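(* Let $(H,\mathcal R)$ be a quasitriangular Hopf algebra with twist $\mathcal F\in H\otimes H$, $\mathcal F^{-1}=\bar f^\alpha\otimes\bar f_\alpha$, let $A$ be a quasi-commutative left $H$-module algebra, and let $V,W,\widetilde V,\widetilde W$ be quasi-commutative left $H$-module $A$-bimodules. Then for all right $A$-linear maps $P\in\mathrm{Hom}_A(V,\widetilde V)$ and $Q\in\mathrm{Hom}_A(W,\widetilde W)$ one has the equality of maps $V_\star\otimes_{A_\star}W_\star\to(\widetilde V\otimes_A\widetilde W)_\star$ $$\varphi_{\widetilde V,\widetilde W}\circ\bigl(D_{\mathcal F}(P)\otimes_{\mathcal R^{\mathcal F}}D_{\mathcal F}(Q)\bigr)=D_{\mathcal F}\bigl((\bar f^\alpha\blacktriangleright P)\otimes_{\mathcal R}(\bar f_\alpha\blacktriangleright Q)\bigr)\circ\varphi_{V,W},$$ where $D_{\mathcal F}(P)\otimes_{\mathcal R^{\mathcal F}}D_{\mathcal F}(Q):V_\star\otimes_{A_\star}W_\star\to\widetilde V_\star\otimes_{A_\star}\widetilde W_\star$, $(\bar f^\alpha\blacktriangleright P)\otimes_{\mathcal R}(\bar f_\alpha\blacktriangleright Q):V\otimes_AW\to\widetilde V\otimes_A\widetilde W$, and $\varphi_{V,W}:V_\star\otimes_{A_\star}W_\star\to(V\otimes_AW)_\star$, $\varphi_{\widetilde V,\widetilde W}:\widetilde V_\star\otimes_{A_\star}\widetilde W_\star\to(\widetilde V\otimes_A\widetilde W)_\star$ are the induced maps.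
   Context: $\mathbb K$ is a commutative ring with unit; modules, algebras (associative, unital) and unadorned tensor products are over $\mathbb K$. For a Hopf algebra $H$ with coproduct $\Delta$, counit $\varepsilon$, antipode $S$, write $\Delta(\xi)=\xi_1\otimes\xi_2$ (sum understood). A quasitriangular Hopf algebra $(H,\mathcal R)$ is a Hopf algebra with an invertible $\mathcal R\in H\otimes H$ satisfying $\xi_2\otimes\xi_1=\mathcal R\,\Delta(\xi)\,\mathcal R^{-1}$, $(\Delta\otimes\mathrm{id})\mathcal R=\mathcal R_{13}\mathcal R_{23}$, $(\mathrm{id}\otimes\Delta)\mathcal R=\mathcal R_{13}\mathcal R_{12}$; write $\mathcal R^{-1}=\bar R^\alpha\otimes\bar R_\alpha$. A left $H$-module algebra is an algebra $A$ with left $H$-action satisfying $\xi\triangleright(ab)=(\xi_1\triangleright a)(\xi_2\triangleright b)$, $\xi\triangleright1=\varepsilon(\xi)1$. A left $H$-module $A$-bimodule is an $A$-bimodule $V$ with left $H$-action satisfying $\xi\triangleright(a\cdot v)=(\xi_1\triangleright a)\cdot(\xi_2\triangleright v)$, $\xi\triangleright(v\cdot a)=(\xi_1\triangleright v)\cdot(\xi_2\triangleright a)$. $A$ is quasi-commutative if $a\tilde a=(\bar R^\alpha\triangleright\tilde a)(\bar R_\alpha\triangleright a)$ for all $a,\tilde a\in A$; $V$ is quasi-commutative if $v\cdot a=(\bar R^\alpha\triangleright a)\cdot(\bar R_\alpha\triangleright v)$ for all $a\in A,v\in V$. $\mathrm{Hom}_A(V,W)$ denotes right $A$-linear (not necessarily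 $H$-equivariant) maps. A twist of $H$ is an invertible $\mathcal F\in H\otimes H$ with $(\mathcal F\otimes 1)(\Delta\otimes\mathrm{id})\mathcal F=(1\otimes\mathcal F)(\mathrm{id}\otimes\Delta)\mathcal F$ and $(\varepsilon\otimes\mathrm{id})\mathcal F=1=(\mathrm{id}\otimes\varepsilon)\mathcal F$. Write $\mathcal F=f^\alpha\otimes f_\alpha$. $H^{\mathcal F}$ is the Hopf algebra with the same algebra structure and counit as $H$, coproduct $\Delta^{\mathcal F}(\xi)=\mathcal F\Delta(\xi)\mathcal F^{-1}=\xi_{1_{\mathcal F}}\otimes\xi_{2_{\mathcal F}}$, antipode $S^{\mathcal F}(\xi)=\chi S(\xi)\chi^{-1}$, $\chi=f^\alpha S(f_\alpha)$; it is quasitriangular with $\mathcal R^{\mathcal F}=\mathcal F_{21}\mathcal R\mathcal F^{-1}$. $A_\star$ is the left $H^{\mathcal F}$-module algebra equal to $A$ as an $H$-module, with product $a\star b=(\bar f^\alpha\triangleright a)(\bar f_\alpha\triangleright b)$; $V_\star$ is the left $H^{\mathcal F}$-module $A_\star$-bimodule equal to $V$ as an $H$-module with $a\star v=(\bar f^\alpha\triangleright a)\cdot(\bar f_\alpha\triangleright v)$, $v\star a=(\bar f^\alpha\triangleright v)\cdot(\bar f_\alpha\triangleright a)$. $V\otimes W$ and $V\otimes_AW$ carry the $H$-action $\xi\triangleright(v\otimes w)=(\xi_1\triangleright v)\otimes(\xi_2\triangleright w)$; $V_\star\otimes_{A_\star}W_\star$ carries the $H^{\mathcal F}$-action defined in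 the same way through $\Delta^{\mathcal F}$. The isomorphism $\varphi_{V,W}:V_\star\otimes_{A_\star}W_\star\to(V\otimes_AW)_\star$ is $v\otimes_{A_\star}w\mapsto(\bar f^\alpha\triangleright v)\otimes_A(\bar f_\alpha\triangleright w)$. For a linear map $P$ between left $H$-modules: $\xi\blacktriangleright P:=\xi_1\triangleright\circ P\circ S(\xi_2)\triangleright$, $\xi\blacktriangleright_{\mathcal F}P:=\xi_{1_{\mathcal F}}\triangleright\circ P\circ S^{\mathcal F}(\xi_{2_{\mathcal F}})\triangleright$, and $D_{\mathcal F}(P):=(\bar f^\alpha\blacktriangleright P)\circ\bar f_\alpha\triangleright$, regarded as a map between the corresponding $\star$-modules ($D_{\mathcal F}$ sends right $A$-linear maps to right $A_\star$-linear maps). For right $A$-linear $P:V\to\widetilde V$, $Q:W\to\widetilde W$ between quasi-commutative bimodules, $P\otimes_{\mathcal R}Q:V\otimes_AW\to\widetilde V\otimes_A\widetilde W$ is the (well defined, right $A$-linear) map $v\otimes_Aw\mapsto P(\bar R^\alpha\triangleright v)\otimes_A(\bar R_\alpha\blacktriangleright Q)(w)$. $\otimes_{\mathcal R^{\mathcal F}}$ is the same construction with $(H^{\mathcal F},\mathcal R^{\mathcal F},A_\star,\blacktriangleright_{\mathcal F})$ in place of $(H,\mathcal R,A,\blacktriangleright)$; it applies since $A_\star$ and the bimodules $V_\star$ etc. are quasi-commutative with respect to $\mathcal R^{\mathcal F}$. *)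

theory Defs
  imports "HOL-Algebra.Algebra"
begin

section \<open>Tensor products\<close>

text \<open>An element of a tensor product is a coset, in the free abelian group on the pairs of elements
  of the two factors, of the subgroup generated by the defining relations.\<close>

type_synonym ('v, 'w) tensor = "('v \<times> 'w \<Rightarrow>\<^sub>0 int) set"

text \<open>\<open>S\<close> is the set of scalars, acting by \<open>r\<close> from the right on \<open>V\<close> and by \<open>l\<close> from the left
  on \<open>W\<close>.\<close>

definition tensor_relations ::
    "'s set \<Rightarrow> ('v \<Rightarrow> 's \<Rightarrow> 'v) \<Rightarrow> ('s \<Rightarrow> 'w \<Rightarrow> 'w) \<Rightarrow> ('v, 'm) ring_scheme \<Rightarrow> ('w, 'n) ring_scheme
      \<Rightarrow> ('v \<times> 'w \<Rightarrow>\<^sub>0 int) set" where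
  "tensor_relations S r l V W =
     {frag_of (v \<oplus>\<^bsub>V\<^esub> v', w) - frag_of (v, w) - frag_of (v', w) | v v' w.
        v \<in> carrier V \<and> v' \<in> carrier V \<and> w \<in> carrier W}
   \<union> {frag_of (v, w \<oplus>\<^bsub>W\<^esub> w') - frag_of (v, w) - frag_of (v, w') | v w w'.
        v \<in> carrier V \<and> w \<in> carrier W \<and> w' \<in> carrier W}
   \<union> {frag_of (r v s, w) - frag_of (v, l s w) | v s w.
        v \<in> carrier V \<and> s \<in> S \<and> w \<in> carrier W}"

definition tensor_quotient ::
    "'s set \<Rightarrow> ('v \<Rightarrow> 's \<Rightarrow> 'v) \<Rightarrow> ('s \<Rightarrow> 'w \<Rightarrow> 'w) \<Rightarrow> ('v, 'm) ring_scheme \<Rightarrow> ('w, 'n) ring_scheme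
      \<Rightarrow> ('v, 'w) tensor monoid" where
  "tensor_quotient S r l V W =
     (let F = free_Abelian_group (carrier V \<times> carrier W)
      in F Mod generate F (tensor_relations S r l V W))"

text \<open>The same group written additively; the multiplicative fields are junk.\<close>

definition tensor_group ::
    "'s set \<Rightarrow> ('v \<Rightarrow> 's \<Rightarrow> 'v) \<Rightarrow> ('s \<Rightarrow> 'w \<Rightarrow> 'w) \<Rightarrow> ('v, 'm) ring_scheme \<Rightarrow> ('w, 'n) ring_scheme
      \<Rightarrow> ('v, 'w) tensor ring" where
  "tensor_group S r l V W =
     (let Q = tensor_quotient S r l V W
      in \<lparr>carrier = carrier Q, monoid.mult = undefined, one = undefined,
          ring.zero = one Q, ring.add = monoid.mult Q\<rparr>)"

text \<open>The zero of a tensor product \<open>T\<close> is the subgroup of relations itself, so that the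
  following is the coset of the generator \<open>(v, w)\<close>.\<close>

definition pure_tensor :: "(('v, 'w) tensor, 'm) ring_scheme \<Rightarrow> 'v \<Rightarrow> 'w \<Rightarrow> ('v, 'w) tensor" where
  "pure_tensor T v w = (\<lambda>c. c + frag_of (v, w)) ` \<zero>\<^bsub>T\<^esub>"

text \<open>The value at \<open>t\<close> of the additive map into \<open>M\<close> induced by a balanced map \<open>f\<close>: for
  \<open>t = x\<^sup>\<alpha> \<otimes> y\<^sub>\<alpha>\<close> this is \<open>f x\<^sup>\<alpha> y\<^sub>\<alpha>\<close>, sum understood. The value is computed on an arbitrary
  representative of \<open>t\<close>, on which it does not depend if \<open>f\<close> is balanced.\<close>

definition tensor_lift ::
    "('m, 'n) ring_scheme \<Rightarrow> ('x \<Rightarrow> 'y \<Rightarrow> 'm) \<Rightarrow> ('x, 'y) tensor \<Rightarrow> 'm" where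
  "tensor_lift M f t =
     (let c = (SOME c. c \<in> t)
      in \<Oplus>\<^bsub>M\<^esub>p \<in> Poly_Mapping.keys c. [Poly_Mapping.lookup c p] \<cdot>\<^bsub>M\<^esub> f (fst p) (snd p))"

text \<open>The tensor product over \<open>K\<close> of two \<open>K\<close>-algebras.\<close>

definition tensor_algebra ::
    "('k, 'l) ring_scheme \<Rightarrow> ('k, 'x, 'm) module_scheme \<Rightarrow> ('k, 'y, 'n) module_scheme
      \<Rightarrow> ('k, ('x, 'y) tensor) module" where
  "tensor_algebra K A B =
     (let T = tensor_group (carrier K) (\<lambda>a k. k \<odot>\<^bsub>A\<^esub> a) (\<lambda>k b. k \<odot>\<^bsub>B\<^esub> b) A B
      in \<lparr>carrier = carrier T,
          monoid.mult = (\<lambda>s t. tensor_lift T (\<lambda>a b. tensor_lift T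
            (\<lambda>a' b'. pure_tensor T (a \<otimes>\<^bsub>A\<^esub> a') (b \<otimes>\<^bsub>B\<^esub> b')) t) s),
          one = pure_tensor T \<one>\<^bsub>A\<^esub> \<one>\<^bsub>B\<^esub>,
          ring.zero = \<zero>\<^bsub>T\<^esub>,
          ring.add = ring.add T,
          smult = (\<lambda>k. tensor_lift T (\<lambda>a b. pure_tensor T (k \<odot>\<^bsub>A\<^esub> a) b))\<rparr>)"


section \<open>Quasitriangular Hopf algebras and twists\<close>

locale unital_algebra = K?: cring K + M?: module K H + H?: ring H
  for K (structure) and H (structure) +
  assumes smult_mult_left:
      "\<lbrakk>k \<in> carrier K; x \<in> carrier H; y \<in> carrier H\<rbrakk>
        \<Longrightarrow> (k \<odot>\<^bsub>H\<^esub> x) \<otimes>\<^bsub>H\<^esub> y = k \<odot>\<^bsub>H\<^esub> (x \<otimes>\<^bsub>H\<^esub> y)"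
    and smult_mult_right:
      "\<lbrakk>k \<in> carrier K; x \<in> carrier H; y \<in> carrier H\<rbrakk>
        \<Longrightarrow> x \<otimes>\<^bsub>H\<^esub> (k \<odot>\<^bsub>H\<^esub> y) = k \<odot>\<^bsub>H\<^esub> (x \<otimes>\<^bsub>H\<^esub> y)"

definition linear_maps ::
    "('k, 'l) ring_scheme \<Rightarrow> ('k, 'v, 'm) module_scheme \<Rightarrow> ('k, 'w, 'n) module_scheme
      \<Rightarrow> ('v \<Rightarrow> 'w) set" where
  "linear_maps K V W =
     {P \<in> carrier V \<rightarrow> carrier W.
        (\<forall>v \<in> carrier V. \<forall>v' \<in> carrier V. P (v \<oplus>\<^bsub>V\<^esub> v') = P v \<oplus>\<^bsub>W\<^esub> P v') \<and>
        (\<forall>k \<in> carrier K. \<forall>v \<in> carrier V. P (k \<odot>\<^bsub>V\<^esub> v) = k \<odot>\<^bsub>W\<^esub> P v)}"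

record ('k, 'h) hopf = "('k, 'h) module" +
  coprod :: "'h \<Rightarrow> ('h, 'h) tensor"
  counit :: "'h \<Rightarrow> 'k"
  antipode :: "'h \<Rightarrow> 'h"

abbreviation tensor2 ::
    "('k, 'l) ring_scheme \<Rightarrow> ('k, 'h, 'm) module_scheme \<Rightarrow> ('k, ('h, 'h) tensor) module" where
  "tensor2 K H \<equiv> tensor_algebra K H H"

text \<open>The threefold tensor power of \<open>H\<close> is bracketed as \<open>H \<otimes> (H \<otimes> H)\<close>.\<close>

abbreviation tensor3 ::
    "('k, 'l) ring_scheme \<Rightarrow> ('k, 'h, 'm) module_scheme
      \<Rightarrow> ('k, ('h, ('h, 'h) tensor) tensor) module" where
  "tensor3 K H \<equiv> tensor_algebra K H (tensor2 K H)"

definition pure3 ::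
    "('k, 'l) ring_scheme \<Rightarrow> ('k, 'h, 'm) module_scheme
      \<Rightarrow> 'h \<Rightarrow> 'h \<Rightarrow> 'h \<Rightarrow> ('h, ('h, 'h) tensor) tensor" where
  "pure3 K H x y z = pure_tensor (tensor3 K H) x (pure_tensor (tensor2 K H) y z)"

definition leg12 ::
    "('k, 'l) ring_scheme \<Rightarrow> ('k, 'h, 'm) module_scheme
      \<Rightarrow> ('h, 'h) tensor \<Rightarrow> ('h, ('h, 'h) tensor) tensor" where
  "leg12 K H = tensor_lift (tensor3 K H) (\<lambda>x y. pure3 K H x y \<one>\<^bsub>H\<^esub>)"

definition leg13 ::
    "('k, 'l) ring_scheme \<Rightarrow> ('k, 'h, 'm) module_scheme
      \<Rightarrow> ('h, 'h) tensor \<Rightarrow> ('h, ('h, 'h) tensor) tensor" where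
  "leg13 K H = tensor_lift (tensor3 K H) (\<lambda>x y. pure3 K H x \<one>\<^bsub>H\<^esub> y)"

definition leg23 ::
    "('k, 'l) ring_scheme \<Rightarrow> ('k, 'h, 'm) module_scheme
      \<Rightarrow> ('h, 'h) tensor \<Rightarrow> ('h, ('h, 'h) tensor) tensor" where
  "leg23 K H = tensor_lift (tensor3 K H) (\<lambda>x y. pure3 K H \<one>\<^bsub>H\<^esub> x y)"

definition flip ::
    "('k, 'l) ring_scheme \<Rightarrow> ('k, 'h, 'm) module_scheme
      \<Rightarrow> ('h, 'h) tensor \<Rightarrow> ('h, 'h) tensor" where
  "flip K H = tensor_lift (tensor2 K H) (\<lambda>x y. pure_tensor (tensor2 K H) y x)"

text \<open>\<open>\<Delta> \<otimes> id\<close> and \<open>id \<otimes> \<Delta>\<close>.\<close>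

definition coprod_left ::
    "('k, 'l) ring_scheme \<Rightarrow> ('k, 'h, 'm) hopf_scheme
      \<Rightarrow> ('h, 'h) tensor \<Rightarrow> ('h, ('h, 'h) tensor) tensor" where
  "coprod_left K H =
     tensor_lift (tensor3 K H)
       (\<lambda>x y. tensor_lift (tensor3 K H) (\<lambda>x1 x2. pure3 K H x1 x2 y) (coprod H x))"

definition coprod_right ::
    "('k, 'l) ring_scheme \<Rightarrow> ('k, 'h, 'm) hopf_scheme
      \<Rightarrow> ('h, 'h) tensor \<Rightarrow> ('h, ('h, 'h) tensor) tensor" where
  "coprod_right K H =
     tensor_lift (tensor3 K H) (\<lambda>x y. pure_tensor (tensor3 K H) x (coprod H y))"

text \<open>\<open>\<epsilon> \<otimes> id\<close> and \<open>id \<otimes> \<epsilon>\<close>, with \<open>K \<otimes> H\<close> and \<open>H \<otimes> K\<close> identified with \<open>H\<close>.\<close>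

definition counit_left :: "('k, 'h, 'm) hopf_scheme \<Rightarrow> ('h, 'h) tensor \<Rightarrow> 'h" where
  "counit_left H = tensor_lift H (\<lambda>x y. counit H x \<odot>\<^bsub>H\<^esub> y)"

definition counit_right :: "('k, 'h, 'm) hopf_scheme \<Rightarrow> ('h, 'h) tensor \<Rightarrow> 'h" where
  "counit_right H = tensor_lift H (\<lambda>x y. counit H y \<odot>\<^bsub>H\<^esub> x)"

locale hopf_algebra = unital_algebra K H for K and H :: "('k, 'h, 'm) hopf_scheme" (structure) +
  assumes coprod_ring_hom: "coprod H \<in> ring_hom H (tensor2 K H)"
    and coprod_smult:
      "\<lbrakk>k \<in> carrier K; \<xi> \<in> carrier H\<rbrakk>
        \<Longrightarrow> coprod H (k \<odot>\<^bsub>H\<^esub> \<xi>) = k \<odot>\<^bsub>tensor2 K H\<^esub> coprod H \<xi>"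
    and counit_ring_hom: "counit H \<in> ring_hom H K"
    and counit_smult:
      "\<lbrakk>k \<in> carrier K; \<xi> \<in> carrier H\<rbrakk> \<Longrightarrow> counit H (k \<odot>\<^bsub>H\<^esub> \<xi>) = k \<otimes>\<^bsub>K\<^esub> counit H \<xi>"
    and coassoc:
      "\<xi> \<in> carrier H \<Longrightarrow> coprod_left K H (coprod H \<xi>) = coprod_right K H (coprod H \<xi>)"
    and counit_left: "\<xi> \<in> carrier H \<Longrightarrow> counit_left H (coprod H \<xi>) = \<xi>"
    and counit_right: "\<xi> \<in> carrier H \<Longrightarrow> counit_right H (coprod H \<xi>) = \<xi>"
    and antipode_linear: "antipode H \<in> linear_maps K H H"
    and antipode_left:
      "\<xi> \<in> carrier H
        \<Longrightarrow> tensor_lift H (\<lambda>x y. antipode H x \<otimes>\<^bsub>H\<^esub> y) (coprod H \<xi>) = counit H \<xi> \<odot>\<^bsub>H\<^esub> \<one>\<^bsub>H\<^esub>"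
    and antipode_right:
      "\<xi> \<in> carrier H
        \<Longrightarrow> tensor_lift H (\<lambda>x y. x \<otimes>\<^bsub>H\<^esub> antipode H y) (coprod H \<xi>) = counit H \<xi> \<odot>\<^bsub>H\<^esub> \<one>\<^bsub>H\<^esub>"

locale quasitriangular_hopf_algebra = hopf_algebra K H
  for K and H :: "('k, 'h, 'm) hopf_scheme" (structure) and R :: "('h, 'h) tensor" +
  assumes R_Units: "R \<in> Units (tensor2 K H)"
    and R_coprod:
      "\<xi> \<in> carrier H
        \<Longrightarrow> flip K H (coprod H \<xi>)
          = R \<otimes>\<^bsub>tensor2 K H\<^esub> coprod H \<xi> \<otimes>\<^bsub>tensor2 K H\<^esub> inv\<^bsub>tensor2 K H\<^esub> R"
    and R_coprod_left: "coprod_left K H R = leg13 K H R \<otimes>\<^bsub>tensor3 K H\<^esub> leg23 K H R"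
    and R_coprod_right: "coprod_right K H R = leg13 K H R \<otimes>\<^bsub>tensor3 K H\<^esub> leg12 K H R"

definition is_twist ::
    "('k, 'l) ring_scheme \<Rightarrow> ('k, 'h, 'm) hopf_scheme \<Rightarrow> ('h, 'h) tensor \<Rightarrow> bool" where
  "is_twist K H F \<longleftrightarrow>
     F \<in> Units (tensor2 K H) \<and>
     leg12 K H F \<otimes>\<^bsub>tensor3 K H\<^esub> coprod_left K H F
       = leg23 K H F \<otimes>\<^bsub>tensor3 K H\<^esub> coprod_right K H F \<and>
     counit_left H F = \<one>\<^bsub>H\<^esub> \<and> counit_right H F = \<one>\<^bsub>H\<^esub>"

definition twist_hopf ::
    "('k, 'l) ring_scheme \<Rightarrow> ('h, 'h) tensor \<Rightarrow> ('k, 'h, 'm) hopf_scheme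
      \<Rightarrow> ('k, 'h, 'm) hopf_scheme" where
  "twist_hopf K F H =
     (let \<chi> = tensor_lift H (\<lambda>x y. x \<otimes>\<^bsub>H\<^esub> antipode H y) F
      in H\<lparr>coprod := \<lambda>\<xi>. F \<otimes>\<^bsub>tensor2 K H\<^esub> coprod H \<xi> \<otimes>\<^bsub>tensor2 K H\<^esub> inv\<^bsub>tensor2 K H\<^esub> F,
           antipode := \<lambda>\<xi>. \<chi> \<otimes>\<^bsub>H\<^esub> antipode H \<xi> \<otimes>\<^bsub>H\<^esub> inv\<^bsub>H\<^esub> \<chi>\<rparr>)"

definition twist_R ::
    "('k, 'l) ring_scheme \<Rightarrow> ('h, 'h) tensor \<Rightarrow> ('k, 'h, 'm) hopf_scheme
      \<Rightarrow> ('h, 'h) tensor \<Rightarrow> ('h, 'h) tensor" where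
  "twist_R K F H R =
     flip K H F \<otimes>\<^bsub>tensor2 K H\<^esub> R \<otimes>\<^bsub>tensor2 K H\<^esub> inv\<^bsub>tensor2 K H\<^esub> F"


section \<open>Module algebras and bimodules\<close>

record ('k, 'h, 'v) hmod = "('k, 'v) module" +
  hact :: "'h \<Rightarrow> 'v \<Rightarrow> 'v"

record ('k, 'h, 'a, 'v) hbimod = "('k, 'h, 'v) hmod" +
  lact :: "'a \<Rightarrow> 'v \<Rightarrow> 'v"
  ract :: "'v \<Rightarrow> 'a \<Rightarrow> 'v"

locale left_hmodule = H: hopf_algebra K H + V: module K V
  for K and H :: "('k, 'h, 'm) hopf_scheme" and V :: "('k, 'h, 'v, 'n) hmod_scheme" +
  assumes hact_linear: "\<xi> \<in> carrier H \<Longrightarrow> hact V \<xi> \<in> linear_maps K V V"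
    and hact_add:
      "\<lbrakk>\<xi> \<in> carrier H; \<zeta> \<in> carrier H; v \<in> carrier V\<rbrakk>
        \<Longrightarrow> hact V (\<xi> \<oplus>\<^bsub>H\<^esub> \<zeta>) v = hact V \<xi> v \<oplus>\<^bsub>V\<^esub> hact V \<zeta> v"
    and hact_smult:
      "\<lbrakk>k \<in> carrier K; \<xi> \<in> carrier H; v \<in> carrier V\<rbrakk>
        \<Longrightarrow> hact V (k \<odot>\<^bsub>H\<^esub> \<xi>) v = k \<odot>\<^bsub>V\<^esub> hact V \<xi> v"
    and hact_mult:
      "\<lbrakk>\<xi> \<in> carrier H; \<zeta> \<in> carrier H; v \<in> carrier V\<rbrakk>
        \<Longrightarrow> hact V (\<xi> \<otimes>\<^bsub>H\<^esub> \<zeta>) v = hact V \<xi> (hact V \<zeta> v)"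
    and hact_one: "v \<in> carrier V \<Longrightarrow> hact V \<one>\<^bsub>H\<^esub> v = v"

locale hmodule_algebra = left_hmodule K H A + A: unital_algebra K A
  for K and H :: "('k, 'h, 'm) hopf_scheme" and A :: "('k, 'h, 'a, 'n) hmod_scheme" +
  assumes hact_algebra_mult:
      "\<lbrakk>\<xi> \<in> carrier H; a \<in> carrier A; b \<in> carrier A\<rbrakk>
        \<Longrightarrow> hact A \<xi> (a \<otimes>\<^bsub>A\<^esub> b)
          = tensor_lift A (\<lambda>x y. hact A x a \<otimes>\<^bsub>A\<^esub> hact A y b) (coprod H \<xi>)"
    and hact_algebra_one:
      "\<xi> \<in> carrier H \<Longrightarrow> hact A \<xi> \<one>\<^bsub>A\<^esub> = counit H \<xi> \<odot>\<^bsub>A\<^esub> \<one>\<^bsub>A\<^esub>"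

locale hmodule_bimodule = A: hmodule_algebra K H A + left_hmodule K H V
  for K and H :: "('k, 'h, 'm) hopf_scheme" and A :: "('k, 'h, 'a, 'n) hmod_scheme"
    and V :: "('k, 'h, 'a, 'v, 'p) hbimod_scheme" +
  assumes lact_linear: "a \<in> carrier A \<Longrightarrow> lact V a \<in> linear_maps K V V"
    and lact_add:
      "\<lbrakk>a \<in> carrier A; b \<in> carrier A; v \<in> carrier V\<rbrakk>
        \<Longrightarrow> lact V (a \<oplus>\<^bsub>A\<^esub> b) v = lact V a v \<oplus>\<^bsub>V\<^esub> lact V b v"
    and lact_smult:
      "\<lbrakk>k \<in> carrier K; a \<in> carrier A; v \<in> carrier V\<rbrakk>
        \<Longrightarrow> lact V (k \<odot>\<^bsub>A\<^esub> a) v = k \<odot>\<^bsub>V\<^esub> lact V a v"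
    and lact_mult:
      "\<lbrakk>a \<in> carrier A; b \<in> carrier A; v \<in> carrier V\<rbrakk>
        \<Longrightarrow> lact V (a \<otimes>\<^bsub>A\<^esub> b) v = lact V a (lact V b v)"
    and lact_one: "v \<in> carrier V \<Longrightarrow> lact V \<one>\<^bsub>A\<^esub> v = v"
    and ract_linear: "a \<in> carrier A \<Longrightarrow> (\<lambda>v. ract V v a) \<in> linear_maps K V V"
    and ract_add:
      "\<lbrakk>a \<in> carrier A; b \<in> carrier A; v \<in> carrier V\<rbrakk>
        \<Longrightarrow> ract V v (a \<oplus>\<^bsub>A\<^esub> b) = ract V v a \<oplus>\<^bsub>V\<^esub> ract V v b"
    and ract_smult:
      "\<lbrakk>k \<in> carrier K; a \<in> carrier A; v \<in> carrier V\<rbrakk>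
        \<Longrightarrow> ract V v (k \<odot>\<^bsub>A\<^esub> a) = k \<odot>\<^bsub>V\<^esub> ract V v a"
    and ract_mult:
      "\<lbrakk>a \<in> carrier A; b \<in> carrier A; v \<in> carrier V\<rbrakk>
        \<Longrightarrow> ract V v (a \<otimes>\<^bsub>A\<^esub> b) = ract V (ract V v a) b"
    and ract_one: "v \<in> carrier V \<Longrightarrow> ract V v \<one>\<^bsub>A\<^esub> = v"
    and lact_ract:
      "\<lbrakk>a \<in> carrier A; b \<in> carrier A; v \<in> carrier V\<rbrakk>
        \<Longrightarrow> ract V (lact V a v) b = lact V a (ract V v b)"
    and hact_lact:
      "\<lbrakk>\<xi> \<in> carrier H; a \<in> carrier A; v \<in> carrier V\<rbrakk>
        \<Longrightarrow> hact V \<xi> (lact V a v)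
          = tensor_lift V (\<lambda>x y. lact V (hact A x a) (hact V y v)) (coprod H \<xi>)"
    and hact_ract:
      "\<lbrakk>\<xi> \<in> carrier H; a \<in> carrier A; v \<in> carrier V\<rbrakk>
        \<Longrightarrow> hact V \<xi> (ract V v a)
          = tensor_lift V (\<lambda>x y. ract V (hact V x v) (hact A y a)) (coprod H \<xi>)"

definition quasi_commutative_algebra ::
    "('k, 'l) ring_scheme \<Rightarrow> ('k, 'h, 'm) hopf_scheme \<Rightarrow> ('h, 'h) tensor
      \<Rightarrow> ('k, 'h, 'a, 'n) hmod_scheme \<Rightarrow> bool" where
  "quasi_commutative_algebra K H R A \<longleftrightarrow>
     (\<forall>a \<in> carrier A. \<forall>b \<in> carrier A.
        a \<otimes>\<^bsub>A\<^esub> b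
          = tensor_lift A (\<lambda>x y. hact A x b \<otimes>\<^bsub>A\<^esub> hact A y a) (inv\<^bsub>tensor2 K H\<^esub> R))"

definition quasi_commutative_bimodule ::
    "('k, 'l) ring_scheme \<Rightarrow> ('k, 'h, 'm) hopf_scheme \<Rightarrow> ('h, 'h) tensor
      \<Rightarrow> ('k, 'h, 'a, 'n) hmod_scheme \<Rightarrow> ('k, 'h, 'a, 'v, 'p) hbimod_scheme \<Rightarrow> bool" where
  "quasi_commutative_bimodule K H R A V \<longleftrightarrow>
     (\<forall>a \<in> carrier A. \<forall>v \<in> carrier V.
        ract V v a
          = tensor_lift V (\<lambda>x y. lact V (hact A x a) (hact V y v)) (inv\<^bsub>tensor2 K H\<^esub> R))"

definition right_linear_maps ::
    "('k, 'l) ring_scheme \<Rightarrow> ('k, 'h, 'a, 'n) hmod_scheme \<Rightarrow> ('k, 'h, 'a, 'v, 'p) hbimod_scheme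
      \<Rightarrow> ('k, 'h, 'a, 'w, 'q) hbimod_scheme \<Rightarrow> ('v \<Rightarrow> 'w) set" where
  "right_linear_maps K A V W =
     {P \<in> linear_maps K V W.
        \<forall>v \<in> carrier V. \<forall>a \<in> carrier A. P (ract V v a) = ract W (P v) a}"

text \<open>\<open>V \<otimes>\<^sub>A W\<close> as a left \<open>H\<close>-module \<open>A\<close>-bimodule. The \<open>K\<close>-balancedness relations need not be
  imposed separately: \<open>k v = v \<cdot> (k 1)\<close> and \<open>k w = (k 1) \<cdot> w\<close>. The multiplicative
  fields are junk.\<close>

definition tensor_bimod ::
    "('k, 'h, 'm) hopf_scheme \<Rightarrow> ('k, 'h, 'a, 'n) hmod_scheme
      \<Rightarrow> ('k, 'h, 'a, 'v, 'p) hbimod_scheme \<Rightarrow> ('k, 'h, 'a, 'w, 'q) hbimod_scheme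
      \<Rightarrow> ('k, 'h, 'a, ('v, 'w) tensor) hbimod" where
  "tensor_bimod H A V W =
     (let T = tensor_group (carrier A) (ract V) (lact W) V W
      in \<lparr>carrier = carrier T, monoid.mult = undefined, one = undefined,
          ring.zero = \<zero>\<^bsub>T\<^esub>, ring.add = ring.add T,
          smult = (\<lambda>k. tensor_lift T (\<lambda>v w. pure_tensor T (k \<odot>\<^bsub>V\<^esub> v) w)),
          hact = (\<lambda>\<xi>. tensor_lift T (\<lambda>v w. tensor_lift T
            (\<lambda>x y. pure_tensor T (hact V x v) (hact W y w)) (coprod H \<xi>))),
          lact = (\<lambda>a. tensor_lift T (\<lambda>v w. pure_tensor T (lact V a v) w)),
          ract = (\<lambda>t a. tensor_lift T (\<lambda>v w. pure_tensor T v (ract W w a)) t)\<rparr>)"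


section \<open>Deformation of modules and of maps\<close>

definition star_algebra ::
    "('k, 'l) ring_scheme \<Rightarrow> ('h, 'h) tensor \<Rightarrow> ('k, 'h, 'm) hopf_scheme
      \<Rightarrow> ('k, 'h, 'a, 'n) hmod_scheme \<Rightarrow> ('k, 'h, 'a, 'n) hmod_scheme" where
  "star_algebra K F H A =
     A\<lparr>monoid.mult := \<lambda>a b.
         tensor_lift A (\<lambda>x y. hact A x a \<otimes>\<^bsub>A\<^esub> hact A y b) (inv\<^bsub>tensor2 K H\<^esub> F)\<rparr>"

definition star_bimod ::
    "('k, 'l) ring_scheme \<Rightarrow> ('h, 'h) tensor \<Rightarrow> ('k, 'h, 'm) hopf_scheme
      \<Rightarrow> ('k, 'h, 'a, 'n) hmod_scheme \<Rightarrow> ('k, 'h, 'a, 'v, 'p) hbimod_scheme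
      \<Rightarrow> ('k, 'h, 'a, 'v, 'p) hbimod_scheme" where
  "star_bimod K F H A V =
     V\<lparr>lact := \<lambda>a v.
         tensor_lift V (\<lambda>x y. lact V (hact A x a) (hact V y v)) (inv\<^bsub>tensor2 K H\<^esub> F),
       ract := \<lambda>v a.
         tensor_lift V (\<lambda>x y. ract V (hact V x v) (hact A y a)) (inv\<^bsub>tensor2 K H\<^esub> F)\<rparr>"

text \<open>\<open>\<phi> : V\<^sub>\<star> \<otimes> W\<^sub>\<star> \<rightarrow> (V \<otimes> W)\<^sub>\<star>\<close>, the left tensor product being over \<open>A\<^sub>\<star>\<close> and the right one
  over \<open>A\<close>.\<close>

definition twist_iso ::
    "('k, 'l) ring_scheme \<Rightarrow> ('h, 'h) tensor \<Rightarrow> ('k, 'h, 'm) hopf_scheme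
      \<Rightarrow> ('k, 'h, 'a, 'n) hmod_scheme \<Rightarrow> ('k, 'h, 'a, 'v, 'p) hbimod_scheme
      \<Rightarrow> ('k, 'h, 'a, 'w, 'q) hbimod_scheme \<Rightarrow> ('v, 'w) tensor \<Rightarrow> ('v, 'w) tensor" where
  "twist_iso K F H A V W =
     (let T = star_bimod K F H A (tensor_bimod H A V W)
      in tensor_lift T (\<lambda>v w. tensor_lift T
           (\<lambda>x y. pure_tensor T (hact V x v) (hact W y w)) (inv\<^bsub>tensor2 K H\<^esub> F)))"

definition adj_act ::
    "('k, 'h, 'm) hopf_scheme \<Rightarrow> ('k, 'h, 'v, 'p) hmod_scheme \<Rightarrow> ('k, 'h, 'w, 'q) hmod_scheme
      \<Rightarrow> 'h \<Rightarrow> ('v \<Rightarrow> 'w) \<Rightarrow> 'v \<Rightarrow> 'w" where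
  "adj_act H V W \<xi> P v =
     tensor_lift W (\<lambda>x y. hact W x (P (hact V (antipode H y) v))) (coprod H \<xi>)"

definition deform ::
    "('k, 'l) ring_scheme \<Rightarrow> ('h, 'h) tensor \<Rightarrow> ('k, 'h, 'm) hopf_scheme
      \<Rightarrow> ('k, 'h, 'v, 'p) hmod_scheme \<Rightarrow> ('k, 'h, 'w, 'q) hmod_scheme
      \<Rightarrow> ('v \<Rightarrow> 'w) \<Rightarrow> 'v \<Rightarrow> 'w" where
  "deform K F H V W P v =
     tensor_lift W (\<lambda>x y. adj_act H V W x P (hact V y v)) (inv\<^bsub>tensor2 K H\<^esub> F)"

text \<open>\<open>P \<otimes>\<^sub>R Q\<close> for \<open>P : V \<rightarrow> V'\<close> and \<open>Q : W \<rightarrow> W'\<close>.\<close>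

definition tensor_R ::
    "('k, 'l) ring_scheme \<Rightarrow> ('k, 'h, 'm) hopf_scheme \<Rightarrow> ('h, 'h) tensor
      \<Rightarrow> ('k, 'h, 'a, 'n) hmod_scheme
      \<Rightarrow> ('k, 'h, 'a, 'v, 'p) hbimod_scheme \<Rightarrow> ('k, 'h, 'a, 'v1, 'p1) hbimod_scheme
      \<Rightarrow> ('k, 'h, 'a, 'w, 'q) hbimod_scheme \<Rightarrow> ('k, 'h, 'a, 'w1, 'q1) hbimod_scheme
      \<Rightarrow> ('v \<Rightarrow> 'v1) \<Rightarrow> ('w \<Rightarrow> 'w1) \<Rightarrow> ('v, 'w) tensor \<Rightarrow> ('v1, 'w1) tensor" where
  "tensor_R K H R A V V' W W' P Q =
     (let T = tensor_bimod H A V' W'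
      in tensor_lift T (\<lambda>v w. tensor_lift T
           (\<lambda>x y. pure_tensor T (P (hact V x v)) (adj_act H W W' y Q w)) (inv\<^bsub>tensor2 K H\<^esub> R)))"

end

theory Submission
  imports Defs
begin

text \<open>Every Sweedler sum is a nested \<open>tensor_lift\<close> of a multilinear map. The adjoint action is
  characterised by \<open>(\<xi>\<^sub>1 \<blacktriangleright> P) \<circ> \<xi>\<^sub>2\<triangleright> = \<xi>\<triangleright> \<circ> P\<close>, because \<open>\<xi>\<^sub>2 S(\<xi>\<^sub>3)\<close> cancels. This gives
  \<open>(\<xi> \<zeta>) \<blacktriangleright> P = \<xi> \<blacktriangleright> (\<zeta> \<blacktriangleright> P)\<close>, right linearity of \<open>\<xi> \<blacktriangleright> P\<close>,
  \<open>\<xi> \<blacktriangleright> (P \<otimes>\<^sub>R Q) = (\<xi>\<^sub>1 \<blacktriangleright> P) \<otimes>\<^sub>R (\<xi>\<^sub>2 \<blacktriangleright> Q)\<close> and \<open>\<xi> \<blacktriangleright>\<^sub>F D(P) = D(\<xi> \<blacktriangleright> P)\<close>. Consequently both sides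
  of the theorem, evaluated at \<open>v \<otimes> w\<close>, have the form \<open>(k \<blacktriangleright> P)(l \<triangleright> v) \<otimes> (m \<blacktriangleright> Q)(n \<triangleright> w)\<close> for elements
  \<open>k \<otimes> l \<otimes> m \<otimes> n\<close> of \<open>H \<otimes> H \<otimes> H \<otimes> H\<close>, and these two elements agree by the cocycle condition,
  by \<open>R\<inverse> \<Delta>\<^sup>o\<^sup>p = \<Delta> R\<inverse>\<close> and by \<open>(R\<^sup>F)\<inverse> = F R\<inverse> F\<^sub>2\<^sub>1\<inverse>\<close>.

  The map \<open>D(P) \<otimes> D(Q)\<close> over the deformed algebra need not be shown to be well defined:
  \<open>tensor_lift\<close> picks the representative of its argument independently of the lifted function, so an
  additive map can be moved inside even if that function is not balanced.\<close>

section \<open>Tensor products of abelian groups\<close>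

text \<open>The antipode is handled by one cancellation principle: bilinear maps \<open>g\<close>
  and \<open>h\<close> with \<open>g(\<xi>\<^sub>1, \<xi>\<^sub>2 v) = h(\<xi>\<^sub>1,
  \<xi>\<^sub>2 v)\<close> for all \<xi> and \<open>v\<close> are equal. An identity of adjoint
  actions can thus be tested after one more leg of a coproduct has been fed into the argument, and
  there the antipodes have cancelled. An obstacle is \<open>HF\<close>, whose antipode is conjugated
  by \<chi>. It stays a bare record with the algebra of \<open>H\<close>; three laws in Sweedler
  form are enough to compare the two adjoint actions: coassociativity, the right counit law and the
  right antipode law. The legs of a fourfold tensor act on \<open>P\<close>, \<open>v\<close>,
  \<open>Q\<close> and \<open>w\<close> in this order. An R-matrix is needed because
  \<open>Q\<close> has to pass \<open>v\<close>, so it concerns the two inner legs only. For this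
  reason the cocycle condition is iterated until these two legs come from a single coproduct
  followed by a single inverse twist; the R-matrix can be commuted past both.\<close>

lemma foldSetD_cong:
  assumes "(A, x) \<in> foldSetD D f e" and "\<And>a. a \<in> A \<Longrightarrow> f a = g a"
  shows "(A, x) \<in> foldSetD D g e"
  using assms
proof (induction rule: foldSetD.induct)
  case (insertI x A y)
  then have "(insert x A, g x y) \<in> foldSetD D g e"
    by (intro foldSetD.insertI) auto
  then show ?case
    using insertI.prems by simp
qed (rule foldSetD.emptyI)

text \<open>Unlike the library's congruence rule, no closure condition is needed.\<close>

lemma finsum_cong_keys:
  assumes "\<And>a. a \<in> A \<Longrightarrow> f a = g a"
  shows "finsum M f A = finsum M g A"
proof -
  let ?h = "ring.add M" and ?D = "carrier M" and ?e = "\<zero>\<^bsub>M\<^esub>"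
  have "(A, x) \<in> foldSetD ?D (?h \<circ> f) ?e \<longleftrightarrow> (A, x) \<in> foldSetD ?D (?h \<circ> g) ?e" for x
    using foldSetD_cong[of A x ?D "?h \<circ> f" ?e "?h \<circ> g"]
      foldSetD_cong[of A x ?D "?h \<circ> g" ?e "?h \<circ> f"] assms
    by auto
  then show ?thesis
    by (simp add: finsum_def finprod_def foldD_def)
qed

text \<open>The deformed tensor product is treated as an abelian group, so additivity is the common
  notion for maps out of it and for maps between modules.\<close>

definition additive_maps :: "('v, 'm) ring_scheme \<Rightarrow> ('w, 'n) ring_scheme \<Rightarrow> ('v \<Rightarrow> 'w) set" where
  "additive_maps V W =
     {f \<in> carrier V \<rightarrow> carrier W.
        \<forall>x \<in> carrier V. \<forall>y \<in> carrier V. f (x \<oplus>\<^bsub>V\<^esub> y) = f x \<oplus>\<^bsub>W\<^esub> f y}"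

lemma additive_mapsI:
  assumes "\<And>x. x \<in> carrier V \<Longrightarrow> f x \<in> carrier W"
    and "\<And>x y. \<lbrakk>x \<in> carrier V; y \<in> carrier V\<rbrakk> \<Longrightarrow> f (x \<oplus>\<^bsub>V\<^esub> y) = f x \<oplus>\<^bsub>W\<^esub> f y"
  shows "f \<in> additive_maps V W"
  using assms by (auto simp: additive_maps_def)

lemma additive_mapsD:
  assumes "f \<in> additive_maps V W"
  shows "x \<in> carrier V \<Longrightarrow> f x \<in> carrier W"
    and "\<lbrakk>x \<in> carrier V; y \<in> carrier V\<rbrakk> \<Longrightarrow> f (x \<oplus>\<^bsub>V\<^esub> y) = f x \<oplus>\<^bsub>W\<^esub> f y"
  using assms by (auto simp: additive_maps_def)

text \<open>The sum inside \<open>tensor_lift\<close> with the representative \<open>c\<close> as an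
  explicit argument, so that facts about it can be proved by induction on formal sums.\<close>

definition formal_eval :: "('m, 'n) ring_scheme \<Rightarrow> ('x \<Rightarrow> 'm) \<Rightarrow> ('x \<Rightarrow>\<^sub>0 int) \<Rightarrow> 'm" where
  "formal_eval M f c = (\<Oplus>\<^bsub>M\<^esub>p \<in> Poly_Mapping.keys c. [Poly_Mapping.lookup c p] \<cdot>\<^bsub>M\<^esub> f p)"

lemma formal_eval_cong:
  assumes "\<And>p. p \<in> Poly_Mapping.keys c \<Longrightarrow> f p = g p"
  shows "formal_eval M f c = formal_eval M g c"
  unfolding formal_eval_def using assms by (intro finsum_cong_keys) simp

section \<open>Evaluation of formal integer sums in an abelian group\<close>

context abelian_group
begin

text \<open>Points outside the support contribute zero multiples. Formal sums with different
  supports can therefore be compared over one index set.\<close>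

lemma formal_eval_superset:
  assumes "finite A" and "Poly_Mapping.keys c \<subseteq> A" and "f \<in> A \<rightarrow> carrier G"
  shows "formal_eval G f c = (\<Oplus>\<^bsub>G\<^esub>p \<in> A. [Poly_Mapping.lookup c p] \<cdot>\<^bsub>G\<^esub> f p)"
  unfolding formal_eval_def
proof (rule add.finprod_mono_neutral_cong_left)
  show "[Poly_Mapping.lookup c p] \<cdot>\<^bsub>G\<^esub> f p = \<zero>\<^bsub>G\<^esub>" if "p \<in> A - Poly_Mapping.keys c" for p
    using that by (simp add: in_keys_iff add_pow_def)
qed (use assms in auto)

lemma formal_eval_closed:
  assumes "f \<in> Poly_Mapping.keys c \<rightarrow> carrier G"
  shows "formal_eval G f c \<in> carrier G"
  unfolding formal_eval_def using assms by (auto intro!: add.finprod_closed)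

lemma formal_eval_add:
  assumes "Poly_Mapping.keys c \<subseteq> A" and "Poly_Mapping.keys d \<subseteq> A" and "f \<in> A \<rightarrow> carrier G"
  shows "formal_eval G f (c + d) = formal_eval G f c \<oplus> formal_eval G f d"
proof -
  let ?B = "Poly_Mapping.keys c \<union> Poly_Mapping.keys d"
  have f: "f \<in> ?B \<rightarrow> carrier G" using assms by auto
  have "formal_eval G f (c + d) = (\<Oplus>p \<in> ?B. [Poly_Mapping.lookup (c + d) p] \<cdot> f p)"
    using f by (intro formal_eval_superset) (auto dest: subsetD[OF keys_add])
  also have "\<dots> = (\<Oplus>p \<in> ?B. [Poly_Mapping.lookup c p] \<cdot> f p \<oplus> [Poly_Mapping.lookup d p] \<cdot> f p)"
    using f by (intro finsum_cong_keys) (auto simp: lookup_add add.int_pow_mult Pi_iff)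
  also have "\<dots> = formal_eval G f c \<oplus> formal_eval G f d"
    using f by (subst add.finprod_multf) (auto simp: formal_eval_superset[of ?B] Pi_iff)
  finally show ?thesis .
qed

lemma formal_eval_frag_of:
  assumes "f p \<in> carrier G"
  shows "formal_eval G f (frag_of p) = f p"
  using assms by (simp add: formal_eval_def keys_frag_of add.finprod_singleton[of p "{p}"])

lemma formal_eval_zero: "formal_eval G f 0 = \<zero>"
  by (simp add: formal_eval_def)

text \<open>The induction rule for formal sums builds them by subtraction, so its inductive step
  calls for this form.\<close>

lemma formal_eval_diff:
  assumes "Poly_Mapping.keys c \<subseteq> A" and "Poly_Mapping.keys d \<subseteq> A" and "f \<in> A \<rightarrow> carrier G"
  shows "formal_eval G f (c - d) = formal_eval G f c \<ominus> formal_eval G f d"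
proof -
  have k: "Poly_Mapping.keys (c - d) \<subseteq> A"
    using assms keys_diff by fastforce
  have cl: "formal_eval G f (c - d) \<in> carrier G" "formal_eval G f d \<in> carrier G"
    using k assms by (auto intro!: formal_eval_closed)
  have "formal_eval G f c = formal_eval G f (c - d) \<oplus> formal_eval G f d"
    using formal_eval_add[OF k assms(2,3)] by simp
  then show ?thesis
    using cl by (simp add: a_minus_def a_assoc r_neg)
qed

lemma additive_map_zero:
  assumes "abelian_group M" and "f \<in> additive_maps M G"
  shows "f \<zero>\<^bsub>M\<^esub> = \<zero>"
proof -
  interpret M: abelian_group M by fact
  have "f \<zero>\<^bsub>M\<^esub> \<oplus> f \<zero>\<^bsub>M\<^esub> = f \<zero>\<^bsub>M\<^esub>" "f \<zero>\<^bsub>M\<^esub> \<in> carrier G"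
    using additive_mapsD[OF assms(2)] M.zero_closed by (metis M.l_zero)+
  then show ?thesis
    using add.r_cancel_one' by metis
qed

lemma additive_map_neg:
  assumes "abelian_group M" and "f \<in> additive_maps M G" and "x \<in> carrier M"
  shows "f (\<ominus>\<^bsub>M\<^esub> x) = \<ominus> f x"
proof -
  interpret M: abelian_group M by fact
  have "f (\<ominus>\<^bsub>M\<^esub> x) \<oplus> f x = \<zero>"
    using additive_mapsD(2)[OF assms(2), of "\<ominus>\<^bsub>M\<^esub> x" x] additive_map_zero[OF assms(1,2)] assms(3)
    by (simp add: M.l_neg)
  then show ?thesis
    using additive_mapsD(1)[OF assms(2)] assms(3) by (metis M.a_inv_closed minus_equality)
qed

lemma additive_map_formal_eval:
  assumes "abelian_group M" and "h \<in> additive_maps M G" and "f \<in> Poly_Mapping.keys c \<rightarrow> carrier M"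
  shows "h (formal_eval M f c) = formal_eval G (h \<circ> f) c"
proof -
  interpret M: abelian_group M by fact
  \<comment> \<open>The induction keeps all supports inside a fixed set; the support of the given
    formal sum is frozen here to serve as that set.\<close>
  define S where "S = Poly_Mapping.keys c"
  then have c: "Poly_Mapping.keys c \<subseteq> S" by simp
  have f: "f \<in> S \<rightarrow> carrier M" "h \<circ> f \<in> S \<rightarrow> carrier G"
    using assms(3) additive_mapsD(1)[OF assms(2)] by (auto simp: Pi_iff S_def)
  from c show ?thesis
  proof (rule free_Abelian_group_induct)
    show "h (formal_eval M f 0) = formal_eval G (h \<circ> f) 0"
      using additive_map_zero[OF assms(1,2)] by (simp add: formal_eval_zero M.formal_eval_zero)
  next
    fix x y
    assume 2: "Poly_Mapping.keys x \<subseteq> S" "Poly_Mapping.keys y \<subseteq> S"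
      "h (formal_eval M f x) = formal_eval G (h \<circ> f) x"
      "h (formal_eval M f y) = formal_eval G (h \<circ> f) y"
    have cl: "formal_eval M f x \<in> carrier M" "formal_eval M f y \<in> carrier M"
      using 2 f by (auto intro!: M.formal_eval_closed)
    have "h (formal_eval M f (x - y)) = h (formal_eval M f x) \<ominus> h (formal_eval M f y)"
      using cl 2(1,2) f
      by (simp add: M.formal_eval_diff[of x S y f] a_minus_def M.minus_eq additive_mapsD(2)[OF assms(2)]
          additive_map_neg[OF assms(1,2)])
    then show "h (formal_eval M f (x - y)) = formal_eval G (h \<circ> f) (x - y)"
      using f 2 by (simp add: formal_eval_diff[of x S y])
  next
    show "h (formal_eval M f (frag_of a)) = formal_eval G (h \<circ> f) (frag_of a)" if "a \<in> S" for a
      using that f by (simp add: M.formal_eval_frag_of formal_eval_frag_of Pi_iff)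
  qed
qed

lemma formal_eval_addf:
  assumes "f \<in> Poly_Mapping.keys c \<rightarrow> carrier G" and "g \<in> Poly_Mapping.keys c \<rightarrow> carrier G"
  shows "formal_eval G (\<lambda>p. f p \<oplus> g p) c = formal_eval G f c \<oplus> formal_eval G g c"
proof -
  have "formal_eval G (\<lambda>p. f p \<oplus> g p) c
      = (\<Oplus>p \<in> Poly_Mapping.keys c. [Poly_Mapping.lookup c p] \<cdot> f p \<oplus> [Poly_Mapping.lookup c p] \<cdot> g p)"
    unfolding formal_eval_def
    using assms by (intro finsum_cong_keys) (auto simp: add.int_pow_distrib Pi_iff)
  then show ?thesis
    using assms unfolding formal_eval_def by (subst (asm) add.finprod_multf) auto
qed

text \<open>Fubini for formal sums. Every exchange of two independent Sweedler sums rests on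
  it.\<close>

lemma formal_eval_swap:
  assumes "\<And>p q. \<lbrakk>p \<in> Poly_Mapping.keys c; q \<in> Poly_Mapping.keys d\<rbrakk> \<Longrightarrow> f p q \<in> carrier G"
  shows "formal_eval G (\<lambda>p. formal_eval G (\<lambda>q. f p q) d) c
       = formal_eval G (\<lambda>q. formal_eval G (\<lambda>p. f p q) c) d"
proof -
  define S where "S = Poly_Mapping.keys c"
  then have c: "Poly_Mapping.keys c \<subseteq> S"
    and f: "\<And>p q. \<lbrakk>p \<in> S; q \<in> Poly_Mapping.keys d\<rbrakk> \<Longrightarrow> f p q \<in> carrier G"
    using assms by auto
  from c show ?thesis
  proof (rule free_Abelian_group_induct)
    show "formal_eval G (\<lambda>p. formal_eval G (\<lambda>q. f p q) d) 0 = formal_eval G (\<lambda>q. formal_eval G (\<lambda>p. f p q) 0) d"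
      by (simp add: formal_eval_zero) (simp add: formal_eval_def)
  next
    fix x y
    assume 2: "Poly_Mapping.keys x \<subseteq> S" "Poly_Mapping.keys y \<subseteq> S"
      "formal_eval G (\<lambda>p. formal_eval G (\<lambda>q. f p q) d) x = formal_eval G (\<lambda>q. formal_eval G (\<lambda>p. f p q) x) d"
      "formal_eval G (\<lambda>p. formal_eval G (\<lambda>q. f p q) d) y = formal_eval G (\<lambda>q. formal_eval G (\<lambda>p. f p q) y) d"
    have cl: "(\<lambda>p. formal_eval G (\<lambda>q. f p q) d) \<in> S \<rightarrow> carrier G"
      using f by (auto intro!: formal_eval_closed)
    have "formal_eval G (\<lambda>q. formal_eval G (\<lambda>p. f p q) (x - y)) d
        = formal_eval G (\<lambda>q. formal_eval G (\<lambda>p. f p q) x \<ominus> formal_eval G (\<lambda>p. f p q) y) d"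
      using f 2 by (intro formal_eval_cong formal_eval_diff) auto
    also have "\<dots> = formal_eval G (\<lambda>q. formal_eval G (\<lambda>p. f p q) x) d
        \<ominus> formal_eval G (\<lambda>q. formal_eval G (\<lambda>p. f p q) y) d"
    proof -
      have c2: "(\<lambda>q. formal_eval G (\<lambda>p. f p q) z) \<in> Poly_Mapping.keys d \<rightarrow> carrier G"
        if "Poly_Mapping.keys z \<subseteq> S" for z
        using f that by (auto intro!: formal_eval_closed)
      \<comment> \<open>Negation is itself an additive map, which takes it out of the outer
        sum.\<close>
      have "(\<lambda>x. \<ominus> x) \<in> additive_maps G G"
        by (intro additive_mapsI) (auto simp: minus_add a_comm)
      from additive_map_formal_eval[OF abelian_group_axioms this c2[OF 2(2)]]
      show ?thesis
        using c2[OF 2(1)] c2[OF 2(2)] unfolding a_minus_def comp_def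
        by (subst formal_eval_addf) auto
    qed
    finally show "formal_eval G (\<lambda>p. formal_eval G (\<lambda>q. f p q) d) (x - y) = formal_eval G (\<lambda>q. formal_eval G (\<lambda>p. f p q) (x - y)) d"
      using 2 cl by (simp add: formal_eval_diff[of x S y])
  next
    show "formal_eval G (\<lambda>p. formal_eval G (\<lambda>q. f p q) d) (frag_of a) = formal_eval G (\<lambda>q. formal_eval G (\<lambda>p. f p q) (frag_of a)) d" if "a \<in> S" for a
      using that f by (subst formal_eval_frag_of) (auto intro!: formal_eval_closed formal_eval_cong simp: formal_eval_frag_of)
  qed
qed

end

section \<open>Balanced maps and the universal property of the tensor product\<close>

definition balanced ::
    "'s set \<Rightarrow> ('v \<Rightarrow> 's \<Rightarrow> 'v) \<Rightarrow> ('s \<Rightarrow> 'w \<Rightarrow> 'w) \<Rightarrow> ('v, 'm) ring_scheme \<Rightarrow> ('w, 'n) ring_scheme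
      \<Rightarrow> ('u, 'p) ring_scheme \<Rightarrow> ('v \<Rightarrow> 'w \<Rightarrow> 'u) \<Rightarrow> bool" where
  "balanced S r l V W M f \<longleftrightarrow>
     (\<forall>v \<in> carrier V. f v \<in> additive_maps W M) \<and>
     (\<forall>w \<in> carrier W. (\<lambda>v. f v w) \<in> additive_maps V M) \<and>
     (\<forall>v \<in> carrier V. \<forall>s \<in> S. \<forall>w \<in> carrier W. f (r v s) w = f v (l s w))"

lemma tensor_lift_formal_eval:
  "tensor_lift M f t = formal_eval M (\<lambda>p. f (fst p) (snd p)) (SOME c. c \<in> t)"
  by (simp add: tensor_lift_def formal_eval_def Let_def)

text \<open>Finite sums and integer multiples see only the additive structure of the codomain.
  Deforming a product or an action leaves that structure alone, so lifts into a deformed module and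
  into the original one agree.\<close>

lemma tensor_lift_codomain:
  assumes "carrier M = carrier N" and "ring.add M = ring.add N" and "\<zero>\<^bsub>M\<^esub> = \<zero>\<^bsub>N\<^esub>"
  shows "tensor_lift M = tensor_lift N"
proof -
  have "Group.pow (add_monoid M) x (k::int) = Group.pow (add_monoid N) x k" for x k
    using assms by (simp add: int_pow_def nat_pow_def m_inv_def Let_def)
  then show ?thesis
    using assms by (intro ext) (simp add: tensor_lift_def Let_def finsum_def finprod_def add_pow_def)
qed

text \<open>\<open>T\<close> is only required to share carrier, addition and zero with the tensor
  group. The same locale thus covers tensor products of algebras, of bimodules and of deformed
  bimodules, whose other operations differ.\<close>

locale tensor_product = V: abelian_group V + W: abelian_group W
  for S :: "'s set" and r :: "'v \<Rightarrow> 's \<Rightarrow> 'v" and l :: "'s \<Rightarrow> 'w \<Rightarrow> 'w"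
    and V :: "('v, 'm) ring_scheme" and W :: "('w, 'n) ring_scheme"
    and T :: "(('v, 'w) tensor, 'p) ring_scheme" +
  assumes r_closed: "\<lbrakk>v \<in> carrier V; s \<in> S\<rbrakk> \<Longrightarrow> r v s \<in> carrier V"
    and l_closed: "\<lbrakk>w \<in> carrier W; s \<in> S\<rbrakk> \<Longrightarrow> l s w \<in> carrier W"
    and carrier_T: "carrier T = carrier (tensor_group S r l V W)"
    and add_T: "ring.add T = ring.add (tensor_group S r l V W)"
    and zero_T: "\<zero>\<^bsub>T\<^esub> = \<zero>\<^bsub>tensor_group S r l V W\<^esub>"
begin

abbreviation F where "F \<equiv> free_Abelian_group (carrier V \<times> carrier W)"
abbreviation N where "N \<equiv> generate F (tensor_relations S r l V W)"
abbreviation cls where "cls c \<equiv> N #>\<^bsub>F\<^esub> c"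

lemma F_comm_group: "comm_group F"
  by (rule abelian_free_Abelian_group)

lemma frag_diff_closed:
  "\<lbrakk>c \<in> carrier F; d \<in> carrier F\<rbrakk> \<Longrightarrow> c - d \<in> carrier F"
  using keys_diff by fastforce

lemma frag_add_closed:
  "\<lbrakk>c \<in> carrier F; d \<in> carrier F\<rbrakk> \<Longrightarrow> c + d \<in> carrier F"
  using keys_add by fastforce

lemma relations_closed: "tensor_relations S r l V W \<subseteq> carrier F"
proof
  fix c assume "c \<in> tensor_relations S r l V W"
  then show "c \<in> carrier F"
    unfolding tensor_relations_def
    by (elim UnE CollectE exE conjE; hypsubst; intro frag_diff_closed; simp add: r_closed l_closed)
qed

lemma N_subgroup: "subgroup N F"
  by (rule group.generate_is_subgroup[OF group_free_Abelian_group relations_closed])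

lemma N_normal: "N \<lhd> F"
  by (rule comm_group.subgroup_imp_normal[OF F_comm_group N_subgroup])

lemma carrier_eq: "carrier T = cls ` carrier F"
  by (simp add: carrier_T tensor_group_def tensor_quotient_def Let_def carrier_FactGroup)

lemma zero_eq: "\<zero>\<^bsub>T\<^esub> = N"
  by (simp add: zero_T tensor_group_def tensor_quotient_def Let_def)

lemma cls_add:
  assumes "c \<in> carrier F" and "d \<in> carrier F"
  shows "cls c \<oplus>\<^bsub>T\<^esub> cls d = cls (c + d)"
  using normal.rcos_sum[OF N_normal assms]
  by (simp add: add_T tensor_group_def tensor_quotient_def Let_def)

lemma cls_closed: "c \<in> carrier F \<Longrightarrow> cls c \<in> carrier T"
  by (simp add: carrier_eq del: carrier_free_Abelian_group_iff)

lemma cls_eqI: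
  assumes "c \<in> carrier F" and "d \<in> carrier F" and "c - d \<in> N"
  shows "cls c = cls d"
proof -
  have "c \<in> cls d"
    using assms by (auto simp: r_coset_def intro!: bexI[of _ "c - d"])
  then show ?thesis
    using group.repr_independence[OF group_free_Abelian_group _ _ N_subgroup] assms by metis
qed

lemma pure_tensor_cls: "pure_tensor T v w = cls (frag_of (v, w))"
  by (auto simp: pure_tensor_def zero_eq r_coset_def)

lemma T_abelian_group: "abelian_group T"
proof -
  interpret Q: comm_group "F Mod N"
    by (rule comm_group.abelian_FactGroup[OF F_comm_group N_subgroup])
  have "carrier T = carrier (F Mod N)" "ring.add T = monoid.mult (F Mod N)" "\<zero>\<^bsub>T\<^esub> = \<one>\<^bsub>F Mod N\<^esub>"
    by (simp_all add: carrier_T add_T zero_T tensor_group_def tensor_quotient_def Let_def)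
  then show ?thesis
    using Q.l_inv_ex by (intro abelian_groupI) (simp_all only: Q.m_closed Q.one_closed Q.m_ac Q.l_one Q.r_one)
qed

sublocale T: abelian_group T
  by (rule T_abelian_group)

lemma pure_tensor_closed:
  assumes "v \<in> carrier V" and "w \<in> carrier W"
  shows "pure_tensor T v w \<in> carrier T"
  using assms by (simp add: pure_tensor_cls cls_closed)

lemma pure_tensor_add_left:
  assumes "v \<in> carrier V" and "v' \<in> carrier V" and "w \<in> carrier W"
  shows "pure_tensor T (v \<oplus>\<^bsub>V\<^esub> v') w = pure_tensor T v w \<oplus>\<^bsub>T\<^esub> pure_tensor T v' w"
proof -
  have "frag_of (v \<oplus>\<^bsub>V\<^esub> v', w) - (frag_of (v, w) + frag_of (v', w)) \<in> N"
    unfolding diff_diff_add[symmetric]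
    using assms by (intro generate.incl) (auto simp: tensor_relations_def)
  then show ?thesis
    using assms cls_eqI[of "frag_of (v \<oplus>\<^bsub>V\<^esub> v', w)" "frag_of (v, w) + frag_of (v', w)"]
    by (simp add: pure_tensor_cls cls_add del: carrier_free_Abelian_group_iff)
      (simp add: frag_add_closed del: carrier_free_Abelian_group_iff)
qed

lemma pure_tensor_add_right:
  assumes "v \<in> carrier V" and "w \<in> carrier W" and "w' \<in> carrier W"
  shows "pure_tensor T v (w \<oplus>\<^bsub>W\<^esub> w') = pure_tensor T v w \<oplus>\<^bsub>T\<^esub> pure_tensor T v w'"
proof -
  have "frag_of (v, w \<oplus>\<^bsub>W\<^esub> w') - (frag_of (v, w) + frag_of (v, w')) \<in> N"
    unfolding diff_diff_add[symmetric]
    using assms by (intro generate.incl) (auto simp: tensor_relations_def)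
  then show ?thesis
    using assms cls_eqI[of "frag_of (v, w \<oplus>\<^bsub>W\<^esub> w')" "frag_of (v, w) + frag_of (v, w')"]
    by (simp add: pure_tensor_cls cls_add del: carrier_free_Abelian_group_iff)
      (simp add: frag_add_closed del: carrier_free_Abelian_group_iff)
qed

lemma pure_tensor_balanced:
  assumes "v \<in> carrier V" and "s \<in> S" and "w \<in> carrier W"
  shows "pure_tensor T (r v s) w = pure_tensor T v (l s w)"
proof -
  have "frag_of (r v s, w) - frag_of (v, l s w) \<in> N"
    using assms by (intro generate.incl) (auto simp: tensor_relations_def)
  then show ?thesis
    using assms r_closed l_closed unfolding pure_tensor_cls by (intro cls_eqI) auto
qed

lemma balanced_pure_tensor: "balanced S r l V W T (pure_tensor T)"
  unfolding balanced_def
  by (auto intro!: additive_mapsI simp: pure_tensor_closed pure_tensor_add_left pure_tensor_add_right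
      pure_tensor_balanced)

lemma pure_tensor_neg:
  assumes "v \<in> carrier V" and "w \<in> carrier W"
  shows "pure_tensor T (\<ominus>\<^bsub>V\<^esub> v) w = \<ominus>\<^bsub>T\<^esub> pure_tensor T v w"
  using T.additive_map_neg[OF V.abelian_group_axioms, of "\<lambda>v. pure_tensor T v w"] assms balanced_pure_tensor
  by (auto simp: balanced_def)

text \<open>A negative coefficient can be absorbed into the left factor of a pure tensor, so closure
  under addition reaches every integer combination of pure tensors.\<close>

lemma tensor_induct [consumes 1, case_names pure add]:
  assumes "t \<in> carrier T"
    and pure: "\<And>v w. \<lbrakk>v \<in> carrier V; w \<in> carrier W\<rbrakk> \<Longrightarrow> P (pure_tensor T v w)"
    and add: "\<And>s t. \<lbrakk>s \<in> carrier T; t \<in> carrier T; P s; P t\<rbrakk> \<Longrightarrow> P (s \<oplus>\<^bsub>T\<^esub> t)"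
  shows "P t"
proof -
  obtain c where t: "t = cls c" and c: "Poly_Mapping.keys c \<subseteq> carrier V \<times> carrier W"
    using assms(1) by (auto simp: carrier_eq)
  have zero: "P \<zero>\<^bsub>T\<^esub>"
  proof -
    have "pure_tensor T \<zero>\<^bsub>V\<^esub> \<zero>\<^bsub>W\<^esub> = \<zero>\<^bsub>T\<^esub>"
      using T.additive_map_zero[OF V.abelian_group_axioms, of "\<lambda>v. pure_tensor T v \<zero>\<^bsub>W\<^esub>"] balanced_pure_tensor
      by (auto simp: balanced_def)
    then show ?thesis using pure[of "\<zero>\<^bsub>V\<^esub>" "\<zero>\<^bsub>W\<^esub>"] by simp
  qed
  \<comment> \<open>The induction on formal sums steps by subtraction; carrying the claim for the
    negative along turns this step into an addition.\<close>
  have "P (cls c) \<and> P (\<ominus>\<^bsub>T\<^esub> cls c)"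
  proof (rule free_Abelian_group_induct[OF c, where P = "\<lambda>c. P (cls c) \<and> P (\<ominus>\<^bsub>T\<^esub> cls c)"])
    have minus_zero: "\<ominus>\<^bsub>T\<^esub> \<zero>\<^bsub>T\<^esub> = \<zero>\<^bsub>T\<^esub>"
      by (rule T.minus_equality) simp_all
    have "cls 0 = \<zero>\<^bsub>T\<^esub>"
      by (simp add: zero_eq r_coset_def)
    then show "P (cls 0) \<and> P (\<ominus>\<^bsub>T\<^esub> cls 0)" using zero by (simp only: minus_zero simp_thms)
  next
    fix x y
    assume 2: "Poly_Mapping.keys x \<subseteq> carrier V \<times> carrier W" "Poly_Mapping.keys y \<subseteq> carrier V \<times> carrier W"
      "P (cls x) \<and> P (\<ominus>\<^bsub>T\<^esub> cls x)" "P (cls y) \<and> P (\<ominus>\<^bsub>T\<^esub> cls y)"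
    have xy: "cls x \<in> carrier T" "cls y \<in> carrier T" "cls (x - y) \<in> carrier T"
      using 2 frag_diff_closed[of x y] cls_closed by auto
    have "cls (x - y) \<oplus>\<^bsub>T\<^esub> cls y = cls x"
      using 2 frag_diff_closed[of x y] by (subst cls_add) auto
    then have eq: "cls (x - y) = cls x \<oplus>\<^bsub>T\<^esub> \<ominus>\<^bsub>T\<^esub> cls y"
      using xy by (metis T.a_assoc T.a_inv_closed T.r_neg T.r_zero)
    show "P (cls (x - y)) \<and> P (\<ominus>\<^bsub>T\<^esub> cls (x - y))"
      using 2 xy add by (simp add: eq T.minus_add T.minus_minus)
  next
    show "P (cls (frag_of a)) \<and> P (\<ominus>\<^bsub>T\<^esub> cls (frag_of a))" if "a \<in> carrier V \<times> carrier W" for a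
      using that pure pure[of "\<ominus>\<^bsub>V\<^esub> fst a" "snd a"] by (auto simp flip: pure_tensor_cls pure_tensor_neg)
  qed
  then show ?thesis by (simp add: t)
qed

lemma tensor_rep:
  assumes "t \<in> carrier T"
  shows "Poly_Mapping.keys (SOME c. c \<in> t) \<subseteq> carrier V \<times> carrier W" and "cls (SOME c. c \<in> t) = t"
proof -
  obtain c where t: "t = cls c" and c: "c \<in> carrier F"
    using assms by (auto simp: carrier_eq)
  have "c \<in> t"
    using c group.rcos_self[OF group_free_Abelian_group c N_subgroup] t by simp
  then have c': "(SOME c. c \<in> t) \<in> cls c"
    unfolding t by (rule someI)
  show "cls (SOME c. c \<in> t) = t"
    using group.repr_independence[OF group_free_Abelian_group c' c N_subgroup] t by simp
  show "Poly_Mapping.keys (SOME c. c \<in> t) \<subseteq> carrier V \<times> carrier W"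
    using subsetD[OF monoid.r_coset_subset_G[OF group.is_monoid[OF group_free_Abelian_group]
        subgroup.subset[OF N_subgroup] c] c'] by simp
qed

lemma tensor_lift_cong:
  assumes "t \<in> carrier T" and "\<And>v w. \<lbrakk>v \<in> carrier V; w \<in> carrier W\<rbrakk> \<Longrightarrow> f v w = g v w"
  shows "tensor_lift M f t = tensor_lift M g t"
  unfolding tensor_lift_formal_eval
  using tensor_rep(1)[OF assms(1)] assms(2) by (intro formal_eval_cong) auto

lemma tensor_lift_closed:
  assumes "abelian_group M" and "t \<in> carrier T"
    and "\<And>v w. \<lbrakk>v \<in> carrier V; w \<in> carrier W\<rbrakk> \<Longrightarrow> f v w \<in> carrier M"
  shows "tensor_lift M f t \<in> carrier M"
  unfolding tensor_lift_formal_eval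
  using tensor_rep(1)[OF assms(2)] assms(3) by (intro abelian_group.formal_eval_closed[OF assms(1)]) auto

lemma additive_map_tensor_lift:
  assumes "abelian_group M" and "abelian_group M'" and "h \<in> additive_maps M M'" and "t \<in> carrier T"
    and "\<And>v w. \<lbrakk>v \<in> carrier V; w \<in> carrier W\<rbrakk> \<Longrightarrow> f v w \<in> carrier M"
  shows "h (tensor_lift M f t) = tensor_lift M' (\<lambda>v w. h (f v w)) t"
  unfolding tensor_lift_formal_eval
  using tensor_rep(1)[OF assms(4)] assms(5)
  by (subst abelian_group.additive_map_formal_eval[OF assms(2,1,3)]) (auto simp: comp_def)

lemma tensor_lift_addf:
  assumes "abelian_group M" and "t \<in> carrier T"
    and "\<And>v w. \<lbrakk>v \<in> carrier V; w \<in> carrier W\<rbrakk> \<Longrightarrow> f v w \<in> carrier M"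
    and "\<And>v w. \<lbrakk>v \<in> carrier V; w \<in> carrier W\<rbrakk> \<Longrightarrow> g v w \<in> carrier M"
  shows "tensor_lift M (\<lambda>v w. f v w \<oplus>\<^bsub>M\<^esub> g v w) t = tensor_lift M f t \<oplus>\<^bsub>M\<^esub> tensor_lift M g t"
  unfolding tensor_lift_formal_eval
  using tensor_rep(1)[OF assms(2)] assms(3,4)
  by (intro abelian_group.formal_eval_addf[OF assms(1)]) auto

text \<open>The formal sums with value zero form a subgroup. Balancedness puts the generating
  relations into it, hence all of \<open>N\<close>.\<close>

lemma formal_eval_relations:
  assumes "abelian_group M" and "balanced S r l V W M f" and "c \<in> N"
  shows "formal_eval M (\<lambda>p. f (fst p) (snd p)) c = \<zero>\<^bsub>M\<^esub>"
proof -
  interpret M: abelian_group M by fact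
  let ?f = "\<lambda>p. f (fst p) (snd p)"
  let ?Z = "{c \<in> carrier F. formal_eval M ?f c = \<zero>\<^bsub>M\<^esub>}"
  have bal: "\<And>v w. v \<in> carrier V \<Longrightarrow> w \<in> carrier W \<Longrightarrow> f v w \<in> carrier M"
    "\<And>v v' w. v \<in> carrier V \<Longrightarrow> v' \<in> carrier V \<Longrightarrow> w \<in> carrier W
      \<Longrightarrow> f (v \<oplus>\<^bsub>V\<^esub> v') w = f v w \<oplus>\<^bsub>M\<^esub> f v' w"
    "\<And>v w w'. v \<in> carrier V \<Longrightarrow> w \<in> carrier W \<Longrightarrow> w' \<in> carrier W
      \<Longrightarrow> f v (w \<oplus>\<^bsub>W\<^esub> w') = f v w \<oplus>\<^bsub>M\<^esub> f v w'"
    "\<And>v s w. v \<in> carrier V \<Longrightarrow> s \<in> S \<Longrightarrow> w \<in> carrier W \<Longrightarrow> f (r v s) w = f v (l s w)"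
    using assms(2) by (auto simp: balanced_def additive_maps_def)
  have f: "?f \<in> carrier V \<times> carrier W \<rightarrow> carrier M"
    using bal(1) by auto
  note diff = M.formal_eval_diff[OF _ _ f]
  have zero_diff: "\<zero>\<^bsub>M\<^esub> \<ominus>\<^bsub>M\<^esub> \<zero>\<^bsub>M\<^esub> = \<zero>\<^bsub>M\<^esub>"
    by (simp add: M.minus_eq)
  have "subgroup ?Z F"
  proof (rule group.subgroupI[OF group_free_Abelian_group])
    show "inv\<^bsub>F\<^esub> a \<in> ?Z" if "a \<in> ?Z" for a
      using that diff[of 0 a] by (auto simp: M.formal_eval_zero zero_diff)
    show "a \<otimes>\<^bsub>F\<^esub> b \<in> ?Z" if "a \<in> ?Z" "b \<in> ?Z" for a b
      using that frag_add_closed[of a b] M.formal_eval_add[OF _ _ f, of a b] by auto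
    have "0 \<in> ?Z"
      by (simp add: M.formal_eval_zero)
    then show "?Z \<noteq> {}" by blast
  qed auto
  moreover have "tensor_relations S r l V W \<subseteq> ?Z"
  proof
    fix c assume c: "c \<in> tensor_relations S r l V W"
    have keys: "Poly_Mapping.keys (frag_of p - frag_of q) \<subseteq> carrier V \<times> carrier W"
      if "p \<in> carrier V \<times> carrier W" "q \<in> carrier V \<times> carrier W" for p q :: "'v \<times> 'w"
      using frag_diff_closed[of "frag_of p" "frag_of q"] that by auto
    have fr: "formal_eval M ?f (frag_of (v, w)) = f v w" if "v \<in> carrier V" "w \<in> carrier W" for v w
      using that bal(1) by (simp add: M.formal_eval_frag_of)
    have canc: "x \<oplus>\<^bsub>M\<^esub> y \<ominus>\<^bsub>M\<^esub> x \<ominus>\<^bsub>M\<^esub> y = \<zero>\<^bsub>M\<^esub>"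
      if "x \<in> carrier M" "y \<in> carrier M" for x y
      using that by (simp add: M.minus_eq M.a_ac M.r_neg M.r_neg2)
        (metis M.a_comm M.a_inv_closed M.r_neg1 M.r_neg)
    have cF: "c \<in> carrier F"
      using c relations_closed by blast
    then show "c \<in> ?Z"
      using c unfolding tensor_relations_def
    proof (elim UnE CollectE exE conjE)
      fix v v' w
      assume "c = frag_of (v \<oplus>\<^bsub>V\<^esub> v', w) - frag_of (v, w) - frag_of (v', w)"
        "v \<in> carrier V" "v' \<in> carrier V" "w \<in> carrier W"
      then show ?thesis
        using cF bal by (simp add: diff keys fr canc keys_frag_of)
    next
      fix v w w'
      assume "c = frag_of (v, w \<oplus>\<^bsub>W\<^esub> w') - frag_of (v, w) - frag_of (v, w')"
        "v \<in> carrier V" "w \<in> carrier W" "w' \<in> carrier W"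
      then show ?thesis
        using cF bal by (simp add: diff keys fr canc keys_frag_of)
    next
      fix v s w
      assume "c = frag_of (r v s, w) - frag_of (v, l s w)"
        "v \<in> carrier V" "s \<in> S" "w \<in> carrier W"
      then show ?thesis
        using cF bal r_closed l_closed by (simp add: diff keys fr keys_frag_of M.r_neg M.minus_eq)
    qed
  qed
  ultimately have "N \<subseteq> ?Z"
    by (intro group.generate_subgroup_incl[OF group_free_Abelian_group]) auto
  then show ?thesis
    using assms(3) by auto
qed

text \<open>The representative chosen by \<open>SOME\<close> differs from \<open>c\<close> by an
  element of \<open>N\<close>, on which the evaluation of a balanced map vanishes.\<close>

lemma tensor_lift_cls:
  assumes "abelian_group M" and "balanced S r l V W M f" and "c \<in> carrier F"
  shows "tensor_lift M f (cls c) = formal_eval M (\<lambda>p. f (fst p) (snd p)) c"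
proof -
  interpret M: abelian_group M by fact
  let ?f = "\<lambda>p. f (fst p) (snd p)" and ?d = "SOME d. d \<in> cls c"
  have f: "?f \<in> carrier V \<times> carrier W \<rightarrow> carrier M"
    using assms(2) by (auto simp: balanced_def additive_maps_def Pi_iff)
  have d: "?d \<in> carrier F" "cls ?d = cls c"
    using tensor_rep[OF cls_closed[OF assms(3)]] by auto
  have "?d \<in> cls c"
    using d group.rcos_self[OF group_free_Abelian_group d(1) N_subgroup] by simp
  then obtain n where n: "n \<in> N" "?d = n + c"
    by (auto simp: r_coset_def)
  moreover have "Poly_Mapping.keys n \<subseteq> carrier V \<times> carrier W"
    using subsetD[OF subgroup.subset[OF N_subgroup] n(1)] by simp
  moreover have "formal_eval M ?f n = \<zero>\<^bsub>M\<^esub>"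
    by (rule formal_eval_relations[OF assms(1,2) n(1)])
  ultimately have "formal_eval M ?f ?d = formal_eval M ?f c"
    using f assms(3) M.formal_eval_add[OF _ _ f, of n c] M.formal_eval_closed[OF subsetD[OF Pi_anti_mono f], of c] by auto
  then show ?thesis
    by (simp add: tensor_lift_formal_eval)
qed

lemma tensor_lift_pure:
  assumes "abelian_group M" and "balanced S r l V W M f" and "v \<in> carrier V" and "w \<in> carrier W"
  shows "tensor_lift M f (pure_tensor T v w) = f v w"
proof -
  have "f v w \<in> carrier M"
    using assms by (auto simp: balanced_def additive_maps_def)
  then show ?thesis
    using assms unfolding pure_tensor_cls
    by (simp add: tensor_lift_cls abelian_group.formal_eval_frag_of[OF assms(1)])
qed

lemma tensor_lift_additive:
  assumes "abelian_group M" and "balanced S r l V W M f"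
  shows "tensor_lift M f \<in> additive_maps T M"
proof (rule additive_mapsI)
  have f: "(\<lambda>p. f (fst p) (snd p)) \<in> carrier V \<times> carrier W \<rightarrow> carrier M"
    using assms(2) by (auto simp: balanced_def additive_maps_def Pi_iff)
  show "tensor_lift M f t \<in> carrier M" if "t \<in> carrier T" for t
    using that f by (auto intro!: tensor_lift_closed[OF assms(1)] simp: Pi_iff)
  show "tensor_lift M f (s \<oplus>\<^bsub>T\<^esub> t) = tensor_lift M f s \<oplus>\<^bsub>M\<^esub> tensor_lift M f t"
    if st: "s \<in> carrier T" "t \<in> carrier T" for s t
  proof -
    obtain c where c: "s = cls c" "c \<in> carrier F"
      using st(1) unfolding carrier_eq by (elim imageE)
    obtain d where d: "t = cls d" "d \<in> carrier F"
      using st(2) unfolding carrier_eq by (elim imageE)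
    show ?thesis
      using c d frag_add_closed[OF c(2) d(2)] abelian_group.formal_eval_add[OF assms(1) _ _ f, of c d]
      by (simp add: cls_add tensor_lift_cls[OF assms])
  qed
qed

lemma additive_maps_eqI:
  assumes "f \<in> additive_maps T M" and "g \<in> additive_maps T M" and "t \<in> carrier T"
    and "\<And>v w. \<lbrakk>v \<in> carrier V; w \<in> carrier W\<rbrakk> \<Longrightarrow> f (pure_tensor T v w) = g (pure_tensor T v w)"
  shows "f t = g t"
  using assms(3)
  by (induction rule: tensor_induct) (simp_all add: assms(4) additive_mapsD[OF assms(1)] additive_mapsD[OF assms(2)])

text \<open>This allows a tensor to be written as the Sweedler sum of its own pure tensors. By the
  universal property, two additive maps that agree on pure tensors coincide.\<close>

lemma tensor_lift_pure_tensor: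
  assumes "t \<in> carrier T"
  shows "tensor_lift T (pure_tensor T) t = t"
proof -
  have "(\<lambda>t. t) \<in> additive_maps T T"
    by (rule additive_mapsI) auto
  from additive_maps_eqI[OF tensor_lift_additive[OF T_abelian_group balanced_pure_tensor] this assms]
  show ?thesis
    using tensor_lift_pure[OF T_abelian_group balanced_pure_tensor] by simp
qed

end

lemma tensor_lift_swap:
  assumes "abelian_group M" and "tensor_product S r l V W T" and "tensor_product S' r' l' V' W' T'"
    and "s \<in> carrier T" and "t \<in> carrier T'"
    and "\<And>v w v' w'. \<lbrakk>v \<in> carrier V; w \<in> carrier W; v' \<in> carrier V'; w' \<in> carrier W'\<rbrakk>
      \<Longrightarrow> f v w v' w' \<in> carrier M"
  shows "tensor_lift M (\<lambda>v w. tensor_lift M (\<lambda>v' w'. f v w v' w') t) s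
       = tensor_lift M (\<lambda>v' w'. tensor_lift M (\<lambda>v w. f v w v' w') s) t"
  unfolding tensor_lift_formal_eval
proof (rule abelian_group.formal_eval_swap[OF assms(1)])
  show "f (fst p) (snd p) (fst q) (snd q) \<in> carrier M"
    if "p \<in> Poly_Mapping.keys (SOME c. c \<in> s)" "q \<in> Poly_Mapping.keys (SOME c. c \<in> t)" for p q
    using that subsetD[OF tensor_product.tensor_rep(1)[OF assms(2,4)], of p]
      subsetD[OF tensor_product.tensor_rep(1)[OF assms(3,5)], of q] assms(6)
    by auto
qed

section \<open>Tensor products of modules and algebras\<close>

lemma linear_mapsI:
  assumes "\<And>x. x \<in> carrier V \<Longrightarrow> f x \<in> carrier W"
    and "\<And>x y. \<lbrakk>x \<in> carrier V; y \<in> carrier V\<rbrakk> \<Longrightarrow> f (x \<oplus>\<^bsub>V\<^esub> y) = f x \<oplus>\<^bsub>W\<^esub> f y"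
    and "\<And>k x. \<lbrakk>k \<in> carrier K; x \<in> carrier V\<rbrakk> \<Longrightarrow> f (k \<odot>\<^bsub>V\<^esub> x) = k \<odot>\<^bsub>W\<^esub> f x"
  shows "f \<in> linear_maps K V W"
  using assms by (auto simp: linear_maps_def)

lemma linear_mapsD:
  assumes "f \<in> linear_maps K V W"
  shows "x \<in> carrier V \<Longrightarrow> f x \<in> carrier W"
    and "\<lbrakk>x \<in> carrier V; y \<in> carrier V\<rbrakk> \<Longrightarrow> f (x \<oplus>\<^bsub>V\<^esub> y) = f x \<oplus>\<^bsub>W\<^esub> f y"
    and "\<lbrakk>k \<in> carrier K; x \<in> carrier V\<rbrakk> \<Longrightarrow> f (k \<odot>\<^bsub>V\<^esub> x) = k \<odot>\<^bsub>W\<^esub> f x"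
  using assms by (auto simp: linear_maps_def)

lemma linear_maps_additive: "f \<in> linear_maps K V W \<Longrightarrow> f \<in> additive_maps V W"
  by (auto simp: linear_maps_def additive_maps_def)

lemma linear_maps_id: "(\<lambda>x. x) \<in> linear_maps K V V"
  by (rule linear_mapsI) auto

lemma linear_maps_comp:
  assumes "f \<in> linear_maps K V W" and "g \<in> linear_maps K U V"
  shows "(\<lambda>x. f (g x)) \<in> linear_maps K U W"
  using assms by (intro linear_mapsI) (simp_all add: linear_mapsD)

lemma (in module) smult_linear: "k \<in> carrier R \<Longrightarrow> (\<lambda>x. k \<odot>\<^bsub>M\<^esub> x) \<in> linear_maps R M M"
  by (rule linear_mapsI)
    (simp_all add: smult_r_distr smult_assoc1[symmetric] m_comm)

lemma (in module) smult_additive: "k \<in> carrier R \<Longrightarrow> (\<lambda>x. k \<odot>\<^bsub>M\<^esub> x) \<in> additive_maps M M"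
  by (rule linear_maps_additive[OF smult_linear])

section \<open>Bilinear maps and the module structure on a tensor product\<close>

definition bilinear_maps ::
    "('k, 'l) ring_scheme \<Rightarrow> ('k, 'v, 'm) module_scheme \<Rightarrow> ('k, 'w, 'n) module_scheme
      \<Rightarrow> ('k, 'u, 'p) module_scheme \<Rightarrow> ('v \<Rightarrow> 'w \<Rightarrow> 'u) set" where
  "bilinear_maps K V W M =
     {f. (\<forall>v \<in> carrier V. (\<lambda>w. f v w) \<in> linear_maps K W M) \<and>
         (\<forall>w \<in> carrier W. (\<lambda>v. f v w) \<in> linear_maps K V M)}"

lemma bilinear_mapsI:
  assumes "\<And>v. v \<in> carrier V \<Longrightarrow> (\<lambda>w. f v w) \<in> linear_maps K W M"
    and "\<And>w. w \<in> carrier W \<Longrightarrow> (\<lambda>v. f v w) \<in> linear_maps K V M"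
  shows "f \<in> bilinear_maps K V W M"
  using assms by (auto simp: bilinear_maps_def)

lemma bilinear_mapsD:
  assumes "f \<in> bilinear_maps K V W M"
  shows "v \<in> carrier V \<Longrightarrow> (\<lambda>w. f v w) \<in> linear_maps K W M"
    and "w \<in> carrier W \<Longrightarrow> (\<lambda>v. f v w) \<in> linear_maps K V M"
    and "\<lbrakk>v \<in> carrier V; w \<in> carrier W\<rbrakk> \<Longrightarrow> f v w \<in> carrier M"
  using assms by (auto simp: bilinear_maps_def linear_mapsD(1))

lemma pure_tensor_codomain: "\<zero>\<^bsub>T\<^esub> = \<zero>\<^bsub>T'\<^esub> \<Longrightarrow> pure_tensor T = pure_tensor T'"
  by (simp add: fun_eq_iff pure_tensor_def)

text \<open>Scalars of \<open>K\<close> must act through elements of \<open>S\<close>: through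
  \<open>k\<close> itself if \<open>S\<close> is the carrier of \<open>K\<close>, and through
  \<open>k 1\<close> if \<open>S\<close> is the carrier of \<open>A\<close>. This makes the tensors
  balanced over \<open>K\<close> in both cases.\<close>

locale module_tensor = tensor_product S r l V W T + V: module K V + W: module K W
  for K :: "('k, 'q) ring_scheme" and S :: "'s set" and r :: "'v \<Rightarrow> 's \<Rightarrow> 'v" and l :: "'s \<Rightarrow> 'w \<Rightarrow> 'w"
    and V :: "('k, 'v, 'm) module_scheme" and W :: "('k, 'w, 'n) module_scheme"
    and T :: "('k, ('v, 'w) tensor, 'p) module_scheme" +
  assumes smult_r: "\<lbrakk>k \<in> carrier K; v \<in> carrier V; s \<in> S\<rbrakk> \<Longrightarrow> k \<odot>\<^bsub>V\<^esub> r v s = r (k \<odot>\<^bsub>V\<^esub> v) s"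
    and smult_scalar:
      "k \<in> carrier K
        \<Longrightarrow> \<exists>s \<in> S. (\<forall>v \<in> carrier V. r v s = k \<odot>\<^bsub>V\<^esub> v) \<and> (\<forall>w \<in> carrier W. l s w = k \<odot>\<^bsub>W\<^esub> w)"
    and smult_T: "k \<odot>\<^bsub>T\<^esub> t = tensor_lift T (\<lambda>v w. pure_tensor T (k \<odot>\<^bsub>V\<^esub> v) w) t"
begin

lemma smult_map_balanced:
  assumes "k \<in> carrier K"
  shows "balanced S r l V W T (\<lambda>v w. pure_tensor T (k \<odot>\<^bsub>V\<^esub> v) w)"
  unfolding balanced_def using assms
  by (auto intro!: additive_mapsI
      simp: pure_tensor_closed pure_tensor_add_left pure_tensor_add_right V.smult_r_distr smult_r
        pure_tensor_balanced)

lemma smult_pure: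
  assumes "k \<in> carrier K" and "v \<in> carrier V" and "w \<in> carrier W"
  shows "k \<odot>\<^bsub>T\<^esub> pure_tensor T v w = pure_tensor T (k \<odot>\<^bsub>V\<^esub> v) w"
  unfolding smult_T
  using assms tensor_lift_pure[OF T_abelian_group smult_map_balanced] by simp

lemma smult_T_additive:
  "k \<in> carrier K \<Longrightarrow> (\<lambda>t. k \<odot>\<^bsub>T\<^esub> t) \<in> additive_maps T T"
  unfolding smult_T by (rule tensor_lift_additive[OF T_abelian_group smult_map_balanced])

lemma T_module: "module K T"
proof (rule moduleI)
  show "cring K" by (rule V.R.is_cring)
  show "abelian_group T" by (rule T_abelian_group)
  note add = additive_mapsD[OF smult_T_additive]
  show "\<one>\<^bsub>K\<^esub> \<odot>\<^bsub>T\<^esub> t = t" if "t \<in> carrier T" for t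
    using that by (induction rule: tensor_induct) (simp_all add: smult_pure add)
  fix k t assume k: "k \<in> carrier K" and t: "t \<in> carrier T"
  show "k \<odot>\<^bsub>T\<^esub> t \<in> carrier T"
    using k t by (rule add(1))
  show "k \<odot>\<^bsub>T\<^esub> (t \<oplus>\<^bsub>T\<^esub> t') = k \<odot>\<^bsub>T\<^esub> t \<oplus>\<^bsub>T\<^esub> k \<odot>\<^bsub>T\<^esub> t'" if "t' \<in> carrier T" for t'
    using k t that by (rule add(2))
  fix k' assume k': "k' \<in> carrier K"
  show "(k \<oplus>\<^bsub>K\<^esub> k') \<odot>\<^bsub>T\<^esub> t = k \<odot>\<^bsub>T\<^esub> t \<oplus>\<^bsub>T\<^esub> k' \<odot>\<^bsub>T\<^esub> t"
    using t
  proof (induction rule: tensor_induct)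
    case (pure v w)
    then show ?case
      using k k' by (simp add: smult_pure V.smult_l_distr pure_tensor_add_left)
  next
    case (add s t)
    then show ?case
      using k k' by (simp add: additive_mapsD[OF smult_T_additive] T.a_ac)
  qed
  show "(k \<otimes>\<^bsub>K\<^esub> k') \<odot>\<^bsub>T\<^esub> t = k \<odot>\<^bsub>T\<^esub> (k' \<odot>\<^bsub>T\<^esub> t)"
    using t
  proof (induction rule: tensor_induct)
    case (pure v w)
    then show ?case
      using k k' by (simp add: smult_pure V.smult_assoc1)
  next
    case (add s t)
    then show ?case
      using k k' by (simp add: additive_mapsD[OF smult_T_additive])
  qed
qed

sublocale T: module K T
  by (rule T_module)

lemma pure_tensor_smult_right:
  assumes "k \<in> carrier K" and "v \<in> carrier V" and "w \<in> carrier W"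
  shows "pure_tensor T v (k \<odot>\<^bsub>W\<^esub> w) = k \<odot>\<^bsub>T\<^esub> pure_tensor T v w"
proof -
  obtain s where "s \<in> S" "r v s = k \<odot>\<^bsub>V\<^esub> v" "l s w = k \<odot>\<^bsub>W\<^esub> w"
    using smult_scalar[OF assms(1)] assms(2,3) by blast
  then show ?thesis
    using pure_tensor_balanced[of v s w] assms by (simp add: smult_pure)
qed

lemma pure_tensor_bilinear: "pure_tensor T \<in> bilinear_maps K V W T"
  by (intro bilinear_mapsI linear_mapsI)
    (simp_all add: pure_tensor_closed pure_tensor_add_left pure_tensor_add_right smult_pure
      pure_tensor_smult_right)

lemma bilinear_balanced:
  assumes "f \<in> bilinear_maps K V W M"
    and "\<And>v s w. \<lbrakk>v \<in> carrier V; s \<in> S; w \<in> carrier W\<rbrakk> \<Longrightarrow> f (r v s) w = f v (l s w)"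
  shows "balanced S r l V W M f"
  using assms by (auto simp: balanced_def bilinear_maps_def linear_maps_additive)

lemma tensor_lift_linear:
  assumes "module K M" and "f \<in> bilinear_maps K V W M" and "balanced S r l V W M f"
  shows "tensor_lift M f \<in> linear_maps K T M"
proof (rule linear_mapsI)
  interpret M: module K M by fact
  note add = additive_mapsD[OF tensor_lift_additive[OF M.abelian_group_axioms assms(3)]]
  note pure = tensor_lift_pure[OF M.abelian_group_axioms assms(3)]
  show "tensor_lift M f t \<in> carrier M" if "t \<in> carrier T" for t
    using that by (rule add(1))
  show "tensor_lift M f (s \<oplus>\<^bsub>T\<^esub> t) = tensor_lift M f s \<oplus>\<^bsub>M\<^esub> tensor_lift M f t"
    if "s \<in> carrier T" "t \<in> carrier T" for s t
    using that by (rule add(2))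
  show "tensor_lift M f (k \<odot>\<^bsub>T\<^esub> t) = k \<odot>\<^bsub>M\<^esub> tensor_lift M f t"
    if k: "k \<in> carrier K" and t: "t \<in> carrier T" for k t
    using t
  proof (induction rule: tensor_induct)
    case (pure v w)
    then show ?case
      using k linear_mapsD(3)[OF bilinear_mapsD(2)[OF assms(2)]] by (simp add: smult_pure assms tensor_lift_pure M.abelian_group_axioms)
  next
    case (add s t)
    then show ?case
      using k by (simp add: T.smult_r_distr M.smult_r_distr additive_mapsD[OF tensor_lift_additive[OF M.abelian_group_axioms assms(3)]])
  qed
qed

text \<open>The representative of \<open>t\<close> does not vary with \<open>x\<close>, so linearity
  in \<open>x\<close> can be checked term by term. This is what makes a Sweedler sum multilinear in
  its free variables.\<close>

lemma tensor_lift_linear_param: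
  assumes "module K M" and "t \<in> carrier T" and "module K U"
    and "\<And>v w. \<lbrakk>v \<in> carrier V; w \<in> carrier W\<rbrakk> \<Longrightarrow> (\<lambda>x. f x v w) \<in> linear_maps K U M"
  shows "(\<lambda>x. tensor_lift M (\<lambda>v w. f x v w) t) \<in> linear_maps K U M"
proof (rule linear_mapsI)
  interpret M: module K M by fact
  interpret U: module K U by fact
  note lin = linear_mapsD[OF assms(4)]
  show "tensor_lift M (\<lambda>v w. f x v w) t \<in> carrier M" if "x \<in> carrier U" for x
    using that assms(2) lin by (intro tensor_lift_closed[OF M.abelian_group_axioms]) auto
  show "tensor_lift M (\<lambda>v w. f (x \<oplus>\<^bsub>U\<^esub> y) v w) t
      = tensor_lift M (\<lambda>v w. f x v w) t \<oplus>\<^bsub>M\<^esub> tensor_lift M (\<lambda>v w. f y v w) t"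
    if "x \<in> carrier U" "y \<in> carrier U" for x y
    using that assms(2) lin
    by (simp flip: tensor_lift_addf[OF M.abelian_group_axioms] cong: tensor_lift_cong)
  show "tensor_lift M (\<lambda>v w. f (k \<odot>\<^bsub>U\<^esub> x) v w) t = k \<odot>\<^bsub>M\<^esub> tensor_lift M (\<lambda>v w. f x v w) t"
    if "k \<in> carrier K" "x \<in> carrier U" for k x
    using that assms(2) lin
    by (subst additive_map_tensor_lift[OF M.abelian_group_axioms M.abelian_group_axioms M.smult_additive])
      (auto intro!: tensor_lift_cong)
qed

end

text \<open>The definition lifts into the bare tensor group. The operations are restated with lifts
  into the algebra itself, so that its module structure can be used on them.\<close>

lemma tensor_algebra_simps:
  fixes K A B
  defines "T \<equiv> tensor_group (carrier K) (\<lambda>a k. k \<odot>\<^bsub>A\<^esub> a) (\<lambda>k b. k \<odot>\<^bsub>B\<^esub> b) A B"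
  shows "carrier (tensor_algebra K A B) = carrier T"
    and "ring.add (tensor_algebra K A B) = ring.add T"
    and "\<zero>\<^bsub>tensor_algebra K A B\<^esub> = \<zero>\<^bsub>T\<^esub>"
    and "s \<otimes>\<^bsub>tensor_algebra K A B\<^esub> t
      = tensor_lift (tensor_algebra K A B) (\<lambda>a b. tensor_lift (tensor_algebra K A B)
          (\<lambda>a' b'. pure_tensor (tensor_algebra K A B) (a \<otimes>\<^bsub>A\<^esub> a') (b \<otimes>\<^bsub>B\<^esub> b')) t) s"
    and "\<one>\<^bsub>tensor_algebra K A B\<^esub> = pure_tensor (tensor_algebra K A B) \<one>\<^bsub>A\<^esub> \<one>\<^bsub>B\<^esub>"
    and "k \<odot>\<^bsub>tensor_algebra K A B\<^esub> t
      = tensor_lift (tensor_algebra K A B) (\<lambda>a b. pure_tensor (tensor_algebra K A B) (k \<odot>\<^bsub>A\<^esub> a) b) t"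
proof -
  have eqs: "carrier (tensor_algebra K A B) = carrier T"
    "ring.add (tensor_algebra K A B) = ring.add T" "\<zero>\<^bsub>tensor_algebra K A B\<^esub> = \<zero>\<^bsub>T\<^esub>"
    by (simp_all add: tensor_algebra_def T_def Let_def)
  then show "carrier (tensor_algebra K A B) = carrier T"
    "ring.add (tensor_algebra K A B) = ring.add T" "\<zero>\<^bsub>tensor_algebra K A B\<^esub> = \<zero>\<^bsub>T\<^esub>"
    by simp_all
  have l': "tensor_lift T = tensor_lift (tensor_algebra K A B)"
    by (rule tensor_lift_codomain) (simp_all add: eqs)
  have p: "pure_tensor T = pure_tensor (tensor_algebra K A B)"
    by (rule pure_tensor_codomain) (simp add: eqs)
  show "s \<otimes>\<^bsub>tensor_algebra K A B\<^esub> t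
      = tensor_lift (tensor_algebra K A B) (\<lambda>a b. tensor_lift (tensor_algebra K A B)
          (\<lambda>a' b'. pure_tensor (tensor_algebra K A B) (a \<otimes>\<^bsub>A\<^esub> a') (b \<otimes>\<^bsub>B\<^esub> b')) t) s"
    "\<one>\<^bsub>tensor_algebra K A B\<^esub> = pure_tensor (tensor_algebra K A B) \<one>\<^bsub>A\<^esub> \<one>\<^bsub>B\<^esub>"
    "k \<odot>\<^bsub>tensor_algebra K A B\<^esub> t
      = tensor_lift (tensor_algebra K A B) (\<lambda>a b. pure_tensor (tensor_algebra K A B) (k \<odot>\<^bsub>A\<^esub> a) b) t"
    by (simp_all flip: l' p) (simp_all add: tensor_algebra_def Let_def flip: T_def)
qed

section \<open>The tensor product of two algebras\<close>

lemma (in unital_algebra) mult_left_linear: "y \<in> carrier H \<Longrightarrow> (\<lambda>x. x \<otimes>\<^bsub>H\<^esub> y) \<in> linear_maps K H H"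
  by (rule linear_mapsI) (simp_all add: H.l_distr smult_mult_left)

lemma (in unital_algebra) mult_right_linear: "x \<in> carrier H \<Longrightarrow> (\<lambda>y. x \<otimes>\<^bsub>H\<^esub> y) \<in> linear_maps K H H"
  by (rule linear_mapsI) (simp_all add: H.r_distr smult_mult_right)

text \<open>The factors may differ because the threefold power is bracketed to the right: the locale
  is used once for \<open>H\<close> and \<open>H\<close>, and then for \<open>H\<close> and their
  tensor square.\<close>

locale algebra_pair = A: unital_algebra K A + B: unital_algebra K B
  for K :: "('k, 'l) ring_scheme" and A :: "('k, 'a, 'm) module_scheme" and B :: "('k, 'b, 'n) module_scheme"
begin

abbreviation AB where "AB \<equiv> tensor_algebra K A B"

sublocale module_tensor K "carrier K" "\<lambda>a k. k \<odot>\<^bsub>A\<^esub> a" "\<lambda>k b. k \<odot>\<^bsub>B\<^esub> b" A B AB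
proof unfold_locales
  show "\<exists>s \<in> carrier K. (\<forall>v \<in> carrier A. s \<odot>\<^bsub>A\<^esub> v = k \<odot>\<^bsub>A\<^esub> v) \<and> (\<forall>w \<in> carrier B. s \<odot>\<^bsub>B\<^esub> w = k \<odot>\<^bsub>B\<^esub> w)"
    if "k \<in> carrier K" for k
    using that by auto
qed (simp_all add: tensor_algebra_simps A.smult_assoc1[symmetric] A.K.m_comm)

lemma bilinear_imp_balanced:
  assumes "f \<in> bilinear_maps K A B M"
  shows "balanced (carrier K) (\<lambda>a k. k \<odot>\<^bsub>A\<^esub> a) (\<lambda>k b. k \<odot>\<^bsub>B\<^esub> b) A B M f"
  using assms linear_mapsD(3)[OF bilinear_mapsD(1)[OF assms]] linear_mapsD(3)[OF bilinear_mapsD(2)[OF assms]]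
  by (intro bilinear_balanced) auto

lemma lift_pure:
  assumes "module K M" and "f \<in> bilinear_maps K A B M" and "a \<in> carrier A" and "b \<in> carrier B"
  shows "tensor_lift M f (pure_tensor AB a b) = f a b"
  using assms by (intro tensor_lift_pure bilinear_imp_balanced) (auto simp: module_def)

lemma lift_linear:
  assumes "module K M" and "f \<in> bilinear_maps K A B M"
  shows "tensor_lift M f \<in> linear_maps K AB M"
  using assms by (intro tensor_lift_linear bilinear_imp_balanced)

lemma lift_linear_arg:
  assumes "module K M" and "f \<in> bilinear_maps K A B M" and "g \<in> linear_maps K U AB"
  shows "(\<lambda>x. tensor_lift M f (g x)) \<in> linear_maps K U M"
  by (rule linear_maps_comp[OF lift_linear[OF assms(1,2)] assms(3)])

lemma linear_tensor_lift:
  assumes "module K M" and "module K M'" and "h \<in> linear_maps K M M'" and "t \<in> carrier AB"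
    and "\<And>v w. \<lbrakk>v \<in> carrier A; w \<in> carrier B\<rbrakk> \<Longrightarrow> f v w \<in> carrier M"
  shows "h (tensor_lift M f t) = tensor_lift M' (\<lambda>v w. h (f v w)) t"
  using assms by (intro additive_map_tensor_lift linear_maps_additive) (auto simp: module_def)

lemma lift_closed:
  assumes "module K M" and "t \<in> carrier AB"
    and "\<And>v w. \<lbrakk>v \<in> carrier A; w \<in> carrier B\<rbrakk> \<Longrightarrow> f v w \<in> carrier M"
  shows "tensor_lift M f t \<in> carrier M"
  using assms by (intro tensor_lift_closed) (auto simp: module_def)

lemma pure_linear_left:
  "\<lbrakk>b \<in> carrier B; g \<in> linear_maps K U A\<rbrakk> \<Longrightarrow> (\<lambda>x. pure_tensor AB (g x) b) \<in> linear_maps K U AB"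
  by (rule linear_maps_comp[OF bilinear_mapsD(2)[OF pure_tensor_bilinear]])

lemma pure_linear_right:
  "\<lbrakk>a \<in> carrier A; g \<in> linear_maps K U B\<rbrakk> \<Longrightarrow> (\<lambda>x. pure_tensor AB a (g x)) \<in> linear_maps K U AB"
  by (rule linear_maps_comp[OF bilinear_mapsD(1)[OF pure_tensor_bilinear]])

lemma mult_fun_bilinear:
  assumes "a \<in> carrier A" and "b \<in> carrier B"
  shows "(\<lambda>a' b'. pure_tensor AB (a \<otimes>\<^bsub>A\<^esub> a') (b \<otimes>\<^bsub>B\<^esub> b')) \<in> bilinear_maps K A B AB"
  using assms
  by (intro bilinear_mapsI pure_linear_left pure_linear_right A.mult_right_linear B.mult_right_linear) auto

lemma mult_fun_bilinear':
  assumes "t \<in> carrier AB"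
  shows "(\<lambda>a b. tensor_lift AB (\<lambda>a' b'. pure_tensor AB (a \<otimes>\<^bsub>A\<^esub> a') (b \<otimes>\<^bsub>B\<^esub> b')) t) \<in> bilinear_maps K A B AB"
  using assms
  by (intro bilinear_mapsI tensor_lift_linear_param T_module A.module_axioms B.module_axioms
      pure_linear_left pure_linear_right A.mult_left_linear B.mult_left_linear) auto

lemma mult_left_linear_AB:
  assumes "t \<in> carrier AB"
  shows "(\<lambda>s. s \<otimes>\<^bsub>AB\<^esub> t) \<in> linear_maps K AB AB"
  unfolding tensor_algebra_simps(4) by (intro lift_linear T_module mult_fun_bilinear' assms)

lemma mult_right_linear_AB:
  assumes "s \<in> carrier AB"
  shows "(\<lambda>t. s \<otimes>\<^bsub>AB\<^esub> t) \<in> linear_maps K AB AB"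
  unfolding tensor_algebra_simps(4)
  by (intro tensor_lift_linear_param T_module assms lift_linear mult_fun_bilinear)

lemma mult_pure:
  assumes "a \<in> carrier A" and "b \<in> carrier B" and "a' \<in> carrier A" and "b' \<in> carrier B"
  shows "pure_tensor AB a b \<otimes>\<^bsub>AB\<^esub> pure_tensor AB a' b' = pure_tensor AB (a \<otimes>\<^bsub>A\<^esub> a') (b \<otimes>\<^bsub>B\<^esub> b')"
proof -
  have "pure_tensor AB a b \<otimes>\<^bsub>AB\<^esub> pure_tensor AB a' b'
      = tensor_lift AB (\<lambda>a' b'. pure_tensor AB (a \<otimes>\<^bsub>A\<^esub> a') (b \<otimes>\<^bsub>B\<^esub> b')) (pure_tensor AB a' b')"
    unfolding tensor_algebra_simps(4)
    by (rule lift_pure[OF T_module mult_fun_bilinear']) (use assms in \<open>simp_all add: pure_tensor_closed\<close>)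
  also have "\<dots> = pure_tensor AB (a \<otimes>\<^bsub>A\<^esub> a') (b \<otimes>\<^bsub>B\<^esub> b')"
    using assms by (intro lift_pure[OF T_module mult_fun_bilinear])
  finally show ?thesis .
qed

lemma AB_unital_algebra: "unital_algebra K AB"
proof -
  note lin_l = linear_mapsD[OF mult_left_linear_AB] and lin_r = linear_mapsD[OF mult_right_linear_AB]
  have one: "\<one>\<^bsub>AB\<^esub> \<in> carrier AB"
    by (simp add: tensor_algebra_simps(5) pure_tensor_closed)
  have monoid: "monoid AB"
  proof (rule monoidI)
    show "\<one>\<^bsub>AB\<^esub> \<otimes>\<^bsub>AB\<^esub> t = t" if "t \<in> carrier AB" for t
      using that
    proof (induction rule: tensor_induct)
      case (pure v w)
      then show ?case
        unfolding tensor_algebra_simps(5) by (simp add: mult_pure)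
    next
      case (add s t)
      then show ?case
        using one by (simp add: lin_r)
    qed
    show "t \<otimes>\<^bsub>AB\<^esub> \<one>\<^bsub>AB\<^esub> = t" if "t \<in> carrier AB" for t
      using that
    proof (induction rule: tensor_induct)
      case (pure v w)
      then show ?case
        unfolding tensor_algebra_simps(5) by (simp add: mult_pure)
    next
      case (add s t)
      then show ?case
        using one by (simp add: lin_l)
    qed
    fix s t u assume s: "s \<in> carrier AB" and t: "t \<in> carrier AB" and u: "u \<in> carrier AB"
    \<comment> \<open>Both sides are additive in each of the three arguments, so three nested
      inductions reduce associativity to pure tensors.\<close>
    from s show "s \<otimes>\<^bsub>AB\<^esub> t \<otimes>\<^bsub>AB\<^esub> u = s \<otimes>\<^bsub>AB\<^esub> (t \<otimes>\<^bsub>AB\<^esub> u)"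
    proof (induction rule: tensor_induct)
      case s: (pure a b)
      from t show ?case
      proof (induction rule: tensor_induct)
        case t: (pure a' b')
        from u show ?case
        proof (induction rule: tensor_induct)
          case (pure a'' b'')
          with s t show ?case
            by (simp add: mult_pure A.H.m_assoc B.H.m_assoc)
        next
          case (add x y)
          with s t show ?case
            by (simp add: lin_r lin_l pure_tensor_closed)
        qed
      next
        case (add x y)
        with s u show ?case
          by (simp add: lin_r lin_l pure_tensor_closed)
      qed
    next
      case (add x y)
      with t u show ?case
        by (simp add: lin_r lin_l)
    qed
  qed (use one lin_l in auto)
  have "ring AB"
    by (rule ringI[OF T_abelian_group monoid]) (simp_all add: lin_l lin_r)
  then show ?thesis
    using T_module A.K.is_cring lin_l(3) lin_r(3)
    by (intro unital_algebra.intro unital_algebra_axioms.intro) simp_all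
qed

text \<open>The product is itself a double lift, and the linear map induced by \<open>f\<close> may
  be moved inside it. Identities between products of tensors become identities of Sweedler sums in
  this way.\<close>

lemma lift_mult:
  assumes "module K M" and "f \<in> bilinear_maps K A B M" and "s \<in> carrier AB" and "t \<in> carrier AB"
  shows "tensor_lift M f (s \<otimes>\<^bsub>AB\<^esub> t)
    = tensor_lift M (\<lambda>a b. tensor_lift M (\<lambda>a' b'. f (a \<otimes>\<^bsub>A\<^esub> a') (b \<otimes>\<^bsub>B\<^esub> b')) t) s"
proof -
  have "tensor_lift M f (s \<otimes>\<^bsub>AB\<^esub> t) = tensor_lift M (\<lambda>a b. tensor_lift M f
      (tensor_lift AB (\<lambda>a' b'. pure_tensor AB (a \<otimes>\<^bsub>A\<^esub> a') (b \<otimes>\<^bsub>B\<^esub> b')) t)) s"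
    unfolding tensor_algebra_simps(4)
    using assms by (intro linear_tensor_lift T_module lift_linear bilinear_mapsD(3)[OF mult_fun_bilinear'])
  also have "\<dots> = tensor_lift M (\<lambda>a b. tensor_lift M (\<lambda>a' b'. f (a \<otimes>\<^bsub>A\<^esub> a') (b \<otimes>\<^bsub>B\<^esub> b')) t) s"
  proof (rule tensor_lift_cong[OF assms(3)])
    fix a b assume ab: "a \<in> carrier A" "b \<in> carrier B"
    have "tensor_lift M f (tensor_lift AB (\<lambda>a' b'. pure_tensor AB (a \<otimes>\<^bsub>A\<^esub> a') (b \<otimes>\<^bsub>B\<^esub> b')) t)
        = tensor_lift M (\<lambda>a' b'. tensor_lift M f (pure_tensor AB (a \<otimes>\<^bsub>A\<^esub> a') (b \<otimes>\<^bsub>B\<^esub> b'))) t"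
      using assms ab by (intro linear_tensor_lift T_module lift_linear) (simp_all add: pure_tensor_closed)
    also have "\<dots> = tensor_lift M (\<lambda>a' b'. f (a \<otimes>\<^bsub>A\<^esub> a') (b \<otimes>\<^bsub>B\<^esub> b')) t"
      using assms ab by (intro tensor_lift_cong) (simp_all add: lift_pure)
    finally show "tensor_lift M f (tensor_lift AB (\<lambda>a' b'. pure_tensor AB (a \<otimes>\<^bsub>A\<^esub> a') (b \<otimes>\<^bsub>B\<^esub> b')) t)
        = tensor_lift M (\<lambda>a' b'. f (a \<otimes>\<^bsub>A\<^esub> a') (b \<otimes>\<^bsub>B\<^esub> b')) t" .
  qed
  finally show ?thesis .
qed

lemma lift_one:
  assumes "module K M" and "f \<in> bilinear_maps K A B M"
  shows "tensor_lift M f \<one>\<^bsub>AB\<^esub> = f \<one>\<^bsub>A\<^esub> \<one>\<^bsub>B\<^esub>"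
  unfolding tensor_algebra_simps(5) by (rule lift_pure[OF assms]) auto

text \<open>Used to show that the leg embeddings, the flip and the coproducts and counits on single
  legs are homomorphisms of algebras.\<close>

lemma lift_multiplicative:
  assumes "unital_algebra K C" and "f \<in> bilinear_maps K A B C"
    and "\<And>a b a' b'. \<lbrakk>a \<in> carrier A; b \<in> carrier B; a' \<in> carrier A; b' \<in> carrier B\<rbrakk>
      \<Longrightarrow> f (a \<otimes>\<^bsub>A\<^esub> a') (b \<otimes>\<^bsub>B\<^esub> b') = f a b \<otimes>\<^bsub>C\<^esub> f a' b'"
    and "s \<in> carrier AB" and "t \<in> carrier AB"
  shows "tensor_lift C f (s \<otimes>\<^bsub>AB\<^esub> t) = tensor_lift C f s \<otimes>\<^bsub>C\<^esub> tensor_lift C f t"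
proof -
  interpret C: unital_algebra K C by fact
  note M = C.M.module_axioms and f = bilinear_mapsD(3)[OF assms(2)]
  note closed = linear_mapsD(1)[OF lift_linear[OF M assms(2)]]
  have "tensor_lift C f (s \<otimes>\<^bsub>AB\<^esub> t) = tensor_lift C (\<lambda>a b. tensor_lift C (\<lambda>a' b'. f a b \<otimes>\<^bsub>C\<^esub> f a' b') t) s"
    unfolding lift_mult[OF M assms(2,4,5)] using assms(3-5) by (intro tensor_lift_cong) auto
  also have "\<dots> = tensor_lift C (\<lambda>a b. f a b \<otimes>\<^bsub>C\<^esub> tensor_lift C f t) s"
    using assms(4,5) f by (intro tensor_lift_cong linear_tensor_lift[symmetric] C.mult_right_linear M) auto
  also have "\<dots> = tensor_lift C f s \<otimes>\<^bsub>C\<^esub> tensor_lift C f t"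
    using assms(4,5) f closed
    by (intro linear_tensor_lift[symmetric, where h = "\<lambda>x. x \<otimes>\<^bsub>C\<^esub> tensor_lift C f t"] C.mult_left_linear M) auto
  finally show ?thesis .
qed

end

section \<open>Hopf algebras\<close>

lemma bilinear_apply_left:
  assumes "f \<in> bilinear_maps K V W M" and "w \<in> carrier W" and "g \<in> linear_maps K U V"
  shows "(\<lambda>x. f (g x) w) \<in> linear_maps K U M"
  by (rule linear_maps_comp[OF bilinear_mapsD(2)[OF assms(1,2)] assms(3)])

lemma bilinear_apply_right:
  assumes "f \<in> bilinear_maps K V W M" and "v \<in> carrier V" and "g \<in> linear_maps K U W"
  shows "(\<lambda>x. f v (g x)) \<in> linear_maps K U M"
  by (rule linear_maps_comp[OF bilinear_mapsD(1)[OF assms(1,2)] assms(3)])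

definition trilinear_maps ::
    "('k, 'l) ring_scheme \<Rightarrow> ('k, 'h, 'm) module_scheme \<Rightarrow> ('k, 'u, 'n) module_scheme
      \<Rightarrow> ('h \<Rightarrow> 'h \<Rightarrow> 'h \<Rightarrow> 'u) set" where
  "trilinear_maps K H M =
     {f. \<forall>x \<in> carrier H. \<forall>y \<in> carrier H.
        (\<lambda>z. f z x y) \<in> linear_maps K H M \<and> (\<lambda>z. f x z y) \<in> linear_maps K H M
        \<and> (\<lambda>z. f x y z) \<in> linear_maps K H M}"

lemma trilinear_mapsI:
  assumes "\<And>x y. \<lbrakk>x \<in> carrier H; y \<in> carrier H\<rbrakk> \<Longrightarrow> (\<lambda>z. f z x y) \<in> linear_maps K H M"
    and "\<And>x y. \<lbrakk>x \<in> carrier H; y \<in> carrier H\<rbrakk> \<Longrightarrow> (\<lambda>z. f x z y) \<in> linear_maps K H M"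
    and "\<And>x y. \<lbrakk>x \<in> carrier H; y \<in> carrier H\<rbrakk> \<Longrightarrow> (\<lambda>z. f x y z) \<in> linear_maps K H M"
  shows "f \<in> trilinear_maps K H M"
  using assms by (auto simp: trilinear_maps_def)

lemma trilinear_apply:
  assumes "f \<in> trilinear_maps K H M" and "x \<in> carrier H" and "y \<in> carrier H" and "g \<in> linear_maps K U H"
  shows "(\<lambda>z. f (g z) x y) \<in> linear_maps K U M" and "(\<lambda>z. f x (g z) y) \<in> linear_maps K U M"
    and "(\<lambda>z. f x y (g z)) \<in> linear_maps K U M"
  using assms
  by (auto simp: trilinear_maps_def intro: linear_maps_comp[of "\<lambda>z. f z x y"]
      linear_maps_comp[of "\<lambda>z. f x z y"] linear_maps_comp[of "\<lambda>z. f x y z"])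

lemma trilinear_closed:
  assumes "f \<in> trilinear_maps K H M" and "x \<in> carrier H" and "y \<in> carrier H" and "z \<in> carrier H"
  shows "f x y z \<in> carrier M"
  using linear_mapsD(1)[OF trilinear_apply(1)[OF assms(1,3,4) linear_maps_id] assms(2)] .

text \<open>Fixing the first argument gives linearity in the last three, and fixing the last one
  gives linearity in the first three; together they cover all four.\<close>

definition quadrilinear_maps ::
    "('k, 'l) ring_scheme \<Rightarrow> ('k, 'h, 'm) module_scheme \<Rightarrow> ('k, 'u, 'n) module_scheme
      \<Rightarrow> ('h \<Rightarrow> 'h \<Rightarrow> 'h \<Rightarrow> 'h \<Rightarrow> 'u) set" where
  "quadrilinear_maps K H M =
     {f. \<forall>x \<in> carrier H. (\<lambda>a b c. f x a b c) \<in> trilinear_maps K H M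
       \<and> (\<lambda>a b c. f a b c x) \<in> trilinear_maps K H M}"

lemma quadrilinear_mapsI:
  assumes "\<And>x y z. \<lbrakk>x \<in> carrier H; y \<in> carrier H; z \<in> carrier H\<rbrakk> \<Longrightarrow> (\<lambda>u. f u x y z) \<in> linear_maps K H M"
    and "\<And>x y z. \<lbrakk>x \<in> carrier H; y \<in> carrier H; z \<in> carrier H\<rbrakk> \<Longrightarrow> (\<lambda>u. f x u y z) \<in> linear_maps K H M"
    and "\<And>x y z. \<lbrakk>x \<in> carrier H; y \<in> carrier H; z \<in> carrier H\<rbrakk> \<Longrightarrow> (\<lambda>u. f x y u z) \<in> linear_maps K H M"
    and "\<And>x y z. \<lbrakk>x \<in> carrier H; y \<in> carrier H; z \<in> carrier H\<rbrakk> \<Longrightarrow> (\<lambda>u. f x y z u) \<in> linear_maps K H M"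
  shows "f \<in> quadrilinear_maps K H M"
  using assms by (auto simp: quadrilinear_maps_def intro!: trilinear_mapsI)

lemma quadrilinear_apply:
  assumes "f \<in> quadrilinear_maps K H M" and "x \<in> carrier H" and "y \<in> carrier H" and "z \<in> carrier H"
    and "g \<in> linear_maps K U H"
  shows "(\<lambda>u. f (g u) x y z) \<in> linear_maps K U M" and "(\<lambda>u. f x (g u) y z) \<in> linear_maps K U M"
    and "(\<lambda>u. f x y (g u) z) \<in> linear_maps K U M" and "(\<lambda>u. f x y z (g u)) \<in> linear_maps K U M"
proof -
  have f: "(\<lambda>a b c. f x a b c) \<in> trilinear_maps K H M" "(\<lambda>a b c. f a b c z) \<in> trilinear_maps K H M"
    using assms by (auto simp: quadrilinear_maps_def)
  show "(\<lambda>u. f (g u) x y z) \<in> linear_maps K U M" "(\<lambda>u. f x (g u) y z) \<in> linear_maps K U M"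
    "(\<lambda>u. f x y (g u) z) \<in> linear_maps K U M" "(\<lambda>u. f x y z (g u)) \<in> linear_maps K U M"
    using trilinear_apply(1)[OF f(2) assms(2,3,5)] trilinear_apply(2)[OF f(2) assms(2,3,5)]
      trilinear_apply(2)[OF f(1) assms(3,4,5)] trilinear_apply(3)[OF f(1) assms(3,4,5)] by auto
qed

lemma quadrilinear_closed:
  assumes "f \<in> quadrilinear_maps K H M" and "x \<in> carrier H" and "y \<in> carrier H" and "z \<in> carrier H"
    and "u \<in> carrier H"
  shows "f x y z u \<in> carrier M"
  using linear_mapsD(1)[OF quadrilinear_apply(1)[OF assms(1,3,4,5) linear_maps_id] assms(2)] .

lemma linear_smult_right:
  assumes "module K M" and "k \<in> carrier K" and "f \<in> linear_maps K U M"
  shows "(\<lambda>x. k \<odot>\<^bsub>M\<^esub> f x) \<in> linear_maps K U M"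
  by (rule linear_maps_comp[OF module.smult_linear[OF assms(1,2)] assms(3)])

sublocale hopf_algebra \<subseteq> HH: algebra_pair K H H
  by (intro algebra_pair.intro unital_algebra_axioms)

sublocale hopf_algebra \<subseteq> HHH: algebra_pair K H "tensor2 K H"
  by (intro algebra_pair.intro unital_algebra_axioms HH.AB_unital_algebra)

context hopf_algebra
begin

abbreviation H2 where "H2 \<equiv> tensor2 K H"
abbreviation H3 where "H3 \<equiv> tensor3 K H"

lemma coprod_linear: "coprod H \<in> linear_maps K H H2"
  using coprod_ring_hom coprod_smult
  by (intro linear_mapsI) (auto simp: ring_hom_closed ring_hom_add)

lemma coprod_closed [simp]: "\<xi> \<in> carrier H \<Longrightarrow> coprod H \<xi> \<in> carrier H2"
  using coprod_linear by (rule linear_mapsD(1))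

lemma coprod_mult:
  "\<lbrakk>\<xi> \<in> carrier H; \<zeta> \<in> carrier H\<rbrakk> \<Longrightarrow> coprod H (\<xi> \<otimes> \<zeta>) = coprod H \<xi> \<otimes>\<^bsub>H2\<^esub> coprod H \<zeta>"
  using coprod_ring_hom by (simp add: ring_hom_mult)

lemma coprod_one: "coprod H \<one> = \<one>\<^bsub>H2\<^esub>"
  using coprod_ring_hom by (simp add: ring_hom_one)

lemma counit_closed [simp]: "\<xi> \<in> carrier H \<Longrightarrow> counit H \<xi> \<in> carrier K"
  using counit_ring_hom by (simp add: ring_hom_closed)

lemma counit_mult:
  "\<lbrakk>\<xi> \<in> carrier H; \<zeta> \<in> carrier H\<rbrakk> \<Longrightarrow> counit H (\<xi> \<otimes> \<zeta>) = counit H \<xi> \<otimes>\<^bsub>K\<^esub> counit H \<zeta>"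
  using counit_ring_hom by (simp add: ring_hom_mult)

lemma counit_one: "counit H \<one> = \<one>\<^bsub>K\<^esub>"
  using counit_ring_hom by (simp add: ring_hom_one)

lemma antipode_closed [simp]: "\<xi> \<in> carrier H \<Longrightarrow> antipode H \<xi> \<in> carrier H"
  using antipode_linear by (rule linear_mapsD(1))

lemma linear_mult_left:
  "\<lbrakk>y \<in> carrier H; g \<in> linear_maps K U H\<rbrakk> \<Longrightarrow> (\<lambda>x. g x \<otimes> y) \<in> linear_maps K U H"
  by (rule linear_maps_comp[OF mult_left_linear])

lemma linear_mult_right:
  "\<lbrakk>y \<in> carrier H; g \<in> linear_maps K U H\<rbrakk> \<Longrightarrow> (\<lambda>x. y \<otimes> g x) \<in> linear_maps K U H"
  by (rule linear_maps_comp[OF mult_right_linear])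

lemma linear_coprod: "g \<in> linear_maps K U H \<Longrightarrow> (\<lambda>x. coprod H (g x)) \<in> linear_maps K U H2"
  by (rule linear_maps_comp[OF coprod_linear])

lemma linear_antipode: "g \<in> linear_maps K U H \<Longrightarrow> (\<lambda>x. antipode H (g x)) \<in> linear_maps K U H"
  by (rule linear_maps_comp[OF antipode_linear])

lemma linear_counit_smult:
  assumes "module K M" and "m \<in> carrier M" and "g \<in> linear_maps K U H"
  shows "(\<lambda>x. counit H (g x) \<odot>\<^bsub>M\<^esub> m) \<in> linear_maps K U M"
proof -
  interpret N: module K M by fact
  have "counit H (x \<oplus> y) = counit H x \<oplus>\<^bsub>K\<^esub> counit H y" if "x \<in> carrier H" "y \<in> carrier H" for x y
    using counit_ring_hom that by (simp add: ring_hom_add)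
  then have "(\<lambda>x. counit H x \<odot>\<^bsub>M\<^esub> m) \<in> linear_maps K H M"
    using assms(2) by (intro linear_mapsI) (simp_all add: N.smult_l_distr counit_smult N.smult_assoc1)
  then show ?thesis
    using assms(3) by (rule linear_maps_comp)
qed

lemma lift_linear_param:
  assumes "module K M" and "module K U" and "t \<in> carrier H2"
    and "\<And>v w. \<lbrakk>v \<in> carrier H; w \<in> carrier H\<rbrakk> \<Longrightarrow> (\<lambda>x. f x v w) \<in> linear_maps K U M"
  shows "(\<lambda>x. tensor_lift M (\<lambda>v w. f x v w) t) \<in> linear_maps K U M"
  using assms by (intro HH.tensor_lift_linear_param)

text \<open>These rules follow the syntax of a nested Sweedler sum, so that \<open>intro\<close>
  reduces multilinearity of a long expression to closure conditions.\<close>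

lemmas linear_rules = linear_maps_id linear_mult_left linear_mult_right linear_coprod linear_antipode
  linear_counit_smult linear_smult_right lift_linear_param HH.lift_linear_arg
  HH.pure_linear_left HH.pure_linear_right HHH.pure_linear_left HHH.pure_linear_right
  bilinear_mapsI trilinear_mapsI quadrilinear_mapsI

lemma lift_cong:
  assumes "t \<in> carrier H2" and "\<And>x y. \<lbrakk>x \<in> carrier H; y \<in> carrier H\<rbrakk> \<Longrightarrow> f x y = g x y"
  shows "tensor_lift M f t = tensor_lift M g t"
  using assms by (rule HH.tensor_lift_cong)

lemma lift_swap:
  assumes "module K M" and "s \<in> carrier H2" and "t \<in> carrier H2"
    and "\<And>x y x' y'. \<lbrakk>x \<in> carrier H; y \<in> carrier H; x' \<in> carrier H; y' \<in> carrier H\<rbrakk>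
      \<Longrightarrow> f x y x' y' \<in> carrier M"
  shows "tensor_lift M (\<lambda>x y. tensor_lift M (\<lambda>x' y'. f x y x' y') t) s
       = tensor_lift M (\<lambda>x' y'. tensor_lift M (\<lambda>x y. f x y x' y') s) t"
  using assms
  by (intro tensor_lift_swap[OF _ HH.tensor_product_axioms HH.tensor_product_axioms]) (auto simp: module_def)

lemma smult_left_commute:
  "\<lbrakk>k \<in> carrier K; k' \<in> carrier K; x \<in> carrier H\<rbrakk> \<Longrightarrow> k \<odot> (k' \<odot> x) = k' \<odot> (k \<odot> x)"
  by (simp add: smult_assoc1[symmetric] K.m_comm)

subsection \<open>Trilinear maps on the threefold tensor power\<close>

text \<open>The order of nesting follows the bracketing of the threefold power to the right.\<close>

definition lift3 :: "('k, 'u, 'n) module_scheme \<Rightarrow> ('h \<Rightarrow> 'h \<Rightarrow> 'h \<Rightarrow> 'u) \<Rightarrow> ('h, ('h, 'h) tensor) tensor \<Rightarrow> 'u" where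
  "lift3 M f t = tensor_lift M (\<lambda>x s. tensor_lift M (\<lambda>y z. f x y z) s) t"

lemma lift3_bilinear:
  assumes "module K M" and "f \<in> trilinear_maps K H M"
  shows "(\<lambda>x s. tensor_lift M (\<lambda>y z. f x y z) s) \<in> bilinear_maps K H H2 M"
  using assms
  by (intro linear_rules trilinear_apply[OF assms(2)] module_axioms) simp_all

lemma lift3_linear:
  assumes "module K M" and "f \<in> trilinear_maps K H M"
  shows "lift3 M f \<in> linear_maps K H3 M"
  unfolding lift3_def[abs_def] by (intro HHH.lift_linear lift3_bilinear assms)

lemma pure3_closed [simp]:
  "\<lbrakk>x \<in> carrier H; y \<in> carrier H; z \<in> carrier H\<rbrakk> \<Longrightarrow> pure3 K H x y z \<in> carrier H3"
  by (simp add: pure3_def HHH.pure_tensor_closed HH.pure_tensor_closed)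

lemma pure3_trilinear: "pure3 K H \<in> trilinear_maps K H H3"
  unfolding pure3_def[abs_def]
  by (intro linear_rules) (simp_all add: HH.pure_tensor_closed)

lemma pure3_mult:
  "\<lbrakk>x \<in> carrier H; y \<in> carrier H; z \<in> carrier H; x' \<in> carrier H; y' \<in> carrier H; z' \<in> carrier H\<rbrakk>
    \<Longrightarrow> pure3 K H x y z \<otimes>\<^bsub>H3\<^esub> pure3 K H x' y' z' = pure3 K H (x \<otimes> x') (y \<otimes> y') (z \<otimes> z')"
  by (simp add: pure3_def HHH.mult_pure HH.mult_pure HH.pure_tensor_closed)

lemma one_H3: "\<one>\<^bsub>H3\<^esub> = pure3 K H \<one> \<one> \<one>"
  by (simp add: pure3_def tensor_algebra_simps(5))

lemma lift3_pure3:
  assumes "module K M" and "f \<in> trilinear_maps K H M"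
    and "x \<in> carrier H" and "y \<in> carrier H" and "z \<in> carrier H"
  shows "lift3 M f (pure3 K H x y z) = f x y z"
proof -
  have f: "(\<lambda>y z. f x y z) \<in> bilinear_maps K H H M"
    using assms by (intro linear_rules trilinear_apply[OF assms(2)]) simp_all
  show ?thesis
    unfolding lift3_def pure3_def
    using assms
    by (simp add: HHH.lift_pure[OF assms(1) lift3_bilinear[OF assms(1,2)]] HH.pure_tensor_closed HH.lift_pure[OF assms(1) f])
qed

text \<open>The product formula applies once for each level of the bracketing. Afterwards the inner
  sum over the legs of \<open>s\<close> has to change places with the outer sum over
  \<open>t\<close>.\<close>

lemma lift3_mult:
  assumes M: "module K M" and f: "f \<in> trilinear_maps K H M"
    and s: "s \<in> carrier H3" and t: "t \<in> carrier H3"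
  shows "lift3 M f (s \<otimes>\<^bsub>H3\<^esub> t)
    = lift3 M (\<lambda>x y z. lift3 M (\<lambda>x' y' z'. f (x \<otimes> x') (y \<otimes> y') (z \<otimes> z')) t) s"
proof -
  have bil: "(\<lambda>y z. f x y z) \<in> bilinear_maps K H H M" if "x \<in> carrier H" for x
    using that by (intro linear_rules trilinear_apply[OF f]) simp_all
  have "lift3 M f (s \<otimes>\<^bsub>H3\<^esub> t) = tensor_lift M (\<lambda>x u. tensor_lift M (\<lambda>x' u'.
      tensor_lift M (\<lambda>y z. f (x \<otimes> x') y z) (u \<otimes>\<^bsub>H2\<^esub> u')) t) s"
    unfolding lift3_def by (rule HHH.lift_mult[OF M lift3_bilinear[OF M f] s t])
  also have "\<dots> = tensor_lift M (\<lambda>x u. tensor_lift M (\<lambda>x' u'. tensor_lift M (\<lambda>y z.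
      tensor_lift M (\<lambda>y' z'. f (x \<otimes> x') (y \<otimes> y') (z \<otimes> z')) u') u) t) s"
    by (intro HHH.tensor_lift_cong s t) (simp add: HH.lift_mult[OF M bil])
  also have "\<dots> = tensor_lift M (\<lambda>x u. tensor_lift M (\<lambda>y z. tensor_lift M (\<lambda>x' u'.
      tensor_lift M (\<lambda>y' z'. f (x \<otimes> x') (y \<otimes> y') (z \<otimes> z')) u') t) u) s"
    using M by (intro HHH.tensor_lift_cong[OF s]
        tensor_lift_swap[OF _ HHH.tensor_product_axioms HH.tensor_product_axioms t] HH.lift_closed[OF M])
      (auto simp: module_def intro!: trilinear_closed[OF f])
  finally show ?thesis
    by (simp add: lift3_def)
qed

lemma lift3_cong:
  assumes "t \<in> carrier H3"
    and "\<And>x y z. \<lbrakk>x \<in> carrier H; y \<in> carrier H; z \<in> carrier H\<rbrakk> \<Longrightarrow> f x y z = g x y z"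
  shows "lift3 M f t = lift3 M g t"
  unfolding lift3_def using assms by (intro HHH.tensor_lift_cong HH.tensor_lift_cong) auto

lemma legs_bilinear:
  shows "(\<lambda>x y. pure3 K H x y \<one>) \<in> bilinear_maps K H H H3"
    and "(\<lambda>x y. pure3 K H x \<one> y) \<in> bilinear_maps K H H H3"
    and "(\<lambda>x y. pure3 K H \<one> x y) \<in> bilinear_maps K H H H3"
    and "(\<lambda>x y. tensor_lift H3 (\<lambda>x1 x2. pure3 K H x1 x2 y) (coprod H x)) \<in> bilinear_maps K H H H3"
    and "(\<lambda>x y. pure_tensor H3 x (coprod H y)) \<in> bilinear_maps K H H H3"
    and "(\<lambda>x y. pure_tensor H2 y x) \<in> bilinear_maps K H H H2"
    and "(\<lambda>x y. counit H x \<odot> y) \<in> bilinear_maps K H H H"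
    and "(\<lambda>x y. counit H y \<odot> x) \<in> bilinear_maps K H H H"
  by (intro linear_rules trilinear_apply[OF pure3_trilinear] HHH.T_module module_axioms; simp)+

lemma legs_closed:
  assumes "t \<in> carrier H2"
  shows "leg12 K H t \<in> carrier H3" and "leg13 K H t \<in> carrier H3" and "leg23 K H t \<in> carrier H3"
    and "coprod_left K H t \<in> carrier H3" and "coprod_right K H t \<in> carrier H3"
    and "flip K H t \<in> carrier H2"
    and "counit_left H t \<in> carrier H" and "counit_right H t \<in> carrier H"
  unfolding leg12_def leg13_def leg23_def coprod_left_def coprod_right_def flip_def counit_left_def counit_right_def
  using assms linear_mapsD(1)[OF HH.lift_linear[OF HHH.T_module legs_bilinear(1)]]
    linear_mapsD(1)[OF HH.lift_linear[OF HHH.T_module legs_bilinear(2)]]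
    linear_mapsD(1)[OF HH.lift_linear[OF HHH.T_module legs_bilinear(3)]]
    linear_mapsD(1)[OF HH.lift_linear[OF HHH.T_module legs_bilinear(4)]]
    linear_mapsD(1)[OF HH.lift_linear[OF HHH.T_module legs_bilinear(5)]]
    linear_mapsD(1)[OF HH.lift_linear[OF HH.T_module legs_bilinear(6)]]
    linear_mapsD(1)[OF HH.lift_linear[OF module_axioms legs_bilinear(7)]]
    linear_mapsD(1)[OF HH.lift_linear[OF module_axioms legs_bilinear(8)]]
  by simp_all

lemma legs_one:
  shows "leg12 K H \<one>\<^bsub>H2\<^esub> = \<one>\<^bsub>H3\<^esub>" and "leg13 K H \<one>\<^bsub>H2\<^esub> = \<one>\<^bsub>H3\<^esub>" and "leg23 K H \<one>\<^bsub>H2\<^esub> = \<one>\<^bsub>H3\<^esub>"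
    and "coprod_left K H \<one>\<^bsub>H2\<^esub> = \<one>\<^bsub>H3\<^esub>" and "coprod_right K H \<one>\<^bsub>H2\<^esub> = \<one>\<^bsub>H3\<^esub>"
    and "flip K H \<one>\<^bsub>H2\<^esub> = \<one>\<^bsub>H2\<^esub>"
    and "counit_left H \<one>\<^bsub>H2\<^esub> = \<one>" and "counit_right H \<one>\<^bsub>H2\<^esub> = \<one>"
proof -
  have b: "(\<lambda>x y. pure3 K H x y \<one>) \<in> bilinear_maps K H H H3"
    by (rule legs_bilinear)
  show "leg12 K H \<one>\<^bsub>H2\<^esub> = \<one>\<^bsub>H3\<^esub>" "leg13 K H \<one>\<^bsub>H2\<^esub> = \<one>\<^bsub>H3\<^esub>" "leg23 K H \<one>\<^bsub>H2\<^esub> = \<one>\<^bsub>H3\<^esub>"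
    "coprod_left K H \<one>\<^bsub>H2\<^esub> = \<one>\<^bsub>H3\<^esub>" "coprod_right K H \<one>\<^bsub>H2\<^esub> = \<one>\<^bsub>H3\<^esub>"
    unfolding leg12_def leg13_def leg23_def coprod_left_def coprod_right_def
      HH.lift_one[OF HHH.T_module legs_bilinear(1)] HH.lift_one[OF HHH.T_module legs_bilinear(2)]
      HH.lift_one[OF HHH.T_module legs_bilinear(3)] HH.lift_one[OF HHH.T_module legs_bilinear(4)]
      HH.lift_one[OF HHH.T_module legs_bilinear(5)] coprod_one
    by (simp_all only: HH.lift_one[OF HHH.T_module b] one_H3 pure3_def tensor_algebra_simps(5))
  show "flip K H \<one>\<^bsub>H2\<^esub> = \<one>\<^bsub>H2\<^esub>"
    unfolding flip_def HH.lift_one[OF HH.T_module legs_bilinear(6)] by (simp only: tensor_algebra_simps(5))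
  show "counit_left H \<one>\<^bsub>H2\<^esub> = \<one>" "counit_right H \<one>\<^bsub>H2\<^esub> = \<one>"
    unfolding counit_left_def counit_right_def
    by (simp_all add: HH.lift_one[OF module_axioms] legs_bilinear counit_one)
qed

text \<open>With \<open>legs_one\<close>, multiplicativity carries inverses in \<open>H2\<close>
  over to each leg map, so that the equations for \<open>R\<close> and for the twist can be inverted
  in \<open>H3\<close>.\<close>

lemma legs_mult:
  assumes s: "s \<in> carrier H2" and t: "t \<in> carrier H2"
  shows "leg12 K H (s \<otimes>\<^bsub>H2\<^esub> t) = leg12 K H s \<otimes>\<^bsub>H3\<^esub> leg12 K H t"
    and "leg13 K H (s \<otimes>\<^bsub>H2\<^esub> t) = leg13 K H s \<otimes>\<^bsub>H3\<^esub> leg13 K H t"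
    and "leg23 K H (s \<otimes>\<^bsub>H2\<^esub> t) = leg23 K H s \<otimes>\<^bsub>H3\<^esub> leg23 K H t"
    and "coprod_left K H (s \<otimes>\<^bsub>H2\<^esub> t) = coprod_left K H s \<otimes>\<^bsub>H3\<^esub> coprod_left K H t"
    and "coprod_right K H (s \<otimes>\<^bsub>H2\<^esub> t) = coprod_right K H s \<otimes>\<^bsub>H3\<^esub> coprod_right K H t"
    and "flip K H (s \<otimes>\<^bsub>H2\<^esub> t) = flip K H s \<otimes>\<^bsub>H2\<^esub> flip K H t"
    and "counit_left H (s \<otimes>\<^bsub>H2\<^esub> t) = counit_left H s \<otimes> counit_left H t"
    and "counit_right H (s \<otimes>\<^bsub>H2\<^esub> t) = counit_right H s \<otimes> counit_right H t"
proof -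
  show "leg12 K H (s \<otimes>\<^bsub>H2\<^esub> t) = leg12 K H s \<otimes>\<^bsub>H3\<^esub> leg12 K H t"
    "leg13 K H (s \<otimes>\<^bsub>H2\<^esub> t) = leg13 K H s \<otimes>\<^bsub>H3\<^esub> leg13 K H t"
    "leg23 K H (s \<otimes>\<^bsub>H2\<^esub> t) = leg23 K H s \<otimes>\<^bsub>H3\<^esub> leg23 K H t"
    unfolding leg12_def leg13_def leg23_def
    by (rule HH.lift_multiplicative[OF HHH.AB_unital_algebra legs_bilinear(1) _ s t]
        HH.lift_multiplicative[OF HHH.AB_unital_algebra legs_bilinear(2) _ s t]
        HH.lift_multiplicative[OF HHH.AB_unital_algebra legs_bilinear(3) _ s t];
        simp add: pure3_mult)+
  show "coprod_right K H (s \<otimes>\<^bsub>H2\<^esub> t) = coprod_right K H s \<otimes>\<^bsub>H3\<^esub> coprod_right K H t"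
    unfolding coprod_right_def
    by (rule HH.lift_multiplicative[OF HHH.AB_unital_algebra legs_bilinear(5) _ s t])
      (simp add: coprod_mult HHH.mult_pure)
  show "flip K H (s \<otimes>\<^bsub>H2\<^esub> t) = flip K H s \<otimes>\<^bsub>H2\<^esub> flip K H t"
    unfolding flip_def
    by (rule HH.lift_multiplicative[OF HH.AB_unital_algebra legs_bilinear(6) _ s t])
      (simp add: HH.mult_pure)
  show "counit_left H (s \<otimes>\<^bsub>H2\<^esub> t) = counit_left H s \<otimes> counit_left H t"
    "counit_right H (s \<otimes>\<^bsub>H2\<^esub> t) = counit_right H s \<otimes> counit_right H t"
    unfolding counit_left_def counit_right_def
    by (rule HH.lift_multiplicative[OF unital_algebra_axioms legs_bilinear(7) _ s t]
        HH.lift_multiplicative[OF unital_algebra_axioms legs_bilinear(8) _ s t];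
        simp add: counit_mult smult_mult_left smult_mult_right smult_assoc1 smult_left_commute)+
  have b: "(\<lambda>x y. pure3 K H x y u) \<in> bilinear_maps K H H H3" if "u \<in> carrier H" for u
    using that by (intro linear_rules trilinear_apply[OF pure3_trilinear]) simp_all
  show "coprod_left K H (s \<otimes>\<^bsub>H2\<^esub> t) = coprod_left K H s \<otimes>\<^bsub>H3\<^esub> coprod_left K H t"
    unfolding coprod_left_def
  proof (rule HH.lift_multiplicative[OF HHH.AB_unital_algebra legs_bilinear(4) _ s t])
    fix x y x' y' assume xy: "x \<in> carrier H" "y \<in> carrier H" "x' \<in> carrier H" "y' \<in> carrier H"
    interpret H3: unital_algebra K H3 by (rule HHH.AB_unital_algebra)
    \<comment> \<open>The left coproduct of a pure tensor is again a lift. Its product formula is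
      expanded into a double sum, in which the two factors are then separated.\<close>
    have "tensor_lift H3 (\<lambda>x1 x2. pure3 K H x1 x2 (y \<otimes> y')) (coprod H (x \<otimes> x'))
        = tensor_lift H3 (\<lambda>a b. tensor_lift H3 (\<lambda>a' b'. pure3 K H (a \<otimes> a') (b \<otimes> b') (y \<otimes> y')) (coprod H x')) (coprod H x)"
      using xy by (simp add: coprod_mult HH.lift_mult[OF HHH.T_module b])
    also have "\<dots> = tensor_lift H3 (\<lambda>a b. tensor_lift H3 (\<lambda>a' b'. pure3 K H a b y \<otimes>\<^bsub>H3\<^esub> pure3 K H a' b' y') (coprod H x')) (coprod H x)"
      using xy by (intro lift_cong) (simp_all add: pure3_mult)
    also have "\<dots> = tensor_lift H3 (\<lambda>a b. pure3 K H a b y \<otimes>\<^bsub>H3\<^esub> tensor_lift H3 (\<lambda>a' b'. pure3 K H a' b' y') (coprod H x')) (coprod H x)"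
      using xy by (intro lift_cong HH.linear_tensor_lift[symmetric] HHH.T_module H3.mult_right_linear) simp_all
    also have "\<dots> = tensor_lift H3 (\<lambda>a b. pure3 K H a b y) (coprod H x) \<otimes>\<^bsub>H3\<^esub> tensor_lift H3 (\<lambda>a' b'. pure3 K H a' b' y') (coprod H x')"
      using xy by (intro HH.linear_tensor_lift[symmetric, where h = "\<lambda>z. z \<otimes>\<^bsub>H3\<^esub> tensor_lift H3 (\<lambda>a' b'. pure3 K H a' b' y') (coprod H x')"]
          HHH.T_module H3.mult_left_linear HH.lift_closed) simp_all
    finally show "tensor_lift H3 (\<lambda>x1 x2. pure3 K H x1 x2 (y \<otimes> y')) (coprod H (x \<otimes> x'))
        = tensor_lift H3 (\<lambda>a b. pure3 K H a b y) (coprod H x) \<otimes>\<^bsub>H3\<^esub> tensor_lift H3 (\<lambda>a' b'. pure3 K H a' b' y') (coprod H x')" .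
  qed
qed

text \<open>A dictionary: each equation between elements of \<open>H3\<close> turns into an equation
  of Sweedler sums by evaluating an arbitrary trilinear map on both sides.\<close>

lemma lift3_legs:
  assumes M: "module K M" and f: "f \<in> trilinear_maps K H M" and t: "t \<in> carrier H2"
  shows "lift3 M f (leg12 K H t) = tensor_lift M (\<lambda>x y. f x y \<one>) t"
    and "lift3 M f (leg13 K H t) = tensor_lift M (\<lambda>x y. f x \<one> y) t"
    and "lift3 M f (leg23 K H t) = tensor_lift M (\<lambda>x y. f \<one> x y) t"
    and "lift3 M f (coprod_left K H t)
      = tensor_lift M (\<lambda>x y. tensor_lift M (\<lambda>a b. f a b y) (coprod H x)) t"
    and "lift3 M f (coprod_right K H t)
      = tensor_lift M (\<lambda>x y. tensor_lift M (\<lambda>a b. f x a b) (coprod H y)) t"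
proof -
  note push = HH.linear_tensor_lift[OF HHH.T_module M lift3_linear[OF M f]]
  show "lift3 M f (leg12 K H t) = tensor_lift M (\<lambda>x y. f x y \<one>) t"
    "lift3 M f (leg13 K H t) = tensor_lift M (\<lambda>x y. f x \<one> y) t"
    "lift3 M f (leg23 K H t) = tensor_lift M (\<lambda>x y. f \<one> x y) t"
    unfolding leg12_def leg13_def leg23_def
    by (subst push[OF t]; (intro lift_cong[OF t])?; simp add: lift3_pure3[OF M f])+
  show "lift3 M f (coprod_left K H t)
      = tensor_lift M (\<lambda>x y. tensor_lift M (\<lambda>a b. f a b y) (coprod H x)) t"
    unfolding coprod_left_def
  proof (subst push[OF t])
    show "tensor_lift H3 (\<lambda>x1 x2. pure3 K H x1 x2 y) (coprod H x) \<in> carrier H3"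
      if "x \<in> carrier H" "y \<in> carrier H" for x y
      using that by (intro HH.lift_closed HHH.T_module) simp_all
    show "tensor_lift M (\<lambda>x y. lift3 M f (tensor_lift H3 (\<lambda>x1 x2. pure3 K H x1 x2 y) (coprod H x))) t
        = tensor_lift M (\<lambda>x y. tensor_lift M (\<lambda>a b. f a b y) (coprod H x)) t"
    proof (rule lift_cong[OF t])
      fix x y assume xy: "x \<in> carrier H" "y \<in> carrier H"
      then show "lift3 M f (tensor_lift H3 (\<lambda>x1 x2. pure3 K H x1 x2 y) (coprod H x))
          = tensor_lift M (\<lambda>a b. f a b y) (coprod H x)"
        by (subst push) (auto intro!: lift_cong simp: lift3_pure3[OF M f])
    qed
  qed
  show "lift3 M f (coprod_right K H t)
      = tensor_lift M (\<lambda>x y. tensor_lift M (\<lambda>a b. f x a b) (coprod H y)) t"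
    unfolding coprod_right_def
    by (subst push[OF t])
      (auto intro!: lift_cong[OF t] simp: HHH.pure_tensor_closed lift3_def HHH.lift_pure[OF M lift3_bilinear[OF M f]])
qed

lemma lift_flip:
  assumes M: "module K M" and f: "f \<in> bilinear_maps K H H M" and t: "t \<in> carrier H2"
  shows "tensor_lift M f (flip K H t) = tensor_lift M (\<lambda>x y. f y x) t"
  unfolding flip_def
  by (subst HH.linear_tensor_lift[OF HH.T_module M HH.lift_linear[OF M f] t])
    (auto intro!: lift_cong[OF t] simp: HH.pure_tensor_closed HH.lift_pure[OF M f])

section \<open>The Hopf axioms as Sweedler sums, and cancellation of the antipode\<close>

lemma coassoc_lift:
  assumes M: "module K M" and f: "f \<in> trilinear_maps K H M" and \<xi>: "\<xi> \<in> carrier H"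
  shows "tensor_lift M (\<lambda>x y. tensor_lift M (\<lambda>a b. f a b y) (coprod H x)) (coprod H \<xi>)
       = tensor_lift M (\<lambda>x y. tensor_lift M (\<lambda>a b. f x a b) (coprod H y)) (coprod H \<xi>)"
  using lift3_legs(4,5)[OF M f coprod_closed[OF \<xi>]] coassoc[OF \<xi>] by simp

lemma counit_left_lift:
  assumes M: "module K M" and f: "f \<in> linear_maps K H M" and t: "t \<in> carrier H2"
  shows "tensor_lift M (\<lambda>x y. counit H x \<odot>\<^bsub>M\<^esub> f y) t = f (counit_left H t)"
  unfolding counit_left_def
  by (subst HH.linear_tensor_lift[OF module_axioms M f t])
    (auto intro!: lift_cong[OF t] simp: linear_mapsD(3)[OF f])

lemma counit_right_lift:
  assumes M: "module K M" and f: "f \<in> linear_maps K H M" and t: "t \<in> carrier H2"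
  shows "tensor_lift M (\<lambda>x y. counit H y \<odot>\<^bsub>M\<^esub> f x) t = f (counit_right H t)"
  unfolding counit_right_def
  by (subst HH.linear_tensor_lift[OF module_axioms M f t])
    (auto intro!: lift_cong[OF t] simp: linear_mapsD(3)[OF f])

lemma antipode_left_lift:
  assumes M: "module K M" and f: "f \<in> linear_maps K H M" and \<xi>: "\<xi> \<in> carrier H"
  shows "tensor_lift M (\<lambda>x y. f (antipode H x \<otimes> y)) (coprod H \<xi>) = counit H \<xi> \<odot>\<^bsub>M\<^esub> f \<one>"
  using HH.linear_tensor_lift[OF module_axioms M f coprod_closed[OF \<xi>], of "\<lambda>x y. antipode H x \<otimes> y"]
  by (simp add: antipode_left[OF \<xi>] linear_mapsD(3)[OF f] \<xi>)

lemma antipode_right_lift: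
  assumes M: "module K M" and f: "f \<in> linear_maps K H M" and \<xi>: "\<xi> \<in> carrier H"
  shows "tensor_lift M (\<lambda>x y. f (x \<otimes> antipode H y)) (coprod H \<xi>) = counit H \<xi> \<odot>\<^bsub>M\<^esub> f \<one>"
  using HH.linear_tensor_lift[OF module_axioms M f coprod_closed[OF \<xi>], of "\<lambda>x y. x \<otimes> antipode H y"]
  by (simp add: antipode_right[OF \<xi>] linear_mapsD(3)[OF f] \<xi>)

text \<open>By coassociativity the sum reads
  \<open>g(\<xi>\<^sub>1, \<xi>\<^sub>2 S(\<xi>\<^sub>3) \<eta>)\<close>. The right antipode law
  collapses the last two legs of \<xi> and the right counit law removes what is left of
  them.\<close>

lemma bilinear_recover:
  assumes M: "module K M" and g: "g \<in> bilinear_maps K H H M" and \<xi>: "\<xi> \<in> carrier H" and \<eta>: "\<eta> \<in> carrier H"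
  shows "tensor_lift M (\<lambda>x y. tensor_lift M (\<lambda>a b. g a (b \<otimes> (antipode H y \<otimes> \<eta>))) (coprod H x)) (coprod H \<xi>)
    = g \<xi> \<eta>"
proof -
  have "tensor_lift M (\<lambda>x y. tensor_lift M (\<lambda>a b. g a (b \<otimes> (antipode H y \<otimes> \<eta>))) (coprod H x)) (coprod H \<xi>)
      = tensor_lift M (\<lambda>x y. tensor_lift M (\<lambda>a b. g x (a \<otimes> (antipode H b \<otimes> \<eta>))) (coprod H y)) (coprod H \<xi>)"
    using \<eta> by (intro coassoc_lift[OF M _ \<xi>] linear_rules bilinear_apply_left[OF g] bilinear_apply_right[OF g]) simp_all
  also have "\<dots> = tensor_lift M (\<lambda>x y. counit H y \<odot>\<^bsub>M\<^esub> g x \<eta>) (coprod H \<xi>)"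
  proof (rule lift_cong)
    fix x y assume xy: "x \<in> carrier H" "y \<in> carrier H"
    have "tensor_lift M (\<lambda>a b. g x (a \<otimes> (antipode H b \<otimes> \<eta>))) (coprod H y)
        = tensor_lift M (\<lambda>a b. g x ((a \<otimes> antipode H b) \<otimes> \<eta>)) (coprod H y)"
      using xy \<eta> by (intro lift_cong) (simp_all add: m_assoc)
    also have "\<dots> = counit H y \<odot>\<^bsub>M\<^esub> g x (\<one> \<otimes> \<eta>)"
      using xy \<eta> by (intro antipode_right_lift[OF M] linear_rules bilinear_apply_right[OF g]) simp_all
    finally show "tensor_lift M (\<lambda>a b. g x (a \<otimes> (antipode H b \<otimes> \<eta>))) (coprod H y) = counit H y \<odot>\<^bsub>M\<^esub> g x \<eta>"
      using \<eta> by simp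
  qed (simp add: \<xi>)
  also have "\<dots> = g \<xi> \<eta>"
    using \<xi> \<eta> counit_right_lift[OF M bilinear_apply_left[OF g \<eta> linear_maps_id], of "coprod H \<xi>"]
    by (simp add: counit_right)
  finally show ?thesis .
qed

text \<open>The assumption, used with \<open>\<xi>\<^sub>1\<close> for \<xi> and
  \<open>S(\<xi>\<^sub>2) \<eta>\<close> for \<eta>, equates the two sums from which
  \<open>bilinear_recover\<close> reconstructs \<open>g\<close> and \<open>h\<close>.\<close>

lemma bilinear_cancel:
  assumes M: "module K M" and g: "g \<in> bilinear_maps K H H M" and h: "h \<in> bilinear_maps K H H M"
    and eq: "\<And>\<xi> \<eta>. \<lbrakk>\<xi> \<in> carrier H; \<eta> \<in> carrier H\<rbrakk>
      \<Longrightarrow> tensor_lift M (\<lambda>x y. g x (y \<otimes> \<eta>)) (coprod H \<xi>) = tensor_lift M (\<lambda>x y. h x (y \<otimes> \<eta>)) (coprod H \<xi>)"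
    and \<xi>: "\<xi> \<in> carrier H" and \<eta>: "\<eta> \<in> carrier H"
  shows "g \<xi> \<eta> = h \<xi> \<eta>"
proof -
  have "tensor_lift M (\<lambda>x y. tensor_lift M (\<lambda>a b. g a (b \<otimes> (antipode H y \<otimes> \<eta>))) (coprod H x)) (coprod H \<xi>)
      = tensor_lift M (\<lambda>x y. tensor_lift M (\<lambda>a b. h a (b \<otimes> (antipode H y \<otimes> \<eta>))) (coprod H x)) (coprod H \<xi>)"
    using \<xi> \<eta> by (intro lift_cong eq) simp_all
  then show ?thesis
    by (simp add: bilinear_recover[OF M g \<xi> \<eta>] bilinear_recover[OF M h \<xi> \<eta>])
qed

text \<open>The first of two cancellations that lead to \<open>antipode_mult\<close>. Cancelling in
  \<zeta> puts \<open>\<zeta>\<^sub>1\<close> for \<zeta> and \<open>\<zeta>\<^sub>2 \<eta>\<close>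
  for \<eta>, after which the left antipode law reduces both sides to \<eta> times the counits of
  \<xi> and \<zeta>.\<close>

lemma antipode_mult_aux:
  assumes \<xi>: "\<xi> \<in> carrier H" and \<zeta>: "\<zeta> \<in> carrier H" and \<eta>: "\<eta> \<in> carrier H"
  shows "tensor_lift H (\<lambda>x y. antipode H (x \<otimes> \<zeta>) \<otimes> (y \<otimes> \<eta>)) (coprod H \<xi>)
       = tensor_lift H (\<lambda>x y. antipode H \<zeta> \<otimes> (antipode H x \<otimes> (y \<otimes> \<eta>))) (coprod H \<xi>)"
proof (rule bilinear_cancel[OF module_axioms _ _ _ \<zeta> \<eta>])
  show "(\<lambda>\<zeta> \<eta>. tensor_lift H (\<lambda>x y. antipode H (x \<otimes> \<zeta>) \<otimes> (y \<otimes> \<eta>)) (coprod H \<xi>)) \<in> bilinear_maps K H H H"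
    "(\<lambda>\<zeta> \<eta>. tensor_lift H (\<lambda>x y. antipode H \<zeta> \<otimes> (antipode H x \<otimes> (y \<otimes> \<eta>))) (coprod H \<xi>)) \<in> bilinear_maps K H H H"
    using \<xi> by (intro linear_rules module_axioms; simp)+
  fix \<zeta> \<eta> assume \<zeta>: "\<zeta> \<in> carrier H" and \<eta>: "\<eta> \<in> carrier H"
  have "tensor_lift H (\<lambda>u v. tensor_lift H (\<lambda>x y. antipode H (x \<otimes> u) \<otimes> (y \<otimes> (v \<otimes> \<eta>))) (coprod H \<xi>)) (coprod H \<zeta>)
      = tensor_lift H (\<lambda>x y. tensor_lift H (\<lambda>u v. antipode H (x \<otimes> u) \<otimes> (y \<otimes> (v \<otimes> \<eta>))) (coprod H \<zeta>)) (coprod H \<xi>)"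
    using \<xi> \<zeta> \<eta> by (intro lift_swap module_axioms) simp_all
  also have "\<dots> = tensor_lift H (\<lambda>x y. tensor_lift H (\<lambda>u v. (antipode H (x \<otimes> u) \<otimes> (y \<otimes> v)) \<otimes> \<eta>) (coprod H \<zeta>)) (coprod H \<xi>)"
    using \<xi> \<zeta> \<eta> by (intro lift_cong) (simp_all add: m_assoc)
  also have "\<dots> = tensor_lift H (\<lambda>p q. (antipode H p \<otimes> q) \<otimes> \<eta>) (coprod H (\<xi> \<otimes> \<zeta>))"
    using \<xi> \<zeta> \<eta> by (subst coprod_mult; (subst HH.lift_mult)?; (intro linear_rules module_axioms)?; simp)
  also have "\<dots> = counit H (\<xi> \<otimes> \<zeta>) \<odot> (\<one> \<otimes> \<eta>)"
    using \<xi> \<zeta> \<eta> by (intro antipode_left_lift module_axioms mult_left_linear) simp_all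
  also have "\<dots> = counit H \<zeta> \<odot> (counit H \<xi> \<odot> \<eta>)"
    using \<xi> \<zeta> \<eta> by (simp add: counit_mult smult_assoc1[symmetric] m_comm K.m_comm)
  also have "\<dots> = counit H \<xi> \<odot> (counit H \<zeta> \<odot> (\<one> \<otimes> \<eta>))"
    using \<xi> \<zeta> \<eta> by (simp add: smult_assoc1[symmetric] K.m_comm)
  also have "\<dots> = counit H \<xi> \<odot> (tensor_lift H (\<lambda>u v. (antipode H u \<otimes> v) \<otimes> \<eta>) (coprod H \<zeta>))"
    using \<xi> \<zeta> \<eta> by (subst antipode_left_lift[OF module_axioms mult_left_linear]) simp_all
  also have "\<dots> = tensor_lift H (\<lambda>u v. counit H \<xi> \<odot> ((antipode H u \<otimes> v) \<otimes> \<eta>)) (coprod H \<zeta>)"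
    using \<xi> \<zeta> \<eta> by (intro HH.linear_tensor_lift module_axioms smult_linear) simp_all
  also have "\<dots> = tensor_lift H (\<lambda>u v. tensor_lift H (\<lambda>x y. antipode H u \<otimes> (antipode H x \<otimes> (y \<otimes> (v \<otimes> \<eta>)))) (coprod H \<xi>)) (coprod H \<zeta>)"
  proof (rule lift_cong)
    fix u v assume uv: "u \<in> carrier H" "v \<in> carrier H"
    have "tensor_lift H (\<lambda>x y. antipode H u \<otimes> (antipode H x \<otimes> (y \<otimes> (v \<otimes> \<eta>)))) (coprod H \<xi>)
      = tensor_lift H (\<lambda>x y. antipode H u \<otimes> ((antipode H x \<otimes> y) \<otimes> (v \<otimes> \<eta>))) (coprod H \<xi>)"
      using \<xi> \<eta> uv by (intro lift_cong) (simp_all add: m_assoc)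
    also have "\<dots> = counit H \<xi> \<odot> (antipode H u \<otimes> (\<one> \<otimes> (v \<otimes> \<eta>)))"
      using \<xi> \<eta> uv by (intro antipode_left_lift module_axioms linear_rules) simp_all
    finally show "counit H \<xi> \<odot> ((antipode H u \<otimes> v) \<otimes> \<eta>)
      = tensor_lift H (\<lambda>x y. antipode H u \<otimes> (antipode H x \<otimes> (y \<otimes> (v \<otimes> \<eta>)))) (coprod H \<xi>)"
      using \<eta> uv by (simp add: m_assoc)
  qed (simp add: \<zeta>)
  finally show "tensor_lift H (\<lambda>u v. tensor_lift H (\<lambda>x y. antipode H (x \<otimes> u) \<otimes> (y \<otimes> (v \<otimes> \<eta>))) (coprod H \<xi>)) (coprod H \<zeta>)
    = tensor_lift H (\<lambda>u v. tensor_lift H (\<lambda>x y. antipode H u \<otimes> (antipode H x \<otimes> (y \<otimes> (v \<otimes> \<eta>)))) (coprod H \<xi>)) (coprod H \<zeta>)" .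
qed

text \<open>Cancelling in \<xi> leaves exactly \<open>antipode_mult_aux\<close>; the free factor
  \<eta> is then set to one.\<close>

lemma antipode_mult:
  assumes \<xi>: "\<xi> \<in> carrier H" and \<zeta>: "\<zeta> \<in> carrier H"
  shows "antipode H (\<xi> \<otimes> \<zeta>) = antipode H \<zeta> \<otimes> antipode H \<xi>"
proof -
  have "antipode H (\<xi> \<otimes> \<zeta>) \<otimes> \<one> = antipode H \<zeta> \<otimes> (antipode H \<xi> \<otimes> \<one>)"
  proof (rule bilinear_cancel[OF module_axioms _ _ _ \<xi> one_closed,
        where g = "\<lambda>\<xi> \<eta>. antipode H (\<xi> \<otimes> \<zeta>) \<otimes> \<eta>"
        and h = "\<lambda>\<xi> \<eta>. antipode H \<zeta> \<otimes> (antipode H \<xi> \<otimes> \<eta>)"])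
    show "(\<lambda>\<xi> \<eta>. antipode H (\<xi> \<otimes> \<zeta>) \<otimes> \<eta>) \<in> bilinear_maps K H H H"
      "(\<lambda>\<xi> \<eta>. antipode H \<zeta> \<otimes> (antipode H \<xi> \<otimes> \<eta>)) \<in> bilinear_maps K H H H"
      using \<zeta> by (intro linear_rules; simp)+
  qed (use \<zeta> antipode_mult_aux in auto)
  then show ?thesis
    using assms by simp
qed

lemma antipode_one: "antipode H \<one> = \<one>"
proof -
  have "tensor_lift H (\<lambda>x y. antipode H x \<otimes> y) (coprod H \<one>) = antipode H \<one> \<otimes> \<one>"
    unfolding coprod_one by (rule HH.lift_one[OF module_axioms]) (intro linear_rules; simp)
  then show ?thesis
    using antipode_left[of \<one>] by (simp add: counit_one)
qed

end

section \<open>Modules over Hopf algebras\<close>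

context left_hmodule
begin

lemma hact_closed [simp]: "\<lbrakk>\<xi> \<in> carrier H; v \<in> carrier V\<rbrakk> \<Longrightarrow> hact V \<xi> v \<in> carrier V"
  by (rule linear_mapsD(1)[OF hact_linear])

lemma hact_bilinear: "hact V \<in> bilinear_maps K H V V"
  by (intro bilinear_mapsI linear_mapsI) (simp_all add: hact_add hact_smult linear_mapsD[OF hact_linear])

lemma hact_linear_left:
  "\<lbrakk>v \<in> carrier V; g \<in> linear_maps K U H\<rbrakk> \<Longrightarrow> (\<lambda>x. hact V (g x) v) \<in> linear_maps K U V"
  by (rule bilinear_apply_left[OF hact_bilinear])

lemma hact_linear_right:
  "\<lbrakk>\<xi> \<in> carrier H; g \<in> linear_maps K U V\<rbrakk> \<Longrightarrow> (\<lambda>x. hact V \<xi> (g x)) \<in> linear_maps K U V"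
  by (rule bilinear_apply_right[OF hact_bilinear])

text \<open>Composition with the orbit map of \<open>v\<close>, which sends \<eta> to \<eta> acting
  on \<open>v\<close>, reduces this to \<open>bilinear_cancel\<close> at \<eta> = 1.\<close>

lemma module_cancel:
  assumes M: "module K M" and g: "g \<in> bilinear_maps K H V M" and h: "h \<in> bilinear_maps K H V M"
    and eq: "\<And>\<xi> v. \<lbrakk>\<xi> \<in> carrier H; v \<in> carrier V\<rbrakk>
      \<Longrightarrow> tensor_lift M (\<lambda>x y. g x (hact V y v)) (coprod H \<xi>) = tensor_lift M (\<lambda>x y. h x (hact V y v)) (coprod H \<xi>)"
    and \<xi>: "\<xi> \<in> carrier H" and v: "v \<in> carrier V"
  shows "g \<xi> v = h \<xi> v"
proof -
  have "g \<xi> (hact V \<one>\<^bsub>H\<^esub> v) = h \<xi> (hact V \<one>\<^bsub>H\<^esub> v)"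
  proof (rule H.bilinear_cancel[OF M _ _ _ \<xi> H.one_closed,
        where g = "\<lambda>\<xi> \<eta>. g \<xi> (hact V \<eta> v)" and h = "\<lambda>\<xi> \<eta>. h \<xi> (hact V \<eta> v)"])
    show "(\<lambda>\<xi> \<eta>. g \<xi> (hact V \<eta> v)) \<in> bilinear_maps K H H M" "(\<lambda>\<xi> \<eta>. h \<xi> (hact V \<eta> v)) \<in> bilinear_maps K H H M"
      using v by (intro H.linear_rules bilinear_apply_left[OF g] bilinear_apply_right[OF g]
        bilinear_apply_left[OF h] bilinear_apply_right[OF h] hact_linear_left; simp)+
    fix \<xi> \<eta> assume \<xi>: "\<xi> \<in> carrier H" and \<eta>: "\<eta> \<in> carrier H"
    have l: "tensor_lift M (\<lambda>x y. f x (hact V (y \<otimes>\<^bsub>H\<^esub> \<eta>) v)) (coprod H \<xi>)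
        = tensor_lift M (\<lambda>x y. f x (hact V y (hact V \<eta> v))) (coprod H \<xi>)" for f
      using \<xi> \<eta> v by (intro H.lift_cong) (simp_all add: hact_mult)
    show "tensor_lift M (\<lambda>x y. g x (hact V (y \<otimes>\<^bsub>H\<^esub> \<eta>) v)) (coprod H \<xi>)
        = tensor_lift M (\<lambda>x y. h x (hact V (y \<otimes>\<^bsub>H\<^esub> \<eta>) v)) (coprod H \<xi>)"
      unfolding l using \<xi> \<eta> v by (intro eq) simp_all
  qed
  then show ?thesis
    using v by (simp add: hact_one)
qed

end

subsection \<open>The adjoint action on linear maps\<close>

locale hmodule_pair = hopf_algebra K H + V: left_hmodule K H V + W: left_hmodule K H W
  for K and H :: "('k, 'h, 'm) hopf_scheme" (structure)
    and V :: "('k, 'h, 'v, 'n) hmod_scheme" and W :: "('k, 'h, 'w, 'p) hmod_scheme"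
begin

lemmas V_module = V.V.module_axioms
lemmas W_module = W.V.module_axioms
lemmas pair_rules = linear_rules V.hact_linear_left V.hact_linear_right W.hact_linear_left W.hact_linear_right
  V.V.module_axioms W.V.module_axioms module_axioms

lemma adj_closed [simp]:
  assumes "P \<in> linear_maps K V W" and "\<xi> \<in> carrier H" and "v \<in> carrier V"
  shows "adj_act H V W \<xi> P v \<in> carrier W"
  unfolding adj_act_def using assms
  by (intro HH.lift_closed W_module) (simp_all add: linear_mapsD(1)[OF assms(1)])

lemma adj_bilinear:
  assumes "P \<in> linear_maps K V W"
  shows "(\<lambda>\<xi> v. adj_act H V W \<xi> P v) \<in> bilinear_maps K H V W"
  unfolding adj_act_def[abs_def]
  by (intro pair_rules linear_maps_comp[OF assms]) (simp_all add: linear_mapsD(1)[OF assms])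

lemma adj_linear: "\<lbrakk>P \<in> linear_maps K V W; \<xi> \<in> carrier H\<rbrakk> \<Longrightarrow> adj_act H V W \<xi> P \<in> linear_maps K V W"
  using bilinear_mapsD(1)[OF adj_bilinear] by auto

lemma adj_linear_left:
  "\<lbrakk>P \<in> linear_maps K V W; v \<in> carrier V; g \<in> linear_maps K U H\<rbrakk>
    \<Longrightarrow> (\<lambda>x. adj_act H V W (g x) P v) \<in> linear_maps K U W"
  by (rule bilinear_apply_left[OF adj_bilinear])

lemma adj_linear_right:
  "\<lbrakk>P \<in> linear_maps K V W; \<xi> \<in> carrier H; g \<in> linear_maps K U V\<rbrakk>
    \<Longrightarrow> (\<lambda>x. adj_act H V W \<xi> P (g x)) \<in> linear_maps K U W"
  by (rule bilinear_apply_right[OF adj_bilinear])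

text \<open>Covers linear dependence through the map being acted on, as when that map is an adjoint
  action of a varying element.\<close>

lemma adj_linear_map:
  assumes "module K U" and "\<xi> \<in> carrier H" and "v \<in> carrier V"
    and "\<And>u. u \<in> carrier V \<Longrightarrow> (\<lambda>x. p x u) \<in> linear_maps K U W"
  shows "(\<lambda>x. adj_act H V W \<xi> (p x) v) \<in> linear_maps K U W"
  unfolding adj_act_def using assms by (intro pair_rules) simp_all

text \<open>Identities such as \<open>adj_mult\<close> equate two maps on the carrier only, so they
  cannot be rewritten under an outer adjoint action without this rule.\<close>

lemma adj_cong:
  assumes "\<And>u. u \<in> carrier V \<Longrightarrow> P u = Q u" and "\<xi> \<in> carrier H" and "v \<in> carrier V"
  shows "adj_act H V W \<xi> P v = adj_act H V W \<xi> Q v"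
  unfolding adj_act_def using assms by (intro lift_cong) simp_all

lemmas adj_rules = pair_rules adj_linear_left adj_linear_right

text \<open>Expanding the left side gives
  \<open>\<xi>\<^sub>1 P(S(\<xi>\<^sub>2) \<xi>\<^sub>3 v)\<close>, where the left antipode law
  collapses the last two legs.\<close>

lemma adj_hact:
  assumes P: "P \<in> linear_maps K V W" and \<xi>: "\<xi> \<in> carrier H" and v: "v \<in> carrier V"
  shows "tensor_lift W (\<lambda>x y. adj_act H V W x P (hact V y v)) (coprod H \<xi>) = hact W \<xi> (P v)"
proof -
  note Pc = linear_mapsD(1)[OF P]
  have "tensor_lift W (\<lambda>x y. adj_act H V W x P (hact V y v)) (coprod H \<xi>)
      = tensor_lift W (\<lambda>x y. tensor_lift W (\<lambda>a b. hact W x (P (hact V (antipode H a) (hact V b v)))) (coprod H y)) (coprod H \<xi>)"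
    unfolding adj_act_def using v Pc
    by (intro coassoc_lift[OF W_module _ \<xi>] pair_rules linear_maps_comp[OF P]) simp_all
  also have "\<dots> = tensor_lift W (\<lambda>x y. counit H y \<odot>\<^bsub>W\<^esub> hact W x (P v)) (coprod H \<xi>)"
  proof (rule lift_cong)
    fix x y assume xy: "x \<in> carrier H" "y \<in> carrier H"
    have "tensor_lift W (\<lambda>a b. hact W x (P (hact V (antipode H a) (hact V b v)))) (coprod H y)
        = tensor_lift W (\<lambda>a b. hact W x (P (hact V (antipode H a \<otimes> b) v))) (coprod H y)"
      using xy v by (intro lift_cong) (simp_all add: V.hact_mult)
    also have "\<dots> = counit H y \<odot>\<^bsub>W\<^esub> hact W x (P (hact V \<one> v))"
      using xy v by (intro antipode_left_lift[OF W_module] pair_rules linear_maps_comp[OF P]) simp_all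
    finally show "tensor_lift W (\<lambda>a b. hact W x (P (hact V (antipode H a) (hact V b v)))) (coprod H y)
        = counit H y \<odot>\<^bsub>W\<^esub> hact W x (P v)"
      using v by (simp add: V.hact_one)
  qed (simp add: \<xi>)
  also have "\<dots> = hact W \<xi> (P v)"
    using \<xi> v Pc counit_right_lift[OF W_module W.hact_linear_left[OF Pc[OF v] linear_maps_id], of "coprod H \<xi>"]
    by (simp add: counit_right)
  finally show ?thesis .
qed

text \<open>Cancellation makes the property in \<open>adj_hact\<close> characteristic: a bilinear
  candidate for the adjoint action is confirmed by a computation in which the antipode does not
  occur.\<close>

lemma adj_unique:
  assumes P: "P \<in> linear_maps K V W" and g: "g \<in> bilinear_maps K H V W"
    and eq: "\<And>\<xi> v. \<lbrakk>\<xi> \<in> carrier H; v \<in> carrier V\<rbrakk>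
      \<Longrightarrow> tensor_lift W (\<lambda>x y. g x (hact V y v)) (coprod H \<xi>) = hact W \<xi> (P v)"
    and \<xi>: "\<xi> \<in> carrier H" and v: "v \<in> carrier V"
  shows "adj_act H V W \<xi> P v = g \<xi> v"
  using \<xi> v
  by (intro V.module_cancel[OF W_module adj_bilinear[OF P] g]) (simp_all add: eq adj_hact[OF P])

text \<open>After uniqueness in \<xi> and cancellation in \<zeta>, both sides become
  \<open>\<xi> (\<zeta> (P v))\<close> by \<open>adj_hact\<close>, on one side once the two
  coproducts have been merged into that of the product.\<close>

lemma adj_mult:
  assumes P: "P \<in> linear_maps K V W" and \<xi>: "\<xi> \<in> carrier H" and \<zeta>: "\<zeta> \<in> carrier H" and v: "v \<in> carrier V"
  shows "adj_act H V W (\<xi> \<otimes> \<zeta>) P v = adj_act H V W \<xi> (adj_act H V W \<zeta> P) v"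
proof (rule adj_unique[OF adj_linear[OF P \<zeta>] _ _ \<xi> v, symmetric, where g = "\<lambda>\<xi> v. adj_act H V W (\<xi> \<otimes> \<zeta>) P v"])
  show "(\<lambda>\<xi> v. adj_act H V W (\<xi> \<otimes> \<zeta>) P v) \<in> bilinear_maps K H V W"
    using \<zeta> by (intro adj_rules P) simp_all
  fix \<xi> v assume \<xi>: "\<xi> \<in> carrier H" and v: "v \<in> carrier V"
  show "tensor_lift W (\<lambda>x y. adj_act H V W (x \<otimes> \<zeta>) P (hact V y v)) (coprod H \<xi>)
      = hact W \<xi> (adj_act H V W \<zeta> P v)"
  proof (rule V.module_cancel[OF W_module _ _ _ \<zeta> v, where
        g = "\<lambda>\<zeta> v. tensor_lift W (\<lambda>x y. adj_act H V W (x \<otimes> \<zeta>) P (hact V y v)) (coprod H \<xi>)" and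
        h = "\<lambda>\<zeta> v. hact W \<xi> (adj_act H V W \<zeta> P v)"])
    show "(\<lambda>\<zeta> v. tensor_lift W (\<lambda>x y. adj_act H V W (x \<otimes> \<zeta>) P (hact V y v)) (coprod H \<xi>)) \<in> bilinear_maps K H V W"
      "(\<lambda>\<zeta> v. hact W \<xi> (adj_act H V W \<zeta> P v)) \<in> bilinear_maps K H V W"
      using \<xi> by (intro adj_rules P; simp)+
    fix \<zeta> v assume \<zeta>: "\<zeta> \<in> carrier H" and v: "v \<in> carrier V"
    have "tensor_lift W (\<lambda>u w. tensor_lift W (\<lambda>x y. adj_act H V W (x \<otimes> u) P (hact V y (hact V w v))) (coprod H \<xi>)) (coprod H \<zeta>)
        = tensor_lift W (\<lambda>x y. tensor_lift W (\<lambda>u w. adj_act H V W (x \<otimes> u) P (hact V y (hact V w v))) (coprod H \<zeta>)) (coprod H \<xi>)"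
      using \<xi> \<zeta> v P by (intro lift_swap W_module) simp_all
    also have "\<dots> = tensor_lift W (\<lambda>x y. tensor_lift W (\<lambda>u w. adj_act H V W (x \<otimes> u) P (hact V (y \<otimes> w) v)) (coprod H \<zeta>)) (coprod H \<xi>)"
      using \<xi> \<zeta> v by (intro lift_cong) (simp_all add: V.hact_mult)
    also have "\<dots> = tensor_lift W (\<lambda>p q. adj_act H V W p P (hact V q v)) (coprod H (\<xi> \<otimes> \<zeta>))"
      using \<xi> \<zeta> v by (subst coprod_mult; (subst HH.lift_mult)?; (intro adj_rules P)?; simp)
    also have "\<dots> = hact W \<xi> (hact W \<zeta> (P v))"
      using \<xi> \<zeta> v by (simp add: adj_hact[OF P] W.hact_mult linear_mapsD(1)[OF P])
    also have "\<dots> = hact W \<xi> (tensor_lift W (\<lambda>u w. adj_act H V W u P (hact V w v)) (coprod H \<zeta>))"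
      using \<zeta> v by (simp add: adj_hact[OF P])
    also have "\<dots> = tensor_lift W (\<lambda>u w. hact W \<xi> (adj_act H V W u P (hact V w v))) (coprod H \<zeta>)"
      using \<xi> \<zeta> v P by (intro HH.linear_tensor_lift W_module W.hact_linear) simp_all
    finally show "tensor_lift W (\<lambda>u w. tensor_lift W (\<lambda>x y. adj_act H V W (x \<otimes> u) P (hact V y (hact V w v))) (coprod H \<xi>)) (coprod H \<zeta>)
      = tensor_lift W (\<lambda>u w. hact W \<xi> (adj_act H V W u P (hact V w v))) (coprod H \<zeta>)" .
  qed
qed

end

subsection \<open>Bimodules\<close>

context hmodule_bimodule
begin

lemma lact_bilinear: "lact V \<in> bilinear_maps K A V V"
  by (intro bilinear_mapsI linear_mapsI) (simp_all add: lact_add lact_smult linear_mapsD[OF lact_linear])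

lemma ract_bilinear: "ract V \<in> bilinear_maps K V A V"
  by (intro bilinear_mapsI linear_mapsI) (simp_all add: ract_add ract_smult linear_mapsD[OF ract_linear])

lemma lact_closed [simp]: "\<lbrakk>a \<in> carrier A; v \<in> carrier V\<rbrakk> \<Longrightarrow> lact V a v \<in> carrier V"
  by (rule bilinear_mapsD(3)[OF lact_bilinear])

lemma ract_closed [simp]: "\<lbrakk>a \<in> carrier A; v \<in> carrier V\<rbrakk> \<Longrightarrow> ract V v a \<in> carrier V"
  by (rule bilinear_mapsD(3)[OF ract_bilinear])

lemmas act_rules = A.H.linear_rules hact_linear_left hact_linear_right A.hact_linear_left A.hact_linear_right
  bilinear_apply_left[OF lact_bilinear] bilinear_apply_right[OF lact_bilinear]
  bilinear_apply_left[OF ract_bilinear] bilinear_apply_right[OF ract_bilinear]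
  V.module_axioms A.V.module_axioms

end

text \<open>The pair has two uses: as source and target of a map, and as the two factors of a tensor
  product over \<open>A\<close>.\<close>

locale hmodule_bimodule_pair = hopf_algebra K H + A: hmodule_algebra K H A
    + V: hmodule_bimodule K H A V + W: hmodule_bimodule K H A W
  for K and H :: "('k, 'h, 'm) hopf_scheme" (structure) and A :: "('k, 'h, 'a, 'n) hmod_scheme"
    and V :: "('k, 'h, 'a, 'v, 'p) hbimod_scheme" and W :: "('k, 'h, 'a, 'w, 'q) hbimod_scheme"

sublocale hmodule_bimodule_pair \<subseteq> hmodule_pair K H V W
  by unfold_locales

context hmodule_bimodule_pair
begin

lemmas bimodule_rules = adj_rules V.act_rules W.act_rules

lemma right_linear_mapsD:
  assumes "P \<in> right_linear_maps K A V W"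
  shows "P \<in> linear_maps K V W"
    and "\<lbrakk>v \<in> carrier V; a \<in> carrier A\<rbrakk> \<Longrightarrow> P (ract V v a) = ract W (P v) a"
  using assms by (auto simp: right_linear_maps_def)

text \<open>Cancellation is applied against \<open>v\<close> and then, in \<open>aux\<close>,
  against \<open>a\<close>. What remains on both sides is \<xi> acting on \<open>P v\<close>
  multiplied by \<open>a\<close>, and right linearity of \<open>P\<close> identifies the two ways of
  reaching it.\<close>

lemma adj_right_linear:
  assumes P: "P \<in> right_linear_maps K A V W" and \<xi>: "\<xi> \<in> carrier H"
  shows "adj_act H V W \<xi> P \<in> right_linear_maps K A V W"
proof -
  note lin = right_linear_mapsD(1)[OF P] and Pr = right_linear_mapsD(2)[OF P]
  note Pc = linear_mapsD(1)[OF lin]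
  have aux: "tensor_lift W (\<lambda>x y. adj_act H V W x P (ract V (hact V y v) a)) (coprod H \<xi>)
      = tensor_lift W (\<lambda>x y. ract W (adj_act H V W x P (hact V y v)) a) (coprod H \<xi>)"
    if \<xi>: "\<xi> \<in> carrier H" and v: "v \<in> carrier V" and a: "a \<in> carrier A" for \<xi> v a
  proof (rule A.module_cancel[OF W_module _ _ _ \<xi> a, where
        g = "\<lambda>\<xi> a. tensor_lift W (\<lambda>x y. adj_act H V W x P (ract V (hact V y v) a)) (coprod H \<xi>)" and
        h = "\<lambda>\<xi> a. tensor_lift W (\<lambda>x y. ract W (adj_act H V W x P (hact V y v)) a) (coprod H \<xi>)"])
    show "(\<lambda>\<xi> a. tensor_lift W (\<lambda>x y. adj_act H V W x P (ract V (hact V y v) a)) (coprod H \<xi>)) \<in> bilinear_maps K H A W"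
      "(\<lambda>\<xi> a. tensor_lift W (\<lambda>x y. ract W (adj_act H V W x P (hact V y v)) a) (coprod H \<xi>)) \<in> bilinear_maps K H A W"
      using v lin by (intro bimodule_rules; simp)+
    fix \<xi> a assume \<xi>: "\<xi> \<in> carrier H" and a: "a \<in> carrier A"
    have "tensor_lift W (\<lambda>x y. tensor_lift W (\<lambda>b c. adj_act H V W b P (ract V (hact V c v) (hact A y a))) (coprod H x)) (coprod H \<xi>)
        = tensor_lift W (\<lambda>x y. tensor_lift W (\<lambda>b c. adj_act H V W x P (ract V (hact V b v) (hact A c a))) (coprod H y)) (coprod H \<xi>)"
      using v a lin by (intro coassoc_lift[OF W_module _ \<xi>] bimodule_rules) simp_all
    also have "\<dots> = tensor_lift W (\<lambda>x y. adj_act H V W x P (hact V y (ract V v a))) (coprod H \<xi>)"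
    proof (rule lift_cong)
      fix x y assume xy: "x \<in> carrier H" "y \<in> carrier H"
      then show "tensor_lift W (\<lambda>b c. adj_act H V W x P (ract V (hact V b v) (hact A c a))) (coprod H y)
        = adj_act H V W x P (hact V y (ract V v a))"
        using v a by (subst V.hact_ract) (auto intro!: HH.linear_tensor_lift[symmetric] W_module V_module adj_linear[OF lin])
    qed (simp add: \<xi>)
    also have "\<dots> = hact W \<xi> (ract W (P v) a)"
      using \<xi> v a by (simp add: adj_hact[OF lin] Pr)
    also have "\<dots> = tensor_lift W (\<lambda>x y. ract W (hact W x (P v)) (hact A y a)) (coprod H \<xi>)"
      using \<xi> v a Pc by (simp add: W.hact_ract)
    also have "\<dots> = tensor_lift W (\<lambda>x y. tensor_lift W (\<lambda>b c. ract W (adj_act H V W b P (hact V c v)) (hact A y a)) (coprod H x)) (coprod H \<xi>)"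
    proof (rule lift_cong)
      fix x y assume xy: "x \<in> carrier H" "y \<in> carrier H"
      have "ract W (tensor_lift W (\<lambda>b c. adj_act H V W b P (hact V c v)) (coprod H x)) (hact A y a)
          = tensor_lift W (\<lambda>b c. ract W (adj_act H V W b P (hact V c v)) (hact A y a)) (coprod H x)"
        using xy v a lin
        by (intro HH.linear_tensor_lift[where h = "\<lambda>w. ract W w (hact A y a)"] W_module W.ract_linear) simp_all
      then show "ract W (hact W x (P v)) (hact A y a)
          = tensor_lift W (\<lambda>b c. ract W (adj_act H V W b P (hact V c v)) (hact A y a)) (coprod H x)"
        using xy v by (simp add: adj_hact[OF lin])
    qed (simp add: \<xi>)
    finally show "tensor_lift W (\<lambda>x y. tensor_lift W (\<lambda>b c. adj_act H V W b P (ract V (hact V c v) (hact A y a))) (coprod H x)) (coprod H \<xi>)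
      = tensor_lift W (\<lambda>x y. tensor_lift W (\<lambda>b c. ract W (adj_act H V W b P (hact V c v)) (hact A y a)) (coprod H x)) (coprod H \<xi>)" .
  qed
  have "adj_act H V W \<xi> P (ract V v a) = ract W (adj_act H V W \<xi> P v) a"
    if v: "v \<in> carrier V" and a: "a \<in> carrier A" for v a
  proof (rule V.module_cancel[OF W_module _ _ _ \<xi> v, where
        g = "\<lambda>\<xi> v. adj_act H V W \<xi> P (ract V v a)" and h = "\<lambda>\<xi> v. ract W (adj_act H V W \<xi> P v) a"])
    show "(\<lambda>\<xi> v. adj_act H V W \<xi> P (ract V v a)) \<in> bilinear_maps K H V W"
      "(\<lambda>\<xi> v. ract W (adj_act H V W \<xi> P v) a) \<in> bilinear_maps K H V W"
      using a lin by (intro bimodule_rules; simp)+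
  qed (use a aux in auto)
  then show ?thesis
    using adj_linear[OF lin \<xi>] by (simp add: right_linear_maps_def)
qed

end

section \<open>The action of \<open>H\<close> on a tensor product over \<open>A\<close>\<close>

lemma tensor_bimod_simps:
  fixes H A V W
  defines "T \<equiv> tensor_group (carrier A) (ract V) (lact W) V W"
  shows "carrier (tensor_bimod H A V W) = carrier T"
    and "ring.add (tensor_bimod H A V W) = ring.add T"
    and "\<zero>\<^bsub>tensor_bimod H A V W\<^esub> = \<zero>\<^bsub>T\<^esub>"
    and "k \<odot>\<^bsub>tensor_bimod H A V W\<^esub> t
      = tensor_lift (tensor_bimod H A V W) (\<lambda>v w. pure_tensor (tensor_bimod H A V W) (k \<odot>\<^bsub>V\<^esub> v) w) t"
    and "hact (tensor_bimod H A V W) \<xi>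
      = tensor_lift (tensor_bimod H A V W) (\<lambda>v w. tensor_lift (tensor_bimod H A V W)
          (\<lambda>x y. pure_tensor (tensor_bimod H A V W) (hact V x v) (hact W y w)) (coprod H \<xi>))"
proof -
  have eqs: "carrier (tensor_bimod H A V W) = carrier T"
    "ring.add (tensor_bimod H A V W) = ring.add T" "\<zero>\<^bsub>tensor_bimod H A V W\<^esub> = \<zero>\<^bsub>T\<^esub>"
    by (simp_all add: tensor_bimod_def T_def Let_def)
  then show "carrier (tensor_bimod H A V W) = carrier T"
    "ring.add (tensor_bimod H A V W) = ring.add T" "\<zero>\<^bsub>tensor_bimod H A V W\<^esub> = \<zero>\<^bsub>T\<^esub>"
    by simp_all
  have l: "tensor_lift T = tensor_lift (tensor_bimod H A V W)"
    by (rule tensor_lift_codomain) (simp_all add: eqs)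
  have l': "tensor_lift T = tensor_lift (tensor_bimod H A V W)"
    by (rule tensor_lift_codomain) (simp_all add: eqs)
  have p: "pure_tensor T = pure_tensor (tensor_bimod H A V W)"
    by (rule pure_tensor_codomain) (simp add: eqs)
  show "k \<odot>\<^bsub>tensor_bimod H A V W\<^esub> t
      = tensor_lift (tensor_bimod H A V W) (\<lambda>v w. pure_tensor (tensor_bimod H A V W) (k \<odot>\<^bsub>V\<^esub> v) w) t"
    "hact (tensor_bimod H A V W) \<xi>
      = tensor_lift (tensor_bimod H A V W) (\<lambda>v w. tensor_lift (tensor_bimod H A V W)
          (\<lambda>x y. pure_tensor (tensor_bimod H A V W) (hact V x v) (hact W y w)) (coprod H \<xi>))"
    by (simp_all flip: l l' p) (simp_all add: tensor_bimod_def Let_def flip: T_def)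
qed

context hmodule_bimodule_pair
begin

abbreviation VW where "VW \<equiv> tensor_bimod H A V W"

sublocale VW: module_tensor K "carrier A" "ract V" "lact W" V W VW
proof unfold_locales
  \<comment> \<open>A scalar \<open>k\<close> acts on both factors as the element \<open>k 1\<close>
    of \<open>A\<close>.\<close>
  show "\<exists>s \<in> carrier A. (\<forall>v \<in> carrier V. ract V v s = k \<odot>\<^bsub>V\<^esub> v) \<and> (\<forall>w \<in> carrier W. lact W s w = k \<odot>\<^bsub>W\<^esub> w)"
    if "k \<in> carrier K" for k
    using that
    by (intro bexI[of _ "k \<odot>\<^bsub>A\<^esub> \<one>\<^bsub>A\<^esub>"]) (simp_all add: V.ract_smult V.ract_one W.lact_smult W.lact_one)
qed (simp_all add: tensor_bimod_simps linear_mapsD(3)[OF V.ract_linear])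

lemma VW_pure_left:
  "\<lbrakk>w \<in> carrier W; g \<in> linear_maps K U V\<rbrakk> \<Longrightarrow> (\<lambda>x. pure_tensor VW (g x) w) \<in> linear_maps K U VW"
  by (rule bilinear_apply_left[OF VW.pure_tensor_bilinear])

lemma VW_pure_right:
  "\<lbrakk>v \<in> carrier V; g \<in> linear_maps K U W\<rbrakk> \<Longrightarrow> (\<lambda>x. pure_tensor VW v (g x)) \<in> linear_maps K U VW"
  by (rule bilinear_apply_right[OF VW.pure_tensor_bilinear])

lemmas VW_rules = VW_pure_left VW_pure_right VW.T_module

text \<open>Acting on \<open>v a\<close> in the left factor or on \<open>a w\<close> in the right
  one distributes \<xi> over \<open>v\<close>, \<open>a\<close> and \<open>w\<close>. The two
  distributions differ by coassociativity and by moving the leg on \<open>a\<close> across the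
  tensor sign.\<close>

lemma hact_VW_balanced:
  assumes \<xi>: "\<xi> \<in> carrier H"
  shows "balanced (carrier A) (ract V) (lact W) V W VW
    (\<lambda>v w. tensor_lift VW (\<lambda>x y. pure_tensor VW (hact V x v) (hact W y w)) (coprod H \<xi>))"
proof (rule VW.bilinear_balanced)
  show "(\<lambda>v w. tensor_lift VW (\<lambda>x y. pure_tensor VW (hact V x v) (hact W y w)) (coprod H \<xi>)) \<in> bilinear_maps K V W VW"
    using \<xi> by (intro VW_rules bimodule_rules) simp_all
  fix v a w assume v: "v \<in> carrier V" and a: "a \<in> carrier A" and w: "w \<in> carrier W"
  have "tensor_lift VW (\<lambda>x y. pure_tensor VW (hact V x (ract V v a)) (hact W y w)) (coprod H \<xi>)
      = tensor_lift VW (\<lambda>x y. tensor_lift VW (\<lambda>b c. pure_tensor VW (ract V (hact V b v) (hact A c a)) (hact W y w)) (coprod H x)) (coprod H \<xi>)"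
  proof (rule lift_cong)
    fix x y assume "x \<in> carrier H" "y \<in> carrier H"
    then show "pure_tensor VW (hact V x (ract V v a)) (hact W y w)
      = tensor_lift VW (\<lambda>b c. pure_tensor VW (ract V (hact V b v) (hact A c a)) (hact W y w)) (coprod H x)"
      using v a w
      by (subst V.hact_ract, (simp_all)[3])
        (intro HH.linear_tensor_lift[where h = "\<lambda>v. pure_tensor VW v (hact W y w)"] V_module VW_rules linear_maps_id; simp)
  qed (simp add: \<xi>)
  also have "\<dots> = tensor_lift VW (\<lambda>x y. tensor_lift VW (\<lambda>b c. pure_tensor VW (ract V (hact V x v) (hact A b a)) (hact W c w)) (coprod H y)) (coprod H \<xi>)"
    using v a w by (intro coassoc_lift[OF VW.T_module _ \<xi>] VW_rules bimodule_rules) simp_all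
  also have "\<dots> = tensor_lift VW (\<lambda>x y. pure_tensor VW (hact V x v) (hact W y (lact W a w))) (coprod H \<xi>)"
  proof (rule lift_cong)
    fix x y assume xy: "x \<in> carrier H" "y \<in> carrier H"
    have "tensor_lift VW (\<lambda>b c. pure_tensor VW (ract V (hact V x v) (hact A b a)) (hact W c w)) (coprod H y)
      = tensor_lift VW (\<lambda>b c. pure_tensor VW (hact V x v) (lact W (hact A b a) (hact W c w))) (coprod H y)"
      using xy v a w by (intro lift_cong) (simp_all add: VW.pure_tensor_balanced)
    also have "\<dots> = pure_tensor VW (hact V x v) (tensor_lift W (\<lambda>b c. lact W (hact A b a) (hact W c w)) (coprod H y))"
      using xy v a w
      by (intro HH.linear_tensor_lift[symmetric] W_module VW_rules linear_maps_id) simp_all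
    finally show "tensor_lift VW (\<lambda>b c. pure_tensor VW (ract V (hact V x v) (hact A b a)) (hact W c w)) (coprod H y)
      = pure_tensor VW (hact V x v) (hact W y (lact W a w))"
      using xy a w by (simp add: W.hact_lact)
  qed (simp add: \<xi>)
  finally show "tensor_lift VW (\<lambda>x y. pure_tensor VW (hact V x (ract V v a)) (hact W y w)) (coprod H \<xi>)
      = tensor_lift VW (\<lambda>x y. pure_tensor VW (hact V x v) (hact W y (lact W a w))) (coprod H \<xi>)" .
qed

lemma hact_VW_linear:
  assumes \<xi>: "\<xi> \<in> carrier H"
  shows "hact VW \<xi> \<in> linear_maps K VW VW"
  unfolding tensor_bimod_simps(5)
  using \<xi> by (intro VW.tensor_lift_linear hact_VW_balanced VW_rules bimodule_rules) simp_all

lemma hact_VW_pure: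
  assumes "\<xi> \<in> carrier H" and "v \<in> carrier V" and "w \<in> carrier W"
  shows "hact VW \<xi> (pure_tensor VW v w)
    = tensor_lift VW (\<lambda>x y. pure_tensor VW (hact V x v) (hact W y w)) (coprod H \<xi>)"
  unfolding tensor_bimod_simps(5)
  using assms by (intro VW.tensor_lift_pure hact_VW_balanced VW.T_abelian_group)

lemma VW_linear_eqI:
  assumes "f \<in> linear_maps K VW M" and "g \<in> linear_maps K VW M" and "t \<in> carrier VW"
    and "\<And>v w. \<lbrakk>v \<in> carrier V; w \<in> carrier W\<rbrakk> \<Longrightarrow> f (pure_tensor VW v w) = g (pure_tensor VW v w)"
  shows "f t = g t"
  by (rule VW.additive_maps_eqI[OF linear_maps_additive[OF assms(1)] linear_maps_additive[OF assms(2)] assms(3,4)])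

lemma hact_VW_param:
  assumes t: "t \<in> carrier VW"
  shows "(\<lambda>\<xi>. hact VW \<xi> t) \<in> linear_maps K H VW"
  unfolding tensor_bimod_simps(5) using t
  by (intro VW.tensor_lift_linear_param VW_rules bimodule_rules module_axioms) simp_all

text \<open>Makes the adjoint action available for maps between tensor products, in particular for
  the R-tensor product of \<open>P\<close> and \<open>Q\<close>.\<close>

lemma VW_left_hmodule: "left_hmodule K H VW"
proof (intro left_hmodule.intro hopf_algebra_axioms VW.T_module left_hmodule_axioms.intro)
  show "hact VW \<xi> \<in> linear_maps K VW VW" if "\<xi> \<in> carrier H" for \<xi>
    using that by (rule hact_VW_linear)
  show "hact VW (\<xi> \<oplus> \<zeta>) t = hact VW \<xi> t \<oplus>\<^bsub>VW\<^esub> hact VW \<zeta> t"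
    if "\<xi> \<in> carrier H" "\<zeta> \<in> carrier H" "t \<in> carrier VW" for \<xi> \<zeta> t
    using linear_mapsD(2)[OF hact_VW_param[OF that(3)] that(1,2)] .
  show "hact VW (k \<odot> \<xi>) t = k \<odot>\<^bsub>VW\<^esub> hact VW \<xi> t"
    if "k \<in> carrier K" "\<xi> \<in> carrier H" "t \<in> carrier VW" for k \<xi> t
    using linear_mapsD(3)[OF hact_VW_param[OF that(3)] that(1,2)] .
  show "hact VW \<one> t = t" if "t \<in> carrier VW" for t
  proof (rule VW_linear_eqI[OF hact_VW_linear linear_maps_id that])
    fix v w assume v: "v \<in> carrier V" and w: "w \<in> carrier W"
    then have "(\<lambda>x y. pure_tensor VW (hact V x v) (hact W y w)) \<in> bilinear_maps K H H VW"
      by (intro VW_rules bimodule_rules) simp_all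
    then show "hact VW \<one> (pure_tensor VW v w) = pure_tensor VW v w"
      using v w by (simp add: hact_VW_pure coprod_one HH.lift_one[OF VW.T_module] V.hact_one W.hact_one)
  qed simp
  show "hact VW (\<xi> \<otimes> \<zeta>) t = hact VW \<xi> (hact VW \<zeta> t)"
    if \<xi>: "\<xi> \<in> carrier H" and \<zeta>: "\<zeta> \<in> carrier H" and t: "t \<in> carrier VW" for \<xi> \<zeta> t
  proof (rule VW_linear_eqI[OF hact_VW_linear linear_maps_comp[OF hact_VW_linear hact_VW_linear] t])
    fix v w assume v: "v \<in> carrier V" and w: "w \<in> carrier W"
    have bil: "(\<lambda>x y. pure_tensor VW (hact V x v) (hact W y w)) \<in> bilinear_maps K H H VW"
      using v w by (intro VW_rules bimodule_rules) simp_all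
    have "hact VW \<xi> (hact VW \<zeta> (pure_tensor VW v w))
        = tensor_lift VW (\<lambda>u z. hact VW \<xi> (pure_tensor VW (hact V u v) (hact W z w))) (coprod H \<zeta>)"
      using \<xi> \<zeta> v w
      by (simp add: hact_VW_pure) (intro HH.linear_tensor_lift VW.T_module hact_VW_linear; simp add: VW.pure_tensor_closed)
    also have "\<dots> = tensor_lift VW (\<lambda>u z. tensor_lift VW (\<lambda>x y. pure_tensor VW (hact V x (hact V u v)) (hact W y (hact W z w))) (coprod H \<xi>)) (coprod H \<zeta>)"
      using \<xi> \<zeta> v w by (intro lift_cong) (simp_all add: hact_VW_pure)
    also have "\<dots> = tensor_lift VW (\<lambda>x y. tensor_lift VW (\<lambda>u z. pure_tensor VW (hact V x (hact V u v)) (hact W y (hact W z w))) (coprod H \<zeta>)) (coprod H \<xi>)"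
      using \<xi> \<zeta> v w by (intro lift_swap VW.T_module) (simp_all add: VW.pure_tensor_closed)
    also have "\<dots> = tensor_lift VW (\<lambda>x y. tensor_lift VW (\<lambda>u z. pure_tensor VW (hact V (x \<otimes> u) v) (hact W (y \<otimes> z) w)) (coprod H \<zeta>)) (coprod H \<xi>)"
      using \<xi> \<zeta> v w by (intro lift_cong) (simp_all add: V.hact_mult W.hact_mult)
    also have "\<dots> = hact VW (\<xi> \<otimes> \<zeta>) (pure_tensor VW v w)"
      using \<xi> \<zeta> v w by (simp add: hact_VW_pure coprod_mult HH.lift_mult[OF VW.T_module bil])
    finally show "hact VW (\<xi> \<otimes> \<zeta>) (pure_tensor VW v w) = hact VW \<xi> (hact VW \<zeta> (pure_tensor VW v w))" by simp
  qed (use \<xi> \<zeta> in simp_all)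
qed

end

section \<open>Twists and universal R-matrices\<close>

text \<open>Inverts the equation \<open>a b = c d\<close>. The one-sided inverses are given
  explicitly because this is the form in which \<open>legs_inverse\<close> supplies them.\<close>

lemma (in monoid) inverse_products_eq:
  assumes "a \<otimes> b = c \<otimes> d" and "a' \<otimes> a = \<one>" and "b' \<otimes> b = \<one>" and "c \<otimes> c' = \<one>" and "d \<otimes> d' = \<one>"
    and "a \<in> carrier G" "b \<in> carrier G" "c \<in> carrier G" "d \<in> carrier G"
    and "a' \<in> carrier G" "b' \<in> carrier G" "c' \<in> carrier G" "d' \<in> carrier G"
  shows "b' \<otimes> a' = d' \<otimes> c'"
proof -
  have 1: "c \<otimes> d \<otimes> (d' \<otimes> c') = \<one>"
    using assms by (metis m_assoc m_closed r_one)
  have 2: "b' \<otimes> a' \<otimes> (a \<otimes> b) = \<one>"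
    using assms by (metis m_assoc m_closed r_one)
  have "b' \<otimes> a' = b' \<otimes> a' \<otimes> (a \<otimes> b \<otimes> (d' \<otimes> c'))"
    using 1 assms by simp
  also have "\<dots> = b' \<otimes> a' \<otimes> (a \<otimes> b) \<otimes> (d' \<otimes> c')"
    using assms by (simp only: m_assoc m_closed)
  finally show ?thesis
    using 2 assms by simp
qed

text \<open>Cancels \<open>c\<close> on the left and \<open>b\<close> on the right of the same
  equation, which leaves products of an original factor with an inverse one.\<close>

lemma (in monoid) mixed_products_eq:
  assumes "a \<otimes> b = c \<otimes> d" and "c' \<otimes> c = \<one>" and "b \<otimes> b' = \<one>"
    and "a \<in> carrier G" "b \<in> carrier G" "c \<in> carrier G" "d \<in> carrier G"
    and "b' \<in> carrier G" "c' \<in> carrier G"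
  shows "c' \<otimes> a = d \<otimes> b'"
proof -
  have "c \<otimes> (d \<otimes> b') = a \<otimes> b \<otimes> b'"
    using assms(4-9) by (simp add: assms(1) m_assoc)
  also have "\<dots> = a"
    using assms(3-9) by (simp add: m_assoc)
  finally have "c' \<otimes> a = c' \<otimes> (c \<otimes> (d \<otimes> b'))" by simp
  also have "\<dots> = c' \<otimes> c \<otimes> (d \<otimes> b')"
    using assms(4-9) by (simp only: m_assoc m_closed)
  finally show ?thesis
    using assms(2,4-9) by simp
qed

section \<open>Sweedler sums over products of tensors\<close>

context hopf_algebra
begin

text \<open>The tensor precedes the function, so that nested sums can be read in the order of their
  bound variables.\<close>

abbreviation (input) tsum :: "('k, 'u, 'n) module_scheme \<Rightarrow> ('h, 'h) tensor \<Rightarrow> ('h \<Rightarrow> 'h \<Rightarrow> 'u) \<Rightarrow> 'u" where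
  "tsum M t f \<equiv> tensor_lift M f t"

lemma H2_monoid: "monoid H2"
  using HH.AB_unital_algebra by (simp add: unital_algebra_def ring_def)

lemma H3_monoid: "monoid H3"
  using HHH.AB_unital_algebra by (simp add: unital_algebra_def ring_def)

lemma H2_mult_closed [simp]: "\<lbrakk>s \<in> carrier H2; t \<in> carrier H2\<rbrakk> \<Longrightarrow> s \<otimes>\<^bsub>H2\<^esub> t \<in> carrier H2"
  by (rule monoid.m_closed[OF H2_monoid])

lemma H3_mult_closed [simp]: "\<lbrakk>s \<in> carrier H3; t \<in> carrier H3\<rbrakk> \<Longrightarrow> s \<otimes>\<^bsub>H3\<^esub> t \<in> carrier H3"
  by (rule monoid.m_closed[OF H3_monoid])

lemmas H2_m_assoc = monoid.m_assoc[OF H2_monoid]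

text \<open>A factor embedded in two legs changes only these; the unit in the remaining leg
  disappears. The two lemmas that follow treat the other embeddings.\<close>

lemma lift3_mult_leg12:
  assumes M: "module K M" and f: "f \<in> trilinear_maps K H M" and s: "s \<in> carrier H3" and t: "t \<in> carrier H2"
  shows "lift3 M f (s \<otimes>\<^bsub>H3\<^esub> leg12 K H t) = lift3 M (\<lambda>x y z. tsum M t (\<lambda>c d. f (x \<otimes> c) (y \<otimes> d) z)) s"
proof -
  have "lift3 M f (s \<otimes>\<^bsub>H3\<^esub> leg12 K H t)
      = lift3 M (\<lambda>x y z. tsum M t (\<lambda>c d. f (x \<otimes> c) (y \<otimes> d) (z \<otimes> \<one>))) s"
    unfolding lift3_mult[OF M f s legs_closed(1)[OF t]]
    by (intro lift3_cong[OF s] lift3_legs(1)[OF M _ t] linear_rules trilinear_apply[OF f]) simp_all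
  also have "\<dots> = lift3 M (\<lambda>x y z. tsum M t (\<lambda>c d. f (x \<otimes> c) (y \<otimes> d) z)) s"
    by (rule lift3_cong[OF s]) simp
  finally show ?thesis .
qed

lemma lift3_mult_leg13:
  assumes M: "module K M" and f: "f \<in> trilinear_maps K H M" and s: "s \<in> carrier H3" and t: "t \<in> carrier H2"
  shows "lift3 M f (s \<otimes>\<^bsub>H3\<^esub> leg13 K H t) = lift3 M (\<lambda>x y z. tsum M t (\<lambda>c d. f (x \<otimes> c) y (z \<otimes> d))) s"
proof -
  have "lift3 M f (s \<otimes>\<^bsub>H3\<^esub> leg13 K H t)
      = lift3 M (\<lambda>x y z. tsum M t (\<lambda>c d. f (x \<otimes> c) (y \<otimes> \<one>) (z \<otimes> d))) s"
    unfolding lift3_mult[OF M f s legs_closed(2)[OF t]]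
    by (intro lift3_cong[OF s] lift3_legs(2)[OF M _ t] linear_rules trilinear_apply[OF f]) simp_all
  also have "\<dots> = lift3 M (\<lambda>x y z. tsum M t (\<lambda>c d. f (x \<otimes> c) y (z \<otimes> d))) s"
    by (rule lift3_cong[OF s]) simp
  finally show ?thesis .
qed

lemma lift3_mult_leg23:
  assumes M: "module K M" and f: "f \<in> trilinear_maps K H M" and s: "s \<in> carrier H3" and t: "t \<in> carrier H2"
  shows "lift3 M f (s \<otimes>\<^bsub>H3\<^esub> leg23 K H t) = lift3 M (\<lambda>x y z. tsum M t (\<lambda>c d. f x (y \<otimes> c) (z \<otimes> d))) s"
proof -
  have "lift3 M f (s \<otimes>\<^bsub>H3\<^esub> leg23 K H t)
      = lift3 M (\<lambda>x y z. tsum M t (\<lambda>c d. f (x \<otimes> \<one>) (y \<otimes> c) (z \<otimes> d))) s"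
    unfolding lift3_mult[OF M f s legs_closed(3)[OF t]]
    by (intro lift3_cong[OF s] lift3_legs(3)[OF M _ t] linear_rules trilinear_apply[OF f]) simp_all
  also have "\<dots> = lift3 M (\<lambda>x y z. tsum M t (\<lambda>c d. f x (y \<otimes> c) (z \<otimes> d))) s"
    by (rule lift3_cong[OF s]) simp
  finally show ?thesis .
qed

lemma lift_coprod_mult:
  assumes M: "module K M" and f: "f \<in> bilinear_maps K H H M" and x: "x \<in> carrier H" and y: "y \<in> carrier H"
  shows "tsum M (coprod H (x \<otimes> y)) f
    = tsum M (coprod H x) (\<lambda>a b. tsum M (coprod H y) (\<lambda>c d. f (a \<otimes> c) (b \<otimes> d)))"
  using x y by (simp add: coprod_mult HH.lift_mult[OF M f])

text \<open>The shape of the twisted coproduct, which is conjugated by the twist.\<close>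

lemma lift_conj:
  assumes M: "module K M" and f: "f \<in> bilinear_maps K H H M"
    and s: "s \<in> carrier H2" and t: "t \<in> carrier H2" and u: "u \<in> carrier H2"
  shows "tsum M (s \<otimes>\<^bsub>H2\<^esub> t \<otimes>\<^bsub>H2\<^esub> u) f
    = tsum M s (\<lambda>a b. tsum M t (\<lambda>x y. tsum M u (\<lambda>c d. f (a \<otimes> x \<otimes> c) (b \<otimes> y \<otimes> d))))"
proof -
  have g: "(\<lambda>x y. tsum M u (\<lambda>c d. f (x \<otimes> c) (y \<otimes> d))) \<in> bilinear_maps K H H M"
    using u M by (intro linear_rules module_axioms bilinear_apply_left[OF f] bilinear_apply_right[OF f]) simp_all
  show ?thesis
    using s t u by (simp add: HH.lift_mult[OF M f] HH.lift_mult[OF M g])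
qed

lemma legs_inverse:
  assumes s: "s \<in> carrier H2" and t: "t \<in> carrier H2" and st: "s \<otimes>\<^bsub>H2\<^esub> t = \<one>\<^bsub>H2\<^esub>"
  shows "leg12 K H s \<otimes>\<^bsub>H3\<^esub> leg12 K H t = \<one>\<^bsub>H3\<^esub>"
    and "leg13 K H s \<otimes>\<^bsub>H3\<^esub> leg13 K H t = \<one>\<^bsub>H3\<^esub>"
    and "leg23 K H s \<otimes>\<^bsub>H3\<^esub> leg23 K H t = \<one>\<^bsub>H3\<^esub>"
    and "coprod_left K H s \<otimes>\<^bsub>H3\<^esub> coprod_left K H t = \<one>\<^bsub>H3\<^esub>"
    and "coprod_right K H s \<otimes>\<^bsub>H3\<^esub> coprod_right K H t = \<one>\<^bsub>H3\<^esub>"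
    and "flip K H s \<otimes>\<^bsub>H2\<^esub> flip K H t = \<one>\<^bsub>H2\<^esub>"
    and "counit_left H s \<otimes> counit_left H t = \<one>"
    and "counit_right H s \<otimes> counit_right H t = \<one>"
  using legs_mult[OF s t] legs_one st by simp_all

end

locale twisted_hopf_algebra = quasitriangular_hopf_algebra K H R
  for K and H :: "('k, 'h, 'm) hopf_scheme" (structure) and R :: "('h, 'h) tensor" +
  fixes F :: "('h, 'h) tensor"
  assumes twist: "is_twist K H F"

subsection \<open>The R-matrix\<close>

context quasitriangular_hopf_algebra
begin

abbreviation Ri where "Ri \<equiv> inv\<^bsub>H2\<^esub> R"

lemma R_closed [simp]: "R \<in> carrier H2"
  using R_Units by (simp add: Units_def)

lemma Ri_closed [simp]: "Ri \<in> carrier H2"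
  by (rule monoid.Units_inv_closed[OF H2_monoid R_Units])

lemma R_Ri: "R \<otimes>\<^bsub>H2\<^esub> Ri = \<one>\<^bsub>H2\<^esub>" and Ri_R: "Ri \<otimes>\<^bsub>H2\<^esub> R = \<one>\<^bsub>H2\<^esub>"
  using monoid.Units_r_inv[OF H2_monoid R_Units] monoid.Units_l_inv[OF H2_monoid R_Units] by auto

text \<open>Inverting \<open>R\<^sub>1\<^sub>3 R\<^sub>2\<^sub>3\<close> reverses the order of the
  two factors.\<close>

lemma coprod_left_Ri: "coprod_left K H Ri = leg23 K H Ri \<otimes>\<^bsub>H3\<^esub> leg13 K H Ri"
proof -
  interpret H3: monoid H3 by (rule H3_monoid)
  \<comment> \<open>The axiom has a single factor on its left side, so a unit is added to bring it
    into the shape of a product of two.\<close>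
  have "\<one>\<^bsub>H3\<^esub> \<otimes>\<^bsub>H3\<^esub> coprod_left K H Ri = leg23 K H Ri \<otimes>\<^bsub>H3\<^esub> leg13 K H Ri"
    by (rule H3.inverse_products_eq[symmetric, where a = "leg13 K H R" and b = "leg23 K H R"
          and c = "coprod_left K H R" and d = "\<one>\<^bsub>H3\<^esub>" and d' = "\<one>\<^bsub>H3\<^esub>"])
      (simp_all add: legs_closed R_coprod_left legs_inverse[OF _ _ R_Ri] legs_inverse[OF _ _ Ri_R]
        flip: R_coprod_left)
  then show ?thesis
    by (simp add: legs_closed)
qed

lemma coprod_right_Ri: "coprod_right K H Ri = leg12 K H Ri \<otimes>\<^bsub>H3\<^esub> leg13 K H Ri"
proof -
  interpret H3: monoid H3 by (rule H3_monoid)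
  have "\<one>\<^bsub>H3\<^esub> \<otimes>\<^bsub>H3\<^esub> coprod_right K H Ri = leg12 K H Ri \<otimes>\<^bsub>H3\<^esub> leg13 K H Ri"
    by (rule H3.inverse_products_eq[symmetric, where a = "leg13 K H R" and b = "leg12 K H R"
          and c = "coprod_right K H R" and d = "\<one>\<^bsub>H3\<^esub>" and d' = "\<one>\<^bsub>H3\<^esub>"])
      (simp_all add: legs_closed legs_inverse[OF _ _ R_Ri] legs_inverse[OF _ _ Ri_R] flip: R_coprod_right)
  then show ?thesis
    by (simp add: legs_closed)
qed

lemma lift_coprod_left_Ri:
  assumes M: "module K M" and f: "f \<in> trilinear_maps K H M"
  shows "tsum M Ri (\<lambda>a b. tsum M (coprod H a) (\<lambda>p q. f p q b))
       = tsum M Ri (\<lambda>a b. tsum M Ri (\<lambda>c d. f c a (b \<otimes> d)))"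
proof -
  have "tsum M Ri (\<lambda>a b. tsum M (coprod H a) (\<lambda>p q. f p q b)) = lift3 M f (coprod_left K H Ri)"
    by (simp add: lift3_legs(4)[OF M f])
  also have "\<dots> = lift3 M (\<lambda>x y z. tsum M Ri (\<lambda>c d. f (x \<otimes> c) y (z \<otimes> d))) (leg23 K H Ri)"
    by (simp add: coprod_left_Ri lift3_mult_leg13[OF M f] legs_closed)
  also have "\<dots> = tsum M Ri (\<lambda>a b. tsum M Ri (\<lambda>c d. f (\<one> \<otimes> c) a (b \<otimes> d)))"
    by (intro lift3_legs(3)[OF M] linear_rules trilinear_apply[OF f] M module_axioms) simp_all
  also have "\<dots> = tsum M Ri (\<lambda>a b. tsum M Ri (\<lambda>c d. f c a (b \<otimes> d)))"
    by (intro lift_cong) simp_all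
  finally show ?thesis .
qed

lemma lift_coprod_right_Ri:
  assumes M: "module K M" and f: "f \<in> trilinear_maps K H M"
  shows "tsum M Ri (\<lambda>a b. tsum M (coprod H b) (\<lambda>p q. f a p q))
       = tsum M Ri (\<lambda>a b. tsum M Ri (\<lambda>c d. f (a \<otimes> c) b d))"
proof -
  have "tsum M Ri (\<lambda>a b. tsum M (coprod H b) (\<lambda>p q. f a p q)) = lift3 M f (coprod_right K H Ri)"
    by (simp add: lift3_legs(5)[OF M f])
  also have "\<dots> = lift3 M (\<lambda>x y z. tsum M Ri (\<lambda>c d. f (x \<otimes> c) y (z \<otimes> d))) (leg12 K H Ri)"
    by (simp add: coprod_right_Ri lift3_mult_leg13[OF M f] legs_closed)
  also have "\<dots> = tsum M Ri (\<lambda>a b. tsum M Ri (\<lambda>c d. f (a \<otimes> c) b (\<one> \<otimes> d)))"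
    by (intro lift3_legs(1)[OF M] linear_rules trilinear_apply[OF f] M module_axioms) simp_all
  also have "\<dots> = tsum M Ri (\<lambda>a b. tsum M Ri (\<lambda>c d. f (a \<otimes> c) b d))"
    by (intro lift_cong) simp_all
  finally show ?thesis .
qed

text \<open>Multiplying \<open>R_coprod\<close> by the inverse of \<open>R\<close> on the left gives
  \<open>R\<inverse> \<Delta>\<^sup>o\<^sup>p = \<Delta> R\<inverse>\<close>; the opposite coproduct
  shows in the exchange of \<open>x\<close> and \<open>y\<close>.\<close>

lemma lift_Ri_coprod:
  assumes M: "module K M" and f: "f \<in> bilinear_maps K H H M" and \<xi>: "\<xi> \<in> carrier H"
  shows "tsum M Ri (\<lambda>a b. tsum M (coprod H \<xi>) (\<lambda>x y. f (a \<otimes> y) (b \<otimes> x)))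
       = tsum M (coprod H \<xi>) (\<lambda>x y. tsum M Ri (\<lambda>a b. f (x \<otimes> a) (y \<otimes> b)))"
proof -
  have "Ri \<otimes>\<^bsub>H2\<^esub> flip K H (coprod H \<xi>) = (Ri \<otimes>\<^bsub>H2\<^esub> R) \<otimes>\<^bsub>H2\<^esub> coprod H \<xi> \<otimes>\<^bsub>H2\<^esub> Ri"
    using \<xi> by (simp only: R_coprod H2_m_assoc R_closed Ri_closed coprod_closed H2_mult_closed)
  then have eq: "Ri \<otimes>\<^bsub>H2\<^esub> flip K H (coprod H \<xi>) = coprod H \<xi> \<otimes>\<^bsub>H2\<^esub> Ri"
    using \<xi> by (simp add: Ri_R)
  have "tsum M Ri (\<lambda>a b. tsum M (coprod H \<xi>) (\<lambda>x y. f (a \<otimes> y) (b \<otimes> x)))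
      = tsum M Ri (\<lambda>a b. tsum M (flip K H (coprod H \<xi>)) (\<lambda>x y. f (a \<otimes> x) (b \<otimes> y)))"
    using \<xi> by (intro lift_cong lift_flip[symmetric] M linear_rules bilinear_apply_left[OF f] bilinear_apply_right[OF f]) simp_all
  also have "\<dots> = tsum M (Ri \<otimes>\<^bsub>H2\<^esub> flip K H (coprod H \<xi>)) f"
    using \<xi> by (simp add: HH.lift_mult[OF M f] legs_closed)
  finally show ?thesis
    using \<xi> by (simp add: eq HH.lift_mult[OF M f])
qed

text \<open>Applying the counit to the middle leg of the formula for
  \<open>id \<otimes> \<Delta>\<close> on \<open>R\<inverse>\<close> yields
  \<open>(u \<otimes> 1) R\<inverse> = R\<inverse>\<close>, where \<open>u\<close> is the element to
  be computed. Multiplication by \<open>R\<close> on the right then leaves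
  \<open>u \<otimes> 1 = 1 \<otimes> 1\<close>.\<close>

lemma counit_right_Ri: "counit_right H Ri = \<one>"
proof -
  let ?u = "counit_right H Ri" and ?p = "pure_tensor H2"
  have u: "?u \<in> carrier H" by (simp add: legs_closed)
  have tri: "(\<lambda>x y z. ?p x (counit H y \<odot> z)) \<in> trilinear_maps K H H2"
    by (intro linear_rules module_axioms) (simp_all add: linear_maps_id)
  have "?p ?u \<one> \<otimes>\<^bsub>H2\<^esub> Ri = tsum H2 Ri (\<lambda>c d. ?p (?u \<otimes> c) d)"
  proof -
    have "(\<lambda>a b. tsum H2 Ri (\<lambda>c d. ?p (a \<otimes> c) (b \<otimes> d))) \<in> bilinear_maps K H H H2"
      by (intro linear_rules HH.T_module module_axioms) simp_all
    then have "?p ?u \<one> \<otimes>\<^bsub>H2\<^esub> Ri = tsum H2 Ri (\<lambda>c d. ?p (?u \<otimes> c) (\<one> \<otimes> d))"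
      using u unfolding tensor_algebra_simps(4)[of K H H] by (simp add: HH.lift_pure[OF HH.T_module])
    also have "\<dots> = tsum H2 Ri (\<lambda>c d. ?p (?u \<otimes> c) d)"
      by (intro lift_cong) simp_all
    finally show ?thesis .
  qed
  also have "\<dots> = tsum H2 Ri (\<lambda>a b. counit H b \<odot>\<^bsub>H2\<^esub> tsum H2 Ri (\<lambda>c d. ?p (a \<otimes> c) d))"
    by (intro counit_right_lift[symmetric, where f = "\<lambda>a. tsum H2 Ri (\<lambda>c d. ?p (a \<otimes> c) d)"] HH.T_module linear_rules module_axioms) simp_all
  also have "\<dots> = tsum H2 Ri (\<lambda>a b. tsum H2 Ri (\<lambda>c d. ?p (a \<otimes> c) (counit H b \<odot> d)))"
  proof (rule lift_cong)
    fix a b assume ab: "a \<in> carrier H" "b \<in> carrier H"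
    then have "counit H b \<odot>\<^bsub>H2\<^esub> tsum H2 Ri (\<lambda>c d. ?p (a \<otimes> c) d) = tsum H2 Ri (\<lambda>c d. counit H b \<odot>\<^bsub>H2\<^esub> ?p (a \<otimes> c) d)"
      by (intro HH.linear_tensor_lift HH.T_module HH.T.smult_linear) (simp_all add: HH.pure_tensor_closed)
    also have "\<dots> = tsum H2 Ri (\<lambda>c d. ?p (a \<otimes> c) (counit H b \<odot> d))"
      using ab by (intro lift_cong) (simp_all add: HH.pure_tensor_smult_right)
    finally show "counit H b \<odot>\<^bsub>H2\<^esub> tsum H2 Ri (\<lambda>c d. ?p (a \<otimes> c) d) = tsum H2 Ri (\<lambda>c d. ?p (a \<otimes> c) (counit H b \<odot> d))" .
  qed simp
  also have "\<dots> = tsum H2 Ri (\<lambda>a b. tsum H2 (coprod H b) (\<lambda>p q. ?p a (counit H p \<odot> q)))"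
    by (rule lift_coprod_right_Ri[OF HH.T_module tri, symmetric])
  also have "\<dots> = tsum H2 Ri ?p"
  proof (rule lift_cong)
    fix a b assume ab: "a \<in> carrier H" "b \<in> carrier H"
    then have "tsum H2 (coprod H b) (\<lambda>p q. ?p a (counit H p \<odot> q)) = ?p a (tsum H (coprod H b) (\<lambda>p q. counit H p \<odot> q))"
      by (intro HH.linear_tensor_lift[symmetric] module_axioms HH.T_module linear_rules) simp_all
    then show "tsum H2 (coprod H b) (\<lambda>p q. ?p a (counit H p \<odot> q)) = ?p a b"
      using counit_left[OF ab(2)] by (simp add: counit_left_def)
  qed simp
  also have "\<dots> = Ri"
    by (simp add: HH.tensor_lift_pure_tensor)
  finally have "?p ?u \<one> \<otimes>\<^bsub>H2\<^esub> Ri \<otimes>\<^bsub>H2\<^esub> R = Ri \<otimes>\<^bsub>H2\<^esub> R" by simp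
  then have "?p ?u \<one> = \<one>\<^bsub>H2\<^esub>"
    using u by (simp add: H2_m_assoc Ri_R HH.pure_tensor_closed)
  \<comment> \<open>The multiplication map recovers \<open>u\<close> from its tensor product with
    the unit.\<close>
  moreover have mult: "(\<lambda>x y. x \<otimes> y) \<in> bilinear_maps K H H H"
    by (intro linear_rules) simp_all
  ultimately have "?u \<otimes> \<one> = \<one> \<otimes> \<one>"
    using HH.lift_pure[OF module_axioms mult u one_closed] HH.lift_one[OF module_axioms mult] by simp
  then show ?thesis
    using u by simp
qed

text \<open>In \<open>H2\<close> this says that \<open>id \<otimes> S\<close> applied to
  \<open>R\<inverse>\<close> is a right inverse of \<open>R\<inverse>\<close>. The two sums merge
  into one with a coproduct on the second leg, where the antipode and counit laws apply.\<close>

lemma lift_Ri_antipode: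
  assumes M: "module K M" and f: "f \<in> bilinear_maps K H H M"
  shows "tsum M Ri (\<lambda>a b. tsum M Ri (\<lambda>c d. f (a \<otimes> c) (b \<otimes> antipode H d))) = f \<one> \<one>"
proof -
  have "tsum M Ri (\<lambda>a b. tsum M Ri (\<lambda>c d. f (a \<otimes> c) (b \<otimes> antipode H d)))
      = tsum M Ri (\<lambda>a b. tsum M (coprod H b) (\<lambda>p q. f a (p \<otimes> antipode H q)))"
    by (intro lift_coprod_right_Ri[OF M, symmetric] linear_rules bilinear_apply_left[OF f] bilinear_apply_right[OF f]) simp_all
  also have "\<dots> = tsum M Ri (\<lambda>a b. counit H b \<odot>\<^bsub>M\<^esub> f a \<one>)"
    by (intro lift_cong antipode_right_lift[OF M] bilinear_mapsD(1)[OF f]) simp_all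
  also have "\<dots> = f \<one> \<one>"
    using counit_right_lift[OF M bilinear_mapsD(2)[OF f one_closed] Ri_closed] by (simp add: counit_right_Ri)
  finally show ?thesis .
qed

end

subsection \<open>The twist\<close>

context twisted_hopf_algebra
begin

abbreviation Fi where "Fi \<equiv> inv\<^bsub>H2\<^esub> F"

lemma F_Units: "F \<in> Units H2"
  using twist by (simp add: is_twist_def)

lemma F_closed [simp]: "F \<in> carrier H2"
  using F_Units by (simp add: Units_def)

lemma Fi_closed [simp]: "Fi \<in> carrier H2"
  by (rule monoid.Units_inv_closed[OF H2_monoid F_Units])

lemma F_Fi: "F \<otimes>\<^bsub>H2\<^esub> Fi = \<one>\<^bsub>H2\<^esub>" and Fi_F: "Fi \<otimes>\<^bsub>H2\<^esub> F = \<one>\<^bsub>H2\<^esub>"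
  using monoid.Units_r_inv[OF H2_monoid F_Units] monoid.Units_l_inv[OF H2_monoid F_Units] by auto

lemmas F_simps = legs_closed legs_inverse[OF _ _ F_Fi] legs_inverse[OF _ _ Fi_F]

lemma cocycle:
  "leg12 K H F \<otimes>\<^bsub>H3\<^esub> coprod_left K H F = leg23 K H F \<otimes>\<^bsub>H3\<^esub> coprod_right K H F"
  using twist by (simp add: is_twist_def)

lemma counit_F: "counit_left H F = \<one>" "counit_right H F = \<one>"
  using twist by (simp_all add: is_twist_def)

lemma counit_Fi: "counit_left H Fi = \<one>" "counit_right H Fi = \<one>"
  using legs_inverse(7,8)[OF F_closed Fi_closed F_Fi] by (simp_all add: counit_F legs_closed)

lemma cocycle_inverse:
  "coprod_left K H Fi \<otimes>\<^bsub>H3\<^esub> leg12 K H Fi = coprod_right K H Fi \<otimes>\<^bsub>H3\<^esub> leg23 K H Fi"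
  by (rule monoid.inverse_products_eq[OF H3_monoid cocycle]) (simp_all add: F_simps)

text \<open>On the left stand the products that arise when \<chi> and its inverse are multiplied. On
  the right a coproduct is applied to each factor, so that the antipode laws can act.\<close>

lemma cocycle_mixed:
  "leg23 K H Fi \<otimes>\<^bsub>H3\<^esub> leg12 K H F = coprod_right K H F \<otimes>\<^bsub>H3\<^esub> coprod_left K H Fi"
  "leg12 K H Fi \<otimes>\<^bsub>H3\<^esub> leg23 K H F = coprod_left K H F \<otimes>\<^bsub>H3\<^esub> coprod_right K H Fi"
  by (rule monoid.mixed_products_eq[OF H3_monoid cocycle] monoid.mixed_products_eq[OF H3_monoid cocycle[symmetric]];
      simp add: F_simps)+

text \<open>The inverted cocycle condition in the form in which it meets modules, where the inverse
  twist is what acts.\<close>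

lemma lift_cocycle:
  assumes M: "module K M" and f: "f \<in> trilinear_maps K H M"
  shows "tsum M Fi (\<lambda>b b'. tsum M (coprod H b) (\<lambda>p q. tsum M Fi (\<lambda>c d. f (p \<otimes> c) (q \<otimes> d) b')))
       = tsum M Fi (\<lambda>b b'. tsum M (coprod H b') (\<lambda>p q. tsum M Fi (\<lambda>c d. f b (p \<otimes> c) (q \<otimes> d))))"
proof -
  have "tsum M Fi (\<lambda>b b'. tsum M (coprod H b) (\<lambda>p q. tsum M Fi (\<lambda>c d. f (p \<otimes> c) (q \<otimes> d) b')))
      = lift3 M (\<lambda>x y z. tsum M Fi (\<lambda>c d. f (x \<otimes> c) (y \<otimes> d) z)) (coprod_left K H Fi)"
    by (intro lift3_legs(4)[OF M, symmetric] linear_rules trilinear_apply[OF f] M module_axioms) simp_all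
  also have "\<dots> = lift3 M f (coprod_left K H Fi \<otimes>\<^bsub>H3\<^esub> leg12 K H Fi)"
    by (simp add: lift3_mult_leg12[OF M f] F_simps)
  also have "\<dots> = lift3 M (\<lambda>x y z. tsum M Fi (\<lambda>c d. f x (y \<otimes> c) (z \<otimes> d))) (coprod_right K H Fi)"
    by (simp add: cocycle_inverse lift3_mult_leg23[OF M f] F_simps)
  also have "\<dots> = tsum M Fi (\<lambda>b b'. tsum M (coprod H b') (\<lambda>p q. tsum M Fi (\<lambda>c d. f b (p \<otimes> c) (q \<otimes> d))))"
    by (intro lift3_legs(5)[OF M] linear_rules trilinear_apply[OF f] M module_axioms) simp_all
  finally show ?thesis .
qed

section \<open>The element \<chi>, its inverse and the twisted Hopf structure\<close>

definition \<chi> where "\<chi> = tsum H F (\<lambda>x y. x \<otimes> antipode H y)"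
text \<open>The candidate for the inverse of \<chi>, built from the inverse twist with the antipode
  on its first leg.\<close>

definition \<chi>' where "\<chi>' = tsum H Fi (\<lambda>x y. antipode H x \<otimes> y)"

lemma \<chi>_closed [simp]: "\<chi> \<in> carrier H" "\<chi>' \<in> carrier H"
  unfolding \<chi>_def \<chi>'_def by (intro HH.lift_closed module_axioms; simp)+

lemma tsum_smult_counits:
  assumes s: "s \<in> carrier H2" and t: "t \<in> carrier H2" and f: "f \<in> bilinear_maps K H H H"
  shows "tsum H s (\<lambda>x y. tsum H t (\<lambda>x' y'. counit H y \<odot> (counit H x' \<odot> f x y'))) = f (counit_right H s) (counit_left H t)"
proof -
  have "tsum H s (\<lambda>x y. tsum H t (\<lambda>x' y'. counit H y \<odot> (counit H x' \<odot> f x y')))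
      = tsum H s (\<lambda>x y. counit H y \<odot> tsum H t (\<lambda>x' y'. counit H x' \<odot> f x y'))"
    using s t f by (intro lift_cong HH.linear_tensor_lift[symmetric] module_axioms smult_linear) (simp_all add: bilinear_mapsD(3)[OF f])
  also have "\<dots> = tsum H s (\<lambda>x y. counit H y \<odot> f x (counit_left H t))"
    using s t by (intro lift_cong) (simp_all add: counit_left_lift[OF module_axioms bilinear_mapsD(1)[OF f] t])
  also have "\<dots> = f (counit_right H s) (counit_left H t)"
    using s t by (intro counit_right_lift module_axioms bilinear_mapsD(2)[OF f]) (simp_all add: legs_closed)
  finally show ?thesis .
qed

lemma tsum_mult:
  assumes s: "s \<in> carrier H2" and t: "t \<in> carrier H2"
    and f: "\<And>x y. \<lbrakk>x \<in> carrier H; y \<in> carrier H\<rbrakk> \<Longrightarrow> f x y \<in> carrier H"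
    and g: "\<And>x y. \<lbrakk>x \<in> carrier H; y \<in> carrier H\<rbrakk> \<Longrightarrow> g x y \<in> carrier H"
  shows "tsum H s f \<otimes> tsum H t g = tsum H s (\<lambda>x y. tsum H t (\<lambda>x' y'. f x y \<otimes> g x' y'))"
proof -
  have "tsum H s f \<otimes> tsum H t g = tsum H s (\<lambda>x y. f x y \<otimes> tsum H t g)"
    using s t f g
    by (intro HH.linear_tensor_lift[where h = "\<lambda>x. x \<otimes> tsum H t g"] module_axioms mult_left_linear HH.lift_closed) auto
  also have "\<dots> = tsum H s (\<lambda>x y. tsum H t (\<lambda>x' y'. f x y \<otimes> g x' y'))"
    using s t f g by (intro lift_cong HH.linear_tensor_lift module_axioms mult_right_linear) auto
  finally show ?thesis .
qed

text \<open>Since the antipode reverses products, the left side is the map \<open>x S(y) z\<close>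
  evaluated on \<open>F\<inverse>\<^sub>2\<^sub>3 F\<^sub>1\<^sub>2\<close>. By
  \<open>cocycle_mixed\<close> both factors become coproducts of a leg, the antipode laws collapse
  them to counits, and the normalisation of the twist gives one.\<close>

lemma \<chi>_right_inverse: "\<chi> \<otimes> \<chi>' = \<one>"
proof -
  let ?f = "\<lambda>x y z. x \<otimes> (antipode H y \<otimes> z)"
  have f: "?f \<in> trilinear_maps K H H"
    by (intro linear_rules) simp_all
  have "\<chi> \<otimes> \<chi>' = tsum H F (\<lambda>a b. tsum H Fi (\<lambda>c d. (a \<otimes> antipode H b) \<otimes> (antipode H c \<otimes> d)))"
    unfolding \<chi>_def \<chi>'_def by (rule tsum_mult) simp_all
  also have "\<dots> = tsum H F (\<lambda>a b. tsum H Fi (\<lambda>c d. ?f (\<one> \<otimes> a) (c \<otimes> b) d))"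
    by (intro lift_cong) (simp_all add: antipode_mult m_assoc)
  also have "\<dots> = tsum H Fi (\<lambda>c d. tsum H F (\<lambda>a b. ?f (\<one> \<otimes> a) (c \<otimes> b) d))"
    by (intro lift_swap module_axioms) simp_all
  also have "\<dots> = lift3 H (\<lambda>x y z. tsum H F (\<lambda>a b. ?f (x \<otimes> a) (y \<otimes> b) z)) (leg23 K H Fi)"
    by (intro lift3_legs(3)[symmetric] module_axioms linear_rules) simp_all
  also have "\<dots> = lift3 H ?f (coprod_right K H F \<otimes>\<^bsub>H3\<^esub> coprod_left K H Fi)"
    by (simp add: lift3_mult_leg12[OF module_axioms f] F_simps flip: cocycle_mixed)
  also have "\<dots> = lift3 H (\<lambda>x y z. lift3 H (\<lambda>x' y' z'. ?f (x \<otimes> x') (y \<otimes> y') (z \<otimes> z')) (coprod_left K H Fi)) (coprod_right K H F)"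
    by (intro lift3_mult module_axioms f) (simp_all add: F_simps)
  also have "\<dots> = lift3 H (\<lambda>x u v. tsum H Fi (\<lambda>x' y'. tsum H (coprod H x') (\<lambda>p q. ?f (x \<otimes> p) (u \<otimes> q) (v \<otimes> y')))) (coprod_right K H F)"
    by (intro lift3_cong lift3_legs(4) module_axioms linear_rules) (simp_all add: F_simps)
  also have "\<dots> = tsum H F (\<lambda>x y. tsum H (coprod H y) (\<lambda>u v. tsum H Fi (\<lambda>x' y'. tsum H (coprod H x') (\<lambda>p q. ?f (x \<otimes> p) (u \<otimes> q) (v \<otimes> y')))))"
    by (intro lift3_legs(5) module_axioms linear_rules) simp_all
  also have "\<dots> = tsum H F (\<lambda>x y. tsum H Fi (\<lambda>x' y'. counit H y \<odot> (counit H x' \<odot> (x \<otimes> y'))))"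
  proof (rule lift_cong)
    fix x y assume xy: "x \<in> carrier H" "y \<in> carrier H"
    have "tsum H (coprod H y) (\<lambda>u v. tsum H Fi (\<lambda>x' y'. tsum H (coprod H x') (\<lambda>p q. ?f (x \<otimes> p) (u \<otimes> q) (v \<otimes> y'))))
        = tsum H Fi (\<lambda>x' y'. tsum H (coprod H y) (\<lambda>u v. tsum H (coprod H x') (\<lambda>p q. ?f (x \<otimes> p) (u \<otimes> q) (v \<otimes> y'))))"
      using xy by (intro lift_swap module_axioms HH.lift_closed) simp_all
    also have "\<dots> = tsum H Fi (\<lambda>x' y'. counit H y \<odot> (counit H x' \<odot> (x \<otimes> y')))"
    proof (rule lift_cong)
      fix x' y' assume xy': "x' \<in> carrier H" "y' \<in> carrier H"
      have "tsum H (coprod H y) (\<lambda>u v. tsum H (coprod H x') (\<lambda>p q. ?f (x \<otimes> p) (u \<otimes> q) (v \<otimes> y')))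
          = tsum H (coprod H y) (\<lambda>u v. tsum H (coprod H x') (\<lambda>p q. x \<otimes> ((p \<otimes> antipode H q) \<otimes> ((antipode H u \<otimes> v) \<otimes> y'))))"
        using xy xy' by (intro lift_cong) (simp_all add: antipode_mult m_assoc)
      also have "\<dots> = tsum H (coprod H y) (\<lambda>u v. counit H x' \<odot> (x \<otimes> (\<one> \<otimes> ((antipode H u \<otimes> v) \<otimes> y'))))"
        using xy xy' by (intro lift_cong antipode_right_lift module_axioms linear_rules) simp_all
      also have "\<dots> = counit H y \<odot> (counit H x' \<odot> (x \<otimes> (\<one> \<otimes> (\<one> \<otimes> y'))))"
        using xy xy' by (intro antipode_left_lift[where f = "\<lambda>s. counit H x' \<odot> (x \<otimes> (\<one> \<otimes> (s \<otimes> y')))"] module_axioms linear_rules) simp_all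
      finally show "tsum H (coprod H y) (\<lambda>u v. tsum H (coprod H x') (\<lambda>p q. ?f (x \<otimes> p) (u \<otimes> q) (v \<otimes> y')))
          = counit H y \<odot> (counit H x' \<odot> (x \<otimes> y'))"
        using xy' by simp
    qed simp
    finally show "tsum H (coprod H y) (\<lambda>u v. tsum H Fi (\<lambda>x' y'. tsum H (coprod H x') (\<lambda>p q. ?f (x \<otimes> p) (u \<otimes> q) (v \<otimes> y'))))
        = tsum H Fi (\<lambda>x' y'. counit H y \<odot> (counit H x' \<odot> (x \<otimes> y')))" .
  qed simp
  also have "\<dots> = counit_right H F \<otimes> counit_left H Fi"
    by (intro tsum_smult_counits linear_rules) simp_all
  finally show ?thesis
    by (simp add: counit_F counit_Fi)
qed

text \<open>The mirror image: the map \<open>S(x) y S(z)\<close> is evaluated on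
  \<open>F\<inverse>\<^sub>1\<^sub>2 F\<^sub>2\<^sub>3\<close>, and the other mixed form of the
  cocycle condition is used.\<close>

lemma \<chi>_left_inverse: "\<chi>' \<otimes> \<chi> = \<one>"
proof -
  let ?f = "\<lambda>x y z. antipode H x \<otimes> (y \<otimes> antipode H z)"
  have f: "?f \<in> trilinear_maps K H H"
    by (intro linear_rules) simp_all
  have "\<chi>' \<otimes> \<chi> = tsum H Fi (\<lambda>c d. tsum H F (\<lambda>a b. (antipode H c \<otimes> d) \<otimes> (a \<otimes> antipode H b)))"
    unfolding \<chi>_def \<chi>'_def by (rule tsum_mult) simp_all
  also have "\<dots> = tsum H Fi (\<lambda>c d. tsum H F (\<lambda>a b. ?f c (d \<otimes> a) (\<one> \<otimes> b)))"
    by (intro lift_cong) (simp_all add: m_assoc)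
  also have "\<dots> = lift3 H (\<lambda>x y z. tsum H F (\<lambda>a b. ?f x (y \<otimes> a) (z \<otimes> b))) (leg12 K H Fi)"
    by (intro lift3_legs(1)[symmetric] module_axioms linear_rules) simp_all
  also have "\<dots> = lift3 H ?f (coprod_left K H F \<otimes>\<^bsub>H3\<^esub> coprod_right K H Fi)"
    by (simp add: lift3_mult_leg23[OF module_axioms f] F_simps flip: cocycle_mixed)
  also have "\<dots> = lift3 H (\<lambda>x y z. lift3 H (\<lambda>x' y' z'. ?f (x \<otimes> x') (y \<otimes> y') (z \<otimes> z')) (coprod_right K H Fi)) (coprod_left K H F)"
    by (intro lift3_mult module_axioms f) (simp_all add: F_simps)
  also have "\<dots> = lift3 H (\<lambda>p q y. tsum H Fi (\<lambda>x' y'. tsum H (coprod H y') (\<lambda>u v. ?f (p \<otimes> x') (q \<otimes> u) (y \<otimes> v)))) (coprod_left K H F)"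
    by (intro lift3_cong lift3_legs(5) module_axioms linear_rules) (simp_all add: F_simps)
  also have "\<dots> = tsum H F (\<lambda>x y. tsum H (coprod H x) (\<lambda>p q. tsum H Fi (\<lambda>x' y'. tsum H (coprod H y') (\<lambda>u v. ?f (p \<otimes> x') (q \<otimes> u) (y \<otimes> v)))))"
    by (intro lift3_legs(4) module_axioms linear_rules) simp_all
  also have "\<dots> = tsum H F (\<lambda>x y. tsum H Fi (\<lambda>x' y'. counit H x \<odot> (counit H y' \<odot> (antipode H x' \<otimes> antipode H y))))"
  proof (rule lift_cong)
    fix x y assume xy: "x \<in> carrier H" "y \<in> carrier H"
    have "tsum H (coprod H x) (\<lambda>p q. tsum H Fi (\<lambda>x' y'. tsum H (coprod H y') (\<lambda>u v. ?f (p \<otimes> x') (q \<otimes> u) (y \<otimes> v))))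
        = tsum H Fi (\<lambda>x' y'. tsum H (coprod H x) (\<lambda>p q. tsum H (coprod H y') (\<lambda>u v. ?f (p \<otimes> x') (q \<otimes> u) (y \<otimes> v))))"
      using xy by (intro lift_swap module_axioms HH.lift_closed) simp_all
    also have "\<dots> = tsum H Fi (\<lambda>x' y'. counit H x \<odot> (counit H y' \<odot> (antipode H x' \<otimes> antipode H y)))"
    proof (rule lift_cong)
      fix x' y' assume xy': "x' \<in> carrier H" "y' \<in> carrier H"
      have "tsum H (coprod H x) (\<lambda>p q. tsum H (coprod H y') (\<lambda>u v. ?f (p \<otimes> x') (q \<otimes> u) (y \<otimes> v)))
          = tsum H (coprod H x) (\<lambda>p q. tsum H (coprod H y') (\<lambda>u v. antipode H x' \<otimes> ((antipode H p \<otimes> q) \<otimes> ((u \<otimes> antipode H v) \<otimes> antipode H y))))"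
        using xy xy' by (intro lift_cong) (simp_all add: antipode_mult m_assoc)
      also have "\<dots> = tsum H (coprod H x) (\<lambda>p q. counit H y' \<odot> (antipode H x' \<otimes> ((antipode H p \<otimes> q) \<otimes> (\<one> \<otimes> antipode H y))))"
        using xy xy' by (intro lift_cong antipode_right_lift module_axioms linear_rules) simp_all
      also have "\<dots> = counit H x \<odot> (counit H y' \<odot> (antipode H x' \<otimes> (\<one> \<otimes> (\<one> \<otimes> antipode H y))))"
        using xy xy' by (intro antipode_left_lift[where f = "\<lambda>s. counit H y' \<odot> (antipode H x' \<otimes> (s \<otimes> (\<one> \<otimes> antipode H y)))"] module_axioms linear_rules) simp_all
      finally show "tsum H (coprod H x) (\<lambda>p q. tsum H (coprod H y') (\<lambda>u v. ?f (p \<otimes> x') (q \<otimes> u) (y \<otimes> v)))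
          = counit H x \<odot> (counit H y' \<odot> (antipode H x' \<otimes> antipode H y))"
        using xy xy' by simp
    qed simp
    finally show "tsum H (coprod H x) (\<lambda>p q. tsum H Fi (\<lambda>x' y'. tsum H (coprod H y') (\<lambda>u v. ?f (p \<otimes> x') (q \<otimes> u) (y \<otimes> v))))
        = tsum H Fi (\<lambda>x' y'. counit H x \<odot> (counit H y' \<odot> (antipode H x' \<otimes> antipode H y)))" .
  qed simp
  also have "\<dots> = tsum H F (\<lambda>x y. counit H x \<odot> tsum H Fi (\<lambda>x' y'. counit H y' \<odot> (antipode H x' \<otimes> antipode H y)))"
    by (intro lift_cong HH.linear_tensor_lift[symmetric] module_axioms smult_linear) simp_all
  also have "\<dots> = tsum H F (\<lambda>x y. counit H x \<odot> (antipode H (counit_right H Fi) \<otimes> antipode H y))"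
    using counit_right_lift[OF module_axioms _ Fi_closed, where f = "\<lambda>x'. antipode H x' \<otimes> antipode H y" for y]
    by (intro lift_cong arg_cong[where f = "\<lambda>z. _ \<odot> z"] counit_right_lift module_axioms linear_rules) simp_all
  also have "\<dots> = antipode H (counit_right H Fi) \<otimes> antipode H (counit_left H F)"
    by (intro counit_left_lift module_axioms linear_rules) (simp_all add: legs_closed)
  finally show ?thesis
    by (simp add: counit_F counit_Fi antipode_one)
qed

lemma \<chi>_inv: "inv \<chi> = \<chi>'"
  using \<chi>_left_inverse \<chi>_right_inverse by (intro inv_char) simp_all

abbreviation HF where "HF \<equiv> twist_hopf K F H"

lemma HF_simps:
  "carrier HF = carrier H" "ring.add HF = ring.add H" "\<zero>\<^bsub>HF\<^esub> = \<zero>" "monoid.mult HF = monoid.mult H"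
  "\<one>\<^bsub>HF\<^esub> = \<one>" "smult HF = smult H" "counit HF = counit H"
  "coprod HF \<xi> = F \<otimes>\<^bsub>H2\<^esub> coprod H \<xi> \<otimes>\<^bsub>H2\<^esub> Fi"
  "antipode HF \<xi> = \<chi> \<otimes> antipode H \<xi> \<otimes> \<chi>'"
  by (simp_all add: twist_hopf_def Let_def \<chi>_inv flip: \<chi>_def)

text \<open>The twist leaves the underlying algebra unchanged, so tensor square, products and
  inverses are literally the same for \<open>H\<close> and \<open>HF\<close>.\<close>

lemma tensor2_HF: "tensor_algebra K HF HF = H2"
proof -
  have "tensor_group (carrier K) (\<lambda>a k. k \<odot>\<^bsub>HF\<^esub> a) (\<lambda>k b. k \<odot>\<^bsub>HF\<^esub> b) HF HF
      = tensor_group (carrier K) (\<lambda>a k. k \<odot> a) (\<lambda>k b. k \<odot> b) H H"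
    by (simp add: tensor_group_def tensor_quotient_def tensor_relations_def HF_simps Let_def)
  then show ?thesis
    by (simp add: tensor_algebra_def Let_def HF_simps)
qed

lemma coprod_HF_linear: "coprod HF \<in> linear_maps K H H2"
proof -
  have "(\<lambda>\<xi>. F \<otimes>\<^bsub>H2\<^esub> coprod H \<xi> \<otimes>\<^bsub>H2\<^esub> Fi) \<in> linear_maps K H H2"
    by (intro linear_maps_comp[OF HH.mult_left_linear_AB] linear_maps_comp[OF HH.mult_right_linear_AB] coprod_linear) simp_all
  then show ?thesis
    unfolding HF_simps(8)[abs_def] .
qed

lemma coprod_HF_closed [simp]: "\<xi> \<in> carrier H \<Longrightarrow> coprod HF \<xi> \<in> carrier H2"
  by (rule linear_mapsD(1)[OF coprod_HF_linear])

lemma tsum_coprod_HF: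
  assumes M: "module K M" and f: "f \<in> bilinear_maps K H H M" and \<xi>: "\<xi> \<in> carrier H"
  shows "tsum M (coprod HF \<xi>) f
    = tsum M F (\<lambda>a b. tsum M (coprod H \<xi>) (\<lambda>x y. tsum M Fi (\<lambda>c d. f (a \<otimes> x \<otimes> c) (b \<otimes> y \<otimes> d))))"
  unfolding HF_simps using \<xi> by (intro lift_conj M f) simp_all

text \<open>Each iterated twisted coproduct is that of \<open>H\<close> with one side of the cocycle
  condition multiplied on the left and its inverse on the right.\<close>

lemma coassoc_HF:
  assumes M: "module K M" and f: "f \<in> trilinear_maps K H M" and \<xi>: "\<xi> \<in> carrier H"
  shows "tsum M (coprod HF \<xi>) (\<lambda>x y. tsum M (coprod HF x) (\<lambda>a b. f a b y))
       = tsum M (coprod HF \<xi>) (\<lambda>x y. tsum M (coprod HF y) (\<lambda>a b. f x a b))"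
proof -
  interpret H3: monoid H3 by (rule H3_monoid)
  let ?L = "coprod_left K H" and ?R = "coprod_right K H" and ?D = "coprod H \<xi>"
  note fr = linear_rules trilinear_apply[OF f] M module_axioms
  \<comment> \<open>Stated for an arbitrary tensor \<open>t\<close>: twisting the coproduct of its
    first leg means conjugating \<open>?L t\<close> by the twist in legs one and two.\<close>
  have left: "tsum M t (\<lambda>x y. tsum M (coprod HF x) (\<lambda>a b. f a b y))
      = lift3 M f (leg12 K H F \<otimes>\<^bsub>H3\<^esub> (?L t \<otimes>\<^bsub>H3\<^esub> leg12 K H Fi))" if t: "t \<in> carrier H2" for t
  proof -
    have "tsum M t (\<lambda>x y. tsum M (coprod HF x) (\<lambda>a b. f a b y)) = tsum M t (\<lambda>x y.
        tsum M F (\<lambda>a b. tsum M (coprod H x) (\<lambda>p q. tsum M Fi (\<lambda>c d. f (a \<otimes> p \<otimes> c) (b \<otimes> q \<otimes> d) y))))"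
      using t by (intro lift_cong tsum_coprod_HF fr) simp_all
    also have "\<dots> = tsum M F (\<lambda>a b. tsum M t (\<lambda>x y.
        tsum M (coprod H x) (\<lambda>p q. tsum M Fi (\<lambda>c d. f (a \<otimes> p \<otimes> c) (b \<otimes> q \<otimes> d) y))))"
      using t by (intro lift_swap M HH.lift_closed trilinear_closed[OF f]) simp_all
    also have "\<dots> = tsum M F (\<lambda>a b. lift3 M (\<lambda>p q y. tsum M Fi (\<lambda>c d. f (a \<otimes> p \<otimes> c) (b \<otimes> q \<otimes> d) y)) (?L t))"
      using t by (intro lift_cong lift3_legs(4)[symmetric] fr) simp_all
    also have "\<dots> = tsum M F (\<lambda>a b. lift3 M (\<lambda>p q y. tsum M Fi (\<lambda>c d. f (a \<otimes> (p \<otimes> c)) (b \<otimes> (q \<otimes> d)) (\<one> \<otimes> y))) (?L t))"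
      using t by (intro lift_cong lift3_cong) (simp_all add: m_assoc F_simps)
    also have "\<dots> = tsum M F (\<lambda>a b. lift3 M (\<lambda>x y z. f (a \<otimes> x) (b \<otimes> y) (\<one> \<otimes> z)) (?L t \<otimes>\<^bsub>H3\<^esub> leg12 K H Fi))"
      using t by (intro lift_cong lift3_mult_leg12[symmetric] fr) (simp_all add: F_simps)
    also have "\<dots> = lift3 M (\<lambda>a b c. lift3 M (\<lambda>x y z. f (a \<otimes> x) (b \<otimes> y) (c \<otimes> z)) (?L t \<otimes>\<^bsub>H3\<^esub> leg12 K H Fi)) (leg12 K H F)"
      by (rule lift3_legs(1)[symmetric, OF M _ F_closed,
            where f = "\<lambda>a b c. lift3 M (\<lambda>x y z. f (a \<otimes> x) (b \<otimes> y) (c \<otimes> z)) (?L t \<otimes>\<^bsub>H3\<^esub> leg12 K H Fi)"],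
          intro trilinear_mapsI; unfold lift3_def;
          intro HHH.tensor_lift_linear_param lift_linear_param fr; simp add: F_simps t)
    also have "\<dots> = lift3 M f (leg12 K H F \<otimes>\<^bsub>H3\<^esub> (?L t \<otimes>\<^bsub>H3\<^esub> leg12 K H Fi))"
      using t by (intro lift3_mult[symmetric] M f) (simp_all add: F_simps)
    finally show ?thesis .
  qed
  have right: "tsum M t (\<lambda>x y. tsum M (coprod HF y) (\<lambda>a b. f x a b))
      = lift3 M f (leg23 K H F \<otimes>\<^bsub>H3\<^esub> (?R t \<otimes>\<^bsub>H3\<^esub> leg23 K H Fi))" if t: "t \<in> carrier H2" for t
  proof -
    have "tsum M t (\<lambda>x y. tsum M (coprod HF y) (\<lambda>a b. f x a b)) = tsum M t (\<lambda>x y.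
        tsum M F (\<lambda>a b. tsum M (coprod H y) (\<lambda>p q. tsum M Fi (\<lambda>c d. f x (a \<otimes> p \<otimes> c) (b \<otimes> q \<otimes> d)))))"
      using t by (intro lift_cong tsum_coprod_HF fr) simp_all
    also have "\<dots> = tsum M F (\<lambda>a b. tsum M t (\<lambda>x y.
        tsum M (coprod H y) (\<lambda>p q. tsum M Fi (\<lambda>c d. f x (a \<otimes> p \<otimes> c) (b \<otimes> q \<otimes> d)))))"
      using t by (intro lift_swap M HH.lift_closed trilinear_closed[OF f]) simp_all
    also have "\<dots> = tsum M F (\<lambda>a b. lift3 M (\<lambda>x p q. tsum M Fi (\<lambda>c d. f x (a \<otimes> p \<otimes> c) (b \<otimes> q \<otimes> d))) (?R t))"
      using t by (intro lift_cong lift3_legs(5)[symmetric] fr) simp_all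
    also have "\<dots> = tsum M F (\<lambda>a b. lift3 M (\<lambda>x p q. tsum M Fi (\<lambda>c d. f (\<one> \<otimes> x) (a \<otimes> (p \<otimes> c)) (b \<otimes> (q \<otimes> d)))) (?R t))"
      using t by (intro lift_cong lift3_cong) (simp_all add: m_assoc F_simps)
    also have "\<dots> = tsum M F (\<lambda>a b. lift3 M (\<lambda>x y z. f (\<one> \<otimes> x) (a \<otimes> y) (b \<otimes> z)) (?R t \<otimes>\<^bsub>H3\<^esub> leg23 K H Fi))"
      using t by (intro lift_cong lift3_mult_leg23[symmetric] fr) (simp_all add: F_simps)
    also have "\<dots> = lift3 M (\<lambda>c a b. lift3 M (\<lambda>x y z. f (c \<otimes> x) (a \<otimes> y) (b \<otimes> z)) (?R t \<otimes>\<^bsub>H3\<^esub> leg23 K H Fi)) (leg23 K H F)"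
      by (rule lift3_legs(3)[symmetric, OF M _ F_closed,
            where f = "\<lambda>c a b. lift3 M (\<lambda>x y z. f (c \<otimes> x) (a \<otimes> y) (b \<otimes> z)) (?R t \<otimes>\<^bsub>H3\<^esub> leg23 K H Fi)"],
          intro trilinear_mapsI; unfold lift3_def;
          intro HHH.tensor_lift_linear_param lift_linear_param fr; simp add: F_simps t)
    also have "\<dots> = lift3 M f (leg23 K H F \<otimes>\<^bsub>H3\<^esub> (?R t \<otimes>\<^bsub>H3\<^esub> leg23 K H Fi))"
      using t by (intro lift3_mult[symmetric] M f) (simp_all add: F_simps)
    finally show ?thesis .
  qed
  have D: "?D \<in> carrier H2" using \<xi> by simp
  \<comment> \<open>Multiplicativity of the legs isolates the cocycle condition on the left, the
    coproduct of \<xi> in the middle and the inverted cocycle condition on the right.\<close>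
  have "leg12 K H F \<otimes>\<^bsub>H3\<^esub> (?L (F \<otimes>\<^bsub>H2\<^esub> ?D \<otimes>\<^bsub>H2\<^esub> Fi) \<otimes>\<^bsub>H3\<^esub> leg12 K H Fi)
      = (leg12 K H F \<otimes>\<^bsub>H3\<^esub> ?L F) \<otimes>\<^bsub>H3\<^esub> ?L ?D \<otimes>\<^bsub>H3\<^esub> (?L Fi \<otimes>\<^bsub>H3\<^esub> leg12 K H Fi)"
    using D by (simp add: legs_mult legs_closed H3.m_assoc)
  also have "\<dots> = (leg23 K H F \<otimes>\<^bsub>H3\<^esub> ?R F) \<otimes>\<^bsub>H3\<^esub> ?R ?D \<otimes>\<^bsub>H3\<^esub> (?R Fi \<otimes>\<^bsub>H3\<^esub> leg23 K H Fi)"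
    by (simp add: cocycle cocycle_inverse coassoc[OF \<xi>])
  also have "\<dots> = leg23 K H F \<otimes>\<^bsub>H3\<^esub> (?R (F \<otimes>\<^bsub>H2\<^esub> ?D \<otimes>\<^bsub>H2\<^esub> Fi) \<otimes>\<^bsub>H3\<^esub> leg23 K H Fi)"
    using D by (simp add: legs_mult legs_closed H3.m_assoc)
  finally have "lift3 M f (leg12 K H F \<otimes>\<^bsub>H3\<^esub> (?L (coprod HF \<xi>) \<otimes>\<^bsub>H3\<^esub> leg12 K H Fi))
      = lift3 M f (leg23 K H F \<otimes>\<^bsub>H3\<^esub> (?R (coprod HF \<xi>) \<otimes>\<^bsub>H3\<^esub> leg23 K H Fi))"
    by (simp only: HF_simps)
  then show ?thesis
    by (simp only: left[OF coprod_HF_closed[OF \<xi>]] right[OF coprod_HF_closed[OF \<xi>]])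
qed

lemma counit_right_HF:
  assumes M: "module K M" and f: "f \<in> linear_maps K H M" and \<xi>: "\<xi> \<in> carrier H"
  shows "tsum M (coprod HF \<xi>) (\<lambda>x y. counit H y \<odot>\<^bsub>M\<^esub> f x) = f \<xi>"
  using \<xi>
  by (simp add: counit_right_lift[OF M f] HF_simps legs_mult counit_F counit_Fi counit_right)

text \<open>Written out, the argument of \<open>f\<close> is
  \<open>a x (c \<chi> S(d)) S(y) S(b) \<chi>'\<close>. The bracket sums to one, then
  \<open>x S(y)\<close> sums to the counit of \<xi>, and finally \<open>a S(b)\<close> sums to
  \<chi>, which cancels \<open>\<chi>'\<close>.\<close>

lemma antipode_right_HF:
  assumes M: "module K M" and f: "f \<in> linear_maps K H M" and \<xi>: "\<xi> \<in> carrier H"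
  shows "tsum M (coprod HF \<xi>) (\<lambda>x y. f (x \<otimes> antipode HF y)) = counit H \<xi> \<odot>\<^bsub>M\<^esub> f \<one>"
proof -
  \<comment> \<open>Inserting the definition of \<chi> and reversing products under the antipode
    turns the sum into \<open>x S(y)\<close> evaluated on \<open>F\<inverse> F = 1\<close>.\<close>
  have conj: "tsum H Fi (\<lambda>c d. c \<otimes> \<chi> \<otimes> antipode H d) = \<one>"
  proof -
    have bil: "(\<lambda>x y. x \<otimes> antipode H y) \<in> bilinear_maps K H H H"
      by (intro linear_rules) simp_all
    have "tsum H Fi (\<lambda>c d. c \<otimes> \<chi> \<otimes> antipode H d) = tsum H Fi (\<lambda>c d. tsum H F (\<lambda>a b. (c \<otimes> a) \<otimes> antipode H (d \<otimes> b)))"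
    proof (rule lift_cong)
      fix c d assume cd: "c \<in> carrier H" "d \<in> carrier H"
      then have "c \<otimes> \<chi> \<otimes> antipode H d = tsum H F (\<lambda>a b. c \<otimes> (a \<otimes> antipode H b) \<otimes> antipode H d)"
        unfolding \<chi>_def
        by (intro HH.linear_tensor_lift[where h = "\<lambda>x. c \<otimes> x \<otimes> antipode H d"] module_axioms linear_rules) simp_all
      also have "\<dots> = tsum H F (\<lambda>a b. (c \<otimes> a) \<otimes> antipode H (d \<otimes> b))"
        using cd by (intro lift_cong) (simp_all add: antipode_mult m_assoc)
      finally show "c \<otimes> \<chi> \<otimes> antipode H d = tsum H F (\<lambda>a b. (c \<otimes> a) \<otimes> antipode H (d \<otimes> b))" .
    qed simp
    also have "\<dots> = tsum H (Fi \<otimes>\<^bsub>H2\<^esub> F) (\<lambda>x y. x \<otimes> antipode H y)"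
      by (simp add: HH.lift_mult[OF module_axioms bil])
    finally show ?thesis
      by (simp add: Fi_F HH.lift_one[OF module_axioms bil] antipode_one)
  qed
  have "tsum M (coprod HF \<xi>) (\<lambda>x y. f (x \<otimes> antipode HF y))
      = tsum M F (\<lambda>a b. tsum M (coprod H \<xi>) (\<lambda>x y. tsum M Fi (\<lambda>c d.
          f (a \<otimes> x \<otimes> c \<otimes> (\<chi> \<otimes> antipode H (b \<otimes> y \<otimes> d) \<otimes> \<chi>')))))"
    unfolding HF_simps(9) using \<xi> by (intro tsum_coprod_HF M linear_rules linear_maps_comp[OF f]) simp_all
  also have "\<dots> = tsum M F (\<lambda>a b. tsum M (coprod H \<xi>) (\<lambda>x y. tsum M Fi (\<lambda>c d.
          f (a \<otimes> x \<otimes> (c \<otimes> \<chi> \<otimes> antipode H d) \<otimes> (antipode H y \<otimes> antipode H b \<otimes> \<chi>')))))"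
    using \<xi> by (intro lift_cong) (simp_all add: antipode_mult m_assoc)
  also have "\<dots> = tsum M F (\<lambda>a b. tsum M (coprod H \<xi>) (\<lambda>x y. f (a \<otimes> x \<otimes> \<one> \<otimes> (antipode H y \<otimes> antipode H b \<otimes> \<chi>'))))"
  proof (intro lift_cong)
    fix a b x y assume abxy: "a \<in> carrier H" "b \<in> carrier H" "x \<in> carrier H" "y \<in> carrier H"
    let ?h = "\<lambda>z. f (a \<otimes> x \<otimes> z \<otimes> (antipode H y \<otimes> antipode H b \<otimes> \<chi>'))"
    have "?h (tsum H Fi (\<lambda>c d. c \<otimes> \<chi> \<otimes> antipode H d)) = tsum M Fi (\<lambda>c d. ?h (c \<otimes> \<chi> \<otimes> antipode H d))"
      using abxy by (intro HH.linear_tensor_lift[where h = ?h] module_axioms M linear_rules linear_maps_comp[OF f]) simp_all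
    then show "tsum M Fi (\<lambda>c d. ?h (c \<otimes> \<chi> \<otimes> antipode H d)) = ?h \<one>"
      by (simp add: conj)
  qed (use \<xi> in simp_all)
  also have "\<dots> = tsum M F (\<lambda>a b. tsum M (coprod H \<xi>) (\<lambda>x y. f (a \<otimes> (x \<otimes> antipode H y) \<otimes> (antipode H b \<otimes> \<chi>'))))"
    using \<xi> by (intro lift_cong) (simp_all add: m_assoc)
  also have "\<dots> = tsum M F (\<lambda>a b. counit H \<xi> \<odot>\<^bsub>M\<^esub> f (a \<otimes> \<one> \<otimes> (antipode H b \<otimes> \<chi>')))"
    using \<xi> by (intro lift_cong antipode_right_lift M linear_maps_comp[OF f] linear_rules) simp_all
  also have "\<dots> = tsum M F (\<lambda>a b. counit H \<xi> \<odot>\<^bsub>M\<^esub> f ((a \<otimes> antipode H b) \<otimes> \<chi>'))"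
    by (intro lift_cong) (simp_all add: m_assoc)
  also have "\<dots> = counit H \<xi> \<odot>\<^bsub>M\<^esub> f (\<chi> \<otimes> \<chi>')"
    unfolding \<chi>_def using \<xi>
    by (intro HH.linear_tensor_lift[symmetric, where h = "\<lambda>z. counit H \<xi> \<odot>\<^bsub>M\<^esub> f (z \<otimes> \<chi>')"] module_axioms M
        linear_rules linear_maps_comp[OF f]) simp_all
  finally show ?thesis
    by (simp add: \<chi>_right_inverse)
qed

subsection \<open>The twisted R-matrix\<close>

abbreviation RF where "RF \<equiv> twist_R K F H R"
abbreviation RFi where "RFi \<equiv> inv\<^bsub>H2\<^esub> RF"

text \<open>The three factors of the twisted R-matrix are inverted one by one in reverse order. As
  the flip is multiplicative, the flipped inverse twist inverts the flipped twist.\<close>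

lemma RFi_eq: "RFi = F \<otimes>\<^bsub>H2\<^esub> Ri \<otimes>\<^bsub>H2\<^esub> flip K H Fi"
proof -
  let ?G = "flip K H F" and ?Gi = "flip K H Fi"
  have G: "?G \<in> carrier H2" "?Gi \<in> carrier H2" "?G \<otimes>\<^bsub>H2\<^esub> ?Gi = \<one>\<^bsub>H2\<^esub>" "?Gi \<otimes>\<^bsub>H2\<^esub> ?G = \<one>\<^bsub>H2\<^esub>"
    by (simp_all add: F_simps)
  have c: "x \<otimes>\<^bsub>H2\<^esub> (y \<otimes>\<^bsub>H2\<^esub> z) = z"
    if "x \<otimes>\<^bsub>H2\<^esub> y = \<one>\<^bsub>H2\<^esub>" "x \<in> carrier H2" "y \<in> carrier H2" "z \<in> carrier H2" for x y z
    using that by (simp flip: H2_m_assoc)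
  have "RF \<otimes>\<^bsub>H2\<^esub> (F \<otimes>\<^bsub>H2\<^esub> Ri \<otimes>\<^bsub>H2\<^esub> ?Gi) = \<one>\<^bsub>H2\<^esub>"
    unfolding twist_R_def using G by (simp add: H2_m_assoc c[OF Fi_F] c[OF R_Ri])
  moreover have "(F \<otimes>\<^bsub>H2\<^esub> Ri \<otimes>\<^bsub>H2\<^esub> ?Gi) \<otimes>\<^bsub>H2\<^esub> RF = \<one>\<^bsub>H2\<^esub>"
    unfolding twist_R_def using G by (simp add: H2_m_assoc c[OF G(4)] c[OF Ri_R] F_Fi)
  ultimately show ?thesis
    using G by (intro monoid.inv_char[OF H2_monoid]) (simp_all add: twist_R_def)
qed

lemma RFi_closed [simp]: "RFi \<in> carrier H2"
  by (simp add: RFi_eq F_simps)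

text \<open>The inverse of the twisted R-matrix begins with \<open>F\<close>, which cancels the
  inverse twist in front of it. What remains,
  \<open>R\<inverse> F\<^sub>2\<^sub>1\<inverse>\<close>, has the legs of the inverse twist
  exchanged.\<close>

lemma tsum_Fi_RFi:
  assumes M: "module K M" and f: "f \<in> bilinear_maps K H H M"
  shows "tsum M Fi (\<lambda>d d'. tsum M RFi (\<lambda>x y. f (d \<otimes> x) (d' \<otimes> y)))
       = tsum M Ri (\<lambda>r r'. tsum M Fi (\<lambda>d d'. f (r \<otimes> d') (r' \<otimes> d)))"
proof -
  have "Fi \<otimes>\<^bsub>H2\<^esub> RFi = (Fi \<otimes>\<^bsub>H2\<^esub> F) \<otimes>\<^bsub>H2\<^esub> (Ri \<otimes>\<^bsub>H2\<^esub> flip K H Fi)"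
    by (simp add: RFi_eq H2_m_assoc F_simps del: Fi_F)
  then have eq: "Fi \<otimes>\<^bsub>H2\<^esub> RFi = Ri \<otimes>\<^bsub>H2\<^esub> flip K H Fi"
    by (simp add: Fi_F F_simps)
  have "tsum M Fi (\<lambda>d d'. tsum M RFi (\<lambda>x y. f (d \<otimes> x) (d' \<otimes> y))) = tsum M (Ri \<otimes>\<^bsub>H2\<^esub> flip K H Fi) f"
    by (simp add: HH.lift_mult[OF M f] flip: eq)
  also have "\<dots> = tsum M Ri (\<lambda>r r'. tsum M (flip K H Fi) (\<lambda>d' d. f (r \<otimes> d') (r' \<otimes> d)))"
    by (simp add: HH.lift_mult[OF M f] F_simps)
  also have "\<dots> = tsum M Ri (\<lambda>r r'. tsum M Fi (\<lambda>d d'. f (r \<otimes> d') (r' \<otimes> d)))"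
    by (intro lift_cong lift_flip M linear_rules bilinear_apply_left[OF f] bilinear_apply_right[OF f]) simp_all
  finally show ?thesis .
qed

text \<open>In \<open>H \<otimes> H \<otimes> H \<otimes> H\<close> this reads
  \<open>(\<Delta> \<otimes> \<Delta>)(F\<inverse>) F\<inverse>\<^sub>1\<^sub>2 F\<inverse>\<^sub>3\<^sub>4 = (id \<otimes> \<Delta> \<otimes> id)((id \<otimes> \<Delta>)(F\<inverse>) F\<inverse>\<^sub>2\<^sub>3) F\<inverse>\<^sub>2\<^sub>3\<close>.\<close>

lemma tsum_cocycle4:
  assumes M: "module K M" and f: "f \<in> quadrilinear_maps K H M"
  shows "tsum M Fi (\<lambda>b b'. tsum M (coprod H b) (\<lambda>p q. tsum M Fi (\<lambda>c d.
      tsum M (coprod H b') (\<lambda>p' q'. tsum M Fi (\<lambda>c' d'. f (p \<otimes> c) (q \<otimes> d) (p' \<otimes> c') (q' \<otimes> d'))))))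
    = tsum M Fi (\<lambda>b b'. tsum M (coprod H b') (\<lambda>p q. tsum M Fi (\<lambda>c c'.
      tsum M (coprod H (p \<otimes> c)) (\<lambda>u v. tsum M Fi (\<lambda>d d'. f b (u \<otimes> d) (v \<otimes> d') (q \<otimes> c'))))))"
proof -
  note fr = linear_rules quadrilinear_apply[OF f] M module_axioms
  note cl = HH.lift_closed quadrilinear_closed[OF f] M
  \<comment> \<open>For the first use of the cocycle condition, the coproduct of the third argument
    and the last inverse twist are part of the trilinear map, so that \<open>q \<otimes> d\<close>
    is split by a coproduct afterwards.\<close>
  have "tsum M Fi (\<lambda>b b'. tsum M (coprod H b) (\<lambda>p q. tsum M Fi (\<lambda>c d.
      tsum M (coprod H b') (\<lambda>p' q'. tsum M Fi (\<lambda>c' d'. f (p \<otimes> c) (q \<otimes> d) (p' \<otimes> c') (q' \<otimes> d'))))))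
    = tsum M Fi (\<lambda>b b'. tsum M (coprod H b') (\<lambda>p q. tsum M Fi (\<lambda>c d.
      tsum M (coprod H (q \<otimes> d)) (\<lambda>p' q'. tsum M Fi (\<lambda>c' d'. f b (p \<otimes> c) (p' \<otimes> c') (q' \<otimes> d'))))))"
    by (intro lift_cocycle[OF M, where f = "\<lambda>x y z. tsum M (coprod H z) (\<lambda>p' q'. tsum M Fi (\<lambda>c' d'. f x y (p' \<otimes> c') (q' \<otimes> d')))"] fr) simp_all
  also have "\<dots> = tsum M Fi (\<lambda>b b'. tsum M (coprod H b') (\<lambda>p q. tsum M Fi (\<lambda>c c'.
      tsum M (coprod H (p \<otimes> c)) (\<lambda>u v. tsum M Fi (\<lambda>d d'. f b (u \<otimes> d) (v \<otimes> d') (q \<otimes> c'))))))"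
  proof (rule lift_cong)
    fix b b' assume b: "b \<in> carrier H" "b' \<in> carrier H"
    have "tsum M (coprod H b') (\<lambda>p q. tsum M Fi (\<lambda>c d.
          tsum M (coprod H (q \<otimes> d)) (\<lambda>p' q'. tsum M Fi (\<lambda>c' d'. f b (p \<otimes> c) (p' \<otimes> c') (q' \<otimes> d')))))
        = tsum M (coprod H b') (\<lambda>p q. tsum M Fi (\<lambda>c d. tsum M (coprod H q) (\<lambda>q1 q2.
          tsum M (coprod H d) (\<lambda>d1 d2. tsum M Fi (\<lambda>c' d'. f b (p \<otimes> c) (q1 \<otimes> d1 \<otimes> c') (q2 \<otimes> d2 \<otimes> d'))))))"
      using b by (intro lift_cong lift_coprod_mult fr) simp_all
    also have "\<dots> = tsum M (coprod H b') (\<lambda>p q. tsum M (coprod H q) (\<lambda>q1 q2. tsum M Fi (\<lambda>c d.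
          tsum M (coprod H d) (\<lambda>d1 d2. tsum M Fi (\<lambda>c' d'. f b (p \<otimes> c) (q1 \<otimes> d1 \<otimes> c') (q2 \<otimes> d2 \<otimes> d'))))))"
      using b by (intro lift_cong lift_swap cl) simp_all
    \<comment> \<open>Rebracketing exposes one side of \<open>lift_cocycle\<close> in the inner
      sums, where the condition is now used from right to left.\<close>
    also have "\<dots> = tsum M (coprod H b') (\<lambda>p q. tsum M (coprod H q) (\<lambda>q1 q2. tsum M Fi (\<lambda>c d.
          tsum M (coprod H d) (\<lambda>d1 d2. tsum M Fi (\<lambda>c' d'. f b (p \<otimes> c) (q1 \<otimes> (d1 \<otimes> c')) (q2 \<otimes> (d2 \<otimes> d')))))))"
      using b by (intro lift_cong) (simp_all add: m_assoc)
    also have "\<dots> = tsum M (coprod H b') (\<lambda>p q. tsum M (coprod H q) (\<lambda>q1 q2. tsum M Fi (\<lambda>c d.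
          tsum M (coprod H c) (\<lambda>c1 c2. tsum M Fi (\<lambda>c' d'. f b (p \<otimes> (c1 \<otimes> c')) (q1 \<otimes> (c2 \<otimes> d')) (q2 \<otimes> d))))))"
      using b by (intro lift_cong lift_cocycle[OF M, symmetric] fr) simp_all
    also have "\<dots> = tsum M (coprod H b') (\<lambda>p q. tsum M (coprod H p) (\<lambda>p1 p2. tsum M Fi (\<lambda>c d.
          tsum M (coprod H c) (\<lambda>c1 c2. tsum M Fi (\<lambda>c' d'. f b (p1 \<otimes> (c1 \<otimes> c')) (p2 \<otimes> (c2 \<otimes> d')) (q \<otimes> d))))))"
      using b by (intro coassoc_lift[OF M, symmetric] fr) simp_all
    also have "\<dots> = tsum M (coprod H b') (\<lambda>p q. tsum M (coprod H p) (\<lambda>p1 p2. tsum M Fi (\<lambda>c d.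
          tsum M (coprod H c) (\<lambda>c1 c2. tsum M Fi (\<lambda>c' d'. f b (p1 \<otimes> c1 \<otimes> c') (p2 \<otimes> c2 \<otimes> d') (q \<otimes> d))))))"
      using b by (intro lift_cong) (simp_all add: m_assoc)
    also have "\<dots> = tsum M (coprod H b') (\<lambda>p q. tsum M Fi (\<lambda>c d. tsum M (coprod H p) (\<lambda>p1 p2.
          tsum M (coprod H c) (\<lambda>c1 c2. tsum M Fi (\<lambda>c' d'. f b (p1 \<otimes> c1 \<otimes> c') (p2 \<otimes> c2 \<otimes> d') (q \<otimes> d))))))"
      using b by (intro lift_cong lift_swap cl) simp_all
    also have "\<dots> = tsum M (coprod H b') (\<lambda>p q. tsum M Fi (\<lambda>c c'.
          tsum M (coprod H (p \<otimes> c)) (\<lambda>u v. tsum M Fi (\<lambda>d d'. f b (u \<otimes> d) (v \<otimes> d') (q \<otimes> c')))))"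
      using b by (intro lift_cong lift_coprod_mult[symmetric] fr) simp_all
    finally show "tsum M (coprod H b') (\<lambda>p q. tsum M Fi (\<lambda>c d.
          tsum M (coprod H (q \<otimes> d)) (\<lambda>p' q'. tsum M Fi (\<lambda>c' d'. f b (p \<otimes> c) (p' \<otimes> c') (q' \<otimes> d')))))
      = tsum M (coprod H b') (\<lambda>p q. tsum M Fi (\<lambda>c c'.
          tsum M (coprod H (p \<otimes> c)) (\<lambda>u v. tsum M Fi (\<lambda>d d'. f b (u \<otimes> d) (v \<otimes> d') (q \<otimes> c')))))" .
  qed simp
  finally show ?thesis .
qed

text \<open>\<open>tsum_cocycle4\<close> makes the two inner legs a coproduct times an inverse
  twist. There the twisted R-matrix is traded for \<open>R\<close> with the legs exchanged, and the
  same lemma, used backwards, restores the original grouping.\<close>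

lemma tsum_cocycle4_R:
  assumes M: "module K M" and f: "f \<in> quadrilinear_maps K H M"
  shows "tsum M Fi (\<lambda>b b'. tsum M (coprod H b) (\<lambda>p q. tsum M Fi (\<lambda>c d.
      tsum M (coprod H b') (\<lambda>p' q'. tsum M Fi (\<lambda>c' d'. tsum M RFi (\<lambda>x y.
        f (p \<otimes> c) (q \<otimes> d \<otimes> x) (p' \<otimes> c' \<otimes> y) (q' \<otimes> d')))))))
    = tsum M Fi (\<lambda>b b'. tsum M (coprod H b) (\<lambda>p q. tsum M Fi (\<lambda>c d.
      tsum M (coprod H b') (\<lambda>p' q'. tsum M Fi (\<lambda>c' d'. tsum M Ri (\<lambda>r r'.
        f (p \<otimes> c) (r \<otimes> (p' \<otimes> c')) (r' \<otimes> (q \<otimes> d)) (q' \<otimes> d')))))))"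
proof -
  note fr = linear_rules quadrilinear_apply[OF f] M module_axioms
  note cl = HH.lift_closed quadrilinear_closed[OF f] M
  \<comment> \<open>On the inner legs, \<open>\<Delta> F\<inverse> (R\<^sup>F)\<inverse>\<close>
    becomes \<open>\<Delta> R\<inverse> F\<^sub>2\<^sub>1\<inverse>\<close> and then
    \<open>R\<inverse> \<Delta>\<^sup>o\<^sup>p F\<^sub>2\<^sub>1\<inverse>\<close>.\<close>
  have key: "tsum M (coprod H (p \<otimes> c)) (\<lambda>u v. tsum M Fi (\<lambda>d d'. tsum M RFi (\<lambda>x y. f b (u \<otimes> d \<otimes> x) (v \<otimes> d' \<otimes> y) (q \<otimes> c'))))
      = tsum M (coprod H (p \<otimes> c)) (\<lambda>u v. tsum M Fi (\<lambda>d d'. tsum M Ri (\<lambda>r r'. f b (r \<otimes> (v \<otimes> d')) (r' \<otimes> (u \<otimes> d)) (q \<otimes> c'))))"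
    if H: "b \<in> carrier H" "p \<in> carrier H" "q \<in> carrier H" "c \<in> carrier H" "c' \<in> carrier H"
    for b p q c c'
  proof -
    have "tsum M (coprod H (p \<otimes> c)) (\<lambda>u v. tsum M Fi (\<lambda>d d'. tsum M RFi (\<lambda>x y. f b (u \<otimes> d \<otimes> x) (v \<otimes> d' \<otimes> y) (q \<otimes> c'))))
        = tsum M (coprod H (p \<otimes> c)) (\<lambda>u v. tsum M Fi (\<lambda>d d'. tsum M RFi (\<lambda>x y. f b (u \<otimes> (d \<otimes> x)) (v \<otimes> (d' \<otimes> y)) (q \<otimes> c'))))"
      using H by (intro lift_cong) (simp_all add: m_assoc)
    also have "\<dots> = tsum M (coprod H (p \<otimes> c)) (\<lambda>u v. tsum M Ri (\<lambda>r r'. tsum M Fi (\<lambda>d d'. f b (u \<otimes> (r \<otimes> d')) (v \<otimes> (r' \<otimes> d)) (q \<otimes> c'))))"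
      using H by (intro lift_cong tsum_Fi_RFi fr) simp_all
    also have "\<dots> = tsum M (coprod H (p \<otimes> c)) (\<lambda>u v. tsum M Ri (\<lambda>r r'. tsum M Fi (\<lambda>d d'. f b (u \<otimes> r \<otimes> d') (v \<otimes> r' \<otimes> d) (q \<otimes> c'))))"
      using H by (intro lift_cong) (simp_all add: m_assoc)
    also have "\<dots> = tsum M Ri (\<lambda>r r'. tsum M (coprod H (p \<otimes> c)) (\<lambda>u v. tsum M Fi (\<lambda>d d'. f b (r \<otimes> v \<otimes> d') (r' \<otimes> u \<otimes> d) (q \<otimes> c'))))"
      using H by (intro lift_Ri_coprod[symmetric] fr) simp_all
    also have "\<dots> = tsum M (coprod H (p \<otimes> c)) (\<lambda>u v. tsum M Ri (\<lambda>r r'. tsum M Fi (\<lambda>d d'. f b (r \<otimes> v \<otimes> d') (r' \<otimes> u \<otimes> d) (q \<otimes> c'))))"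
      using H by (intro lift_swap cl) simp_all
    also have "\<dots> = tsum M (coprod H (p \<otimes> c)) (\<lambda>u v. tsum M Fi (\<lambda>d d'. tsum M Ri (\<lambda>r r'. f b (r \<otimes> v \<otimes> d') (r' \<otimes> u \<otimes> d) (q \<otimes> c'))))"
      using H by (intro lift_cong lift_swap cl) simp_all
    also have "\<dots> = tsum M (coprod H (p \<otimes> c)) (\<lambda>u v. tsum M Fi (\<lambda>d d'. tsum M Ri (\<lambda>r r'. f b (r \<otimes> (v \<otimes> d')) (r' \<otimes> (u \<otimes> d)) (q \<otimes> c'))))"
      using H by (intro lift_cong) (simp_all add: m_assoc)
    finally show ?thesis .
  qed
  have "tsum M Fi (\<lambda>b b'. tsum M (coprod H b) (\<lambda>p q. tsum M Fi (\<lambda>c d.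
      tsum M (coprod H b') (\<lambda>p' q'. tsum M Fi (\<lambda>c' d'. tsum M RFi (\<lambda>x y.
        f (p \<otimes> c) (q \<otimes> d \<otimes> x) (p' \<otimes> c' \<otimes> y) (q' \<otimes> d')))))))
    = tsum M Fi (\<lambda>b b'. tsum M (coprod H b') (\<lambda>p q. tsum M Fi (\<lambda>c c'.
      tsum M (coprod H (p \<otimes> c)) (\<lambda>u v. tsum M Fi (\<lambda>d d'. tsum M RFi (\<lambda>x y. f b (u \<otimes> d \<otimes> x) (v \<otimes> d' \<otimes> y) (q \<otimes> c')))))))"
    by (intro tsum_cocycle4[OF M, where f = "\<lambda>k l m n. tsum M RFi (\<lambda>x y. f k (l \<otimes> x) (m \<otimes> y) n)"] fr) simp_all
  also have "\<dots> = tsum M Fi (\<lambda>b b'. tsum M (coprod H b') (\<lambda>p q. tsum M Fi (\<lambda>c c'.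
      tsum M (coprod H (p \<otimes> c)) (\<lambda>u v. tsum M Fi (\<lambda>d d'. tsum M Ri (\<lambda>r r'. f b (r \<otimes> (v \<otimes> d')) (r' \<otimes> (u \<otimes> d)) (q \<otimes> c')))))))"
    by (rule lift_cong, simp, rule lift_cong, simp, rule lift_cong, simp, rule key; simp)
  \<comment> \<open>Regrouping backwards uses a map with its inner arguments \<open>l\<close> and
    \<open>m\<close> exchanged, which accounts for the crossing of \<open>p' \<otimes> c'\<close>
    and \<open>q \<otimes> d\<close>.\<close>
  also have "\<dots> = tsum M Fi (\<lambda>b b'. tsum M (coprod H b) (\<lambda>p q. tsum M Fi (\<lambda>c d.
      tsum M (coprod H b') (\<lambda>p' q'. tsum M Fi (\<lambda>c' d'. tsum M Ri (\<lambda>r r'.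
        f (p \<otimes> c) (r \<otimes> (p' \<otimes> c')) (r' \<otimes> (q \<otimes> d)) (q' \<otimes> d')))))))"
    by (intro tsum_cocycle4[OF M, symmetric, where f = "\<lambda>k l m n. tsum M Ri (\<lambda>r r'. f k (r \<otimes> m) (r' \<otimes> l) n)"] fr) simp_all
  finally show ?thesis .
qed

end

section \<open>Deformation of maps\<close>

context hmodule_pair
begin

text \<open>The adjoint action is additive in the map, and the sums over \<xi> and over
  \<open>t\<close> are independent of each other.\<close>

lemma adj_tsum:
  assumes t: "t \<in> carrier H2" and \<xi>: "\<xi> \<in> carrier H" and v: "v \<in> carrier V"
    and L: "\<And>x y u. \<lbrakk>x \<in> carrier H; y \<in> carrier H; u \<in> carrier V\<rbrakk> \<Longrightarrow> L x y u \<in> carrier W"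
  shows "adj_act H V W \<xi> (\<lambda>u. tsum W t (\<lambda>x y. L x y u)) v = tsum W t (\<lambda>x y. adj_act H V W \<xi> (L x y) v)"
proof -
  have "adj_act H V W \<xi> (\<lambda>u. tsum W t (\<lambda>x y. L x y u)) v
      = tsum W (coprod H \<xi>) (\<lambda>p q. tsum W t (\<lambda>x y. hact W p (L x y (hact V (antipode H q) v))))"
    unfolding adj_act_def using assms by (intro lift_cong HH.linear_tensor_lift W_module W.hact_linear) simp_all
  also have "\<dots> = tsum W t (\<lambda>x y. adj_act H V W \<xi> (L x y) v)"
    unfolding adj_act_def using assms by (intro lift_swap W_module) simp_all
  finally show ?thesis .
qed

end

locale twisted_hmodule_pair = twisted_hopf_algebra K H R F + hmodule_pair K H V W
  for K and H :: "('k, 'h, 'm) hopf_scheme" (structure) and R F :: "('h, 'h) tensor"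
    and V :: "('k, 'h, 'v, 'n) hmod_scheme" and W :: "('k, 'h, 'w, 'p) hmod_scheme"
begin

abbreviation D where "D \<equiv> deform K F H V W"

lemma deform_linear_map:
  assumes "module K U" and "v \<in> carrier V"
    and "\<And>u. u \<in> carrier V \<Longrightarrow> (\<lambda>x. p x u) \<in> linear_maps K U W"
  shows "(\<lambda>x. D (p x) v) \<in> linear_maps K U W"
  unfolding deform_def using assms by (intro lift_linear_param W_module adj_linear_map) simp_all

lemma deform_linear:
  assumes "P \<in> linear_maps K V W"
  shows "D P \<in> linear_maps K V W"
proof -
  have "(\<lambda>v. D P v) \<in> linear_maps K V W"
    unfolding deform_def using assms by (intro adj_rules) simp_all
  then show ?thesis by simp
qed

lemma deform_linear_right:
  "\<lbrakk>P \<in> linear_maps K V W; g \<in> linear_maps K U V\<rbrakk> \<Longrightarrow> (\<lambda>x. D P (g x)) \<in> linear_maps K U W"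
  by (rule linear_maps_comp[OF deform_linear])

lemma deform_closed [simp]: "\<lbrakk>P \<in> linear_maps K V W; v \<in> carrier V\<rbrakk> \<Longrightarrow> D P v \<in> carrier W"
  by (rule linear_mapsD(1)[OF deform_linear])

text \<open>\<open>adj_hact\<close> passes \<xi> through each term of the deformed map, and the two
  actions on \<open>P\<close> and on \<open>v\<close> then merge. This brings the action on a
  deformed map into the form \<open>\<Delta> F\<inverse>\<close>.\<close>

lemma hact_deform:
  assumes P: "P \<in> linear_maps K V W" and \<xi>: "\<xi> \<in> carrier H" and v: "v \<in> carrier V"
  shows "hact W \<xi> (D P v)
    = tsum W (coprod H \<xi>) (\<lambda>p q. tsum W Fi (\<lambda>c d. adj_act H V W (p \<otimes> c) P (hact V (q \<otimes> d) v)))"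
proof -
  have "hact W \<xi> (D P v) = tsum W Fi (\<lambda>c d. hact W \<xi> (adj_act H V W c P (hact V d v)))"
    unfolding deform_def using assms by (intro HH.linear_tensor_lift W_module W.hact_linear) simp_all
  also have "\<dots> = tsum W Fi (\<lambda>c d. tsum W (coprod H \<xi>) (\<lambda>p q. adj_act H V W p (adj_act H V W c P) (hact V q (hact V d v))))"
    using assms by (intro lift_cong adj_hact[symmetric] adj_linear) simp_all
  also have "\<dots> = tsum W (coprod H \<xi>) (\<lambda>p q. tsum W Fi (\<lambda>c d. adj_act H V W p (adj_act H V W c P) (hact V q (hact V d v))))"
    using assms by (intro lift_swap W_module) (simp_all add: adj_linear)
  also have "\<dots> = tsum W (coprod H \<xi>) (\<lambda>p q. tsum W Fi (\<lambda>c d. adj_act H V W (p \<otimes> c) P (hact V (q \<otimes> d) v)))"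
    using assms by (intro lift_cong) (simp_all add: adj_mult[OF P] V.hact_mult)
  finally show ?thesis .
qed

text \<open>The twisted coproduct satisfies
  \<open>F\<inverse> \<Delta>\<^sup>F = \<Delta> F\<inverse>\<close>. Evaluated on the map that
  sends \<open>k\<close> and \<open>l\<close> to \<open>(k \<blacktriangleright> P)(l v)\<close>,
  this is the property characteristic of an adjoint action over \<open>HF\<close>.\<close>

lemma hact_deform_HF:
  assumes P: "P \<in> linear_maps K V W" and \<xi>: "\<xi> \<in> carrier H" and v: "v \<in> carrier V"
  shows "tsum W (coprod HF \<xi>) (\<lambda>a b. D (adj_act H V W a P) (hact V b v)) = hact W \<xi> (D P v)"
proof -
  let ?g = "\<lambda>k l. adj_act H V W k P (hact V l v)"
  have g: "?g \<in> bilinear_maps K H H W"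
    using v by (intro adj_rules P) simp_all
  have "tsum W (coprod HF \<xi>) (\<lambda>a b. D (adj_act H V W a P) (hact V b v))
      = tsum W (coprod HF \<xi>) (\<lambda>a b. tsum W Fi (\<lambda>c d. ?g (c \<otimes> a) (d \<otimes> b)))"
    unfolding deform_def using \<xi> v by (intro lift_cong) (simp_all add: adj_mult[OF P] V.hact_mult)
  also have "\<dots> = tsum W Fi (\<lambda>c d. tsum W (coprod HF \<xi>) (\<lambda>a b. ?g (c \<otimes> a) (d \<otimes> b)))"
    using \<xi> v P by (intro lift_swap W_module) simp_all
  also have "\<dots> = tsum W (Fi \<otimes>\<^bsub>H2\<^esub> coprod HF \<xi>) ?g"
    using \<xi> by (simp add: HH.lift_mult[OF W_module g])
  also have "Fi \<otimes>\<^bsub>H2\<^esub> coprod HF \<xi> = (Fi \<otimes>\<^bsub>H2\<^esub> F) \<otimes>\<^bsub>H2\<^esub> (coprod H \<xi> \<otimes>\<^bsub>H2\<^esub> Fi)"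
    unfolding HF_simps using \<xi> by (simp only: H2_m_assoc H2_mult_closed F_closed Fi_closed coprod_closed)
  also have "\<dots> = coprod H \<xi> \<otimes>\<^bsub>H2\<^esub> Fi"
    using \<xi> monoid.l_one[OF H2_monoid] by (simp add: Fi_F)
  also have "tsum W (coprod H \<xi> \<otimes>\<^bsub>H2\<^esub> Fi) ?g = hact W \<xi> (D P v)"
    using \<xi> by (simp add: HH.lift_mult[OF W_module g] hact_deform[OF P \<xi> v])
  finally show ?thesis .
qed

lemma linear_antipode_HF: "g \<in> linear_maps K U H \<Longrightarrow> (\<lambda>x. antipode HF (g x)) \<in> linear_maps K U H"
  unfolding HF_simps by (intro linear_rules) simp_all

lemma antipode_HF_closed [simp]: "\<xi> \<in> carrier H \<Longrightarrow> antipode HF \<xi> \<in> carrier H"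
  by (simp add: HF_simps)

text \<open>The adjoint action of \<open>HF\<close> is unfolded and \<open>hact_deform_HF\<close>
  passes \<open>\<xi>\<^sub>1\<close> through the deformed map. By coassociativity the leg left in
  the argument meets the twisted antipode of the next one, and the two cancel to a counit.\<close>

lemma adj_HF_deform:
  assumes P: "P \<in> linear_maps K V W" and \<xi>: "\<xi> \<in> carrier H" and v: "v \<in> carrier V"
  shows "adj_act HF V W \<xi> (D P) v = D (adj_act H V W \<xi> P) v"
proof -
  note rules = deform_linear_map deform_linear_right adj_rules linear_antipode_HF adj_linear P
  have "adj_act HF V W \<xi> (D P) v
      = tsum W (coprod HF \<xi>) (\<lambda>x y. tsum W (coprod HF x) (\<lambda>a b. D (adj_act H V W a P) (hact V b (hact V (antipode HF y) v))))"
    unfolding adj_act_def[of HF] using \<xi> v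
    by (intro lift_cong) (simp_all add: hact_deform_HF[OF P])
  also have "\<dots> = tsum W (coprod HF \<xi>) (\<lambda>x y. tsum W (coprod HF y) (\<lambda>a b. D (adj_act H V W x P) (hact V a (hact V (antipode HF b) v))))"
    using v by (intro coassoc_HF[OF W_module _ \<xi>] rules) simp_all
  also have "\<dots> = tsum W (coprod HF \<xi>) (\<lambda>x y. counit H y \<odot>\<^bsub>W\<^esub> D (adj_act H V W x P) v)"
  proof (rule lift_cong)
    fix x y assume xy: "x \<in> carrier H" "y \<in> carrier H"
    have "tsum W (coprod HF y) (\<lambda>a b. D (adj_act H V W x P) (hact V a (hact V (antipode HF b) v)))
        = tsum W (coprod HF y) (\<lambda>a b. D (adj_act H V W x P) (hact V (a \<otimes> antipode HF b) v))"
      using xy v by (intro lift_cong) (simp_all add: V.hact_mult)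
    also have "\<dots> = counit H y \<odot>\<^bsub>W\<^esub> D (adj_act H V W x P) (hact V \<one> v)"
      using xy v by (intro antipode_right_HF[OF W_module] rules) simp_all
    finally show "tsum W (coprod HF y) (\<lambda>a b. D (adj_act H V W x P) (hact V a (hact V (antipode HF b) v)))
        = counit H y \<odot>\<^bsub>W\<^esub> D (adj_act H V W x P) v"
      using v by (simp add: V.hact_one)
  qed (simp add: \<xi>)
  also have "\<dots> = D (adj_act H V W \<xi> P) v"
    using \<xi> v by (intro counit_right_HF[OF W_module, where f = "\<lambda>x. D (adj_act H V W x P) v"] rules) simp_all
  finally show ?thesis .
qed

end

section \<open>Tensor products of maps\<close>

text \<open>The four pairings supply the adjoint actions on \<open>P\<close> and on \<open>Q\<close>
  and the two tensor products over \<open>A\<close>.\<close>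

locale quasi_commutative_setting = twisted_hopf_algebra K H R F
    + VV: hmodule_bimodule_pair K H A V V' + WW: hmodule_bimodule_pair K H A W W'
    + T: hmodule_bimodule_pair K H A V W + T': hmodule_bimodule_pair K H A V' W'
  for K and H :: "('k, 'h, 'm) hopf_scheme" (structure) and R F :: "('h, 'h) tensor"
    and A :: "('k, 'h, 'a, 'n) hmod_scheme"
    and V :: "('k, 'h, 'a, 'v, 'p) hbimod_scheme" and V' :: "('k, 'h, 'a, 'v1, 'p1) hbimod_scheme"
    and W :: "('k, 'h, 'a, 'w, 'q) hbimod_scheme" and W' :: "('k, 'h, 'a, 'w1, 'q1) hbimod_scheme" +
  assumes quasi_commutative_W: "quasi_commutative_bimodule K H R A W"
    and quasi_commutative_W': "quasi_commutative_bimodule K H R A W'"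
begin

abbreviation VW where "VW \<equiv> tensor_bimod H A V W"
abbreviation VW' where "VW' \<equiv> tensor_bimod H A V' W'"

sublocale VVd: twisted_hmodule_pair K H R F V V'
  by unfold_locales

sublocale WWd: twisted_hmodule_pair K H R F W W'
  by unfold_locales

sublocale VWd: twisted_hmodule_pair K H R F VW VW'
  by (intro twisted_hmodule_pair.intro twisted_hopf_algebra_axioms hmodule_pair.intro hopf_algebra_axioms
      T.VW_left_hmodule T'.VW_left_hmodule)

lemmas all_rules = T.VW_rules T'.VW_rules VV.bimodule_rules WW.bimodule_rules

text \<open>The adjoint action is expanded, and the formula for the coproduct of the second leg of
  \<open>R\<inverse>\<close> splits off a second inverse R-matrix. One of the two carries
  \<open>a\<close> through \<open>L\<close>; the other then cancels against it by
  \<open>lift_Ri_antipode\<close>.\<close>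

lemma adj_quasi_commutative:
  assumes L: "L \<in> right_linear_maps K A W W'" and a: "a \<in> carrier A" and w: "w \<in> carrier W"
  shows "tsum W' Ri (\<lambda>x y. lact W' (hact A x a) (adj_act H W W' y L w)) = L (lact W a w)"
proof -
  note lin = WW.right_linear_mapsD(1)[OF L]
  note Lc = linear_mapsD(1)[OF lin] and M = WW.W_module
  have "tsum W' Ri (\<lambda>x y. lact W' (hact A x a) (adj_act H W W' y L w))
      = tsum W' Ri (\<lambda>x y. tsum W' (coprod H y) (\<lambda>p q. lact W' (hact A x a) (hact W' p (L (hact W (antipode H q) w)))))"
    unfolding adj_act_def using a w Lc
    by (intro lift_cong HH.linear_tensor_lift M WW.W.lact_linear) simp_all
  also have "\<dots> = tsum W' Ri (\<lambda>x y. tsum W' Ri (\<lambda>c d. lact W' (hact A (x \<otimes> c) a) (hact W' y (L (hact W (antipode H d) w)))))"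
    using a w Lc by (intro lift_coprod_right_Ri[OF M] all_rules linear_maps_comp[OF lin]) simp_all
  also have "\<dots> = tsum W' Ri (\<lambda>c d. tsum W' Ri (\<lambda>x y. lact W' (hact A (x \<otimes> c) a) (hact W' y (L (hact W (antipode H d) w)))))"
    using a w Lc by (intro lift_swap M) simp_all
  also have "\<dots> = tsum W' Ri (\<lambda>c d. L (tsum W Ri (\<lambda>x y. lact W (hact A (x \<otimes> c) a) (hact W (y \<otimes> antipode H d) w))))"
  proof (rule lift_cong)
    fix c d assume cd: "c \<in> carrier H" "d \<in> carrier H"
    have "tsum W' Ri (\<lambda>x y. lact W' (hact A (x \<otimes> c) a) (hact W' y (L (hact W (antipode H d) w))))
        = tsum W' Ri (\<lambda>x y. lact W' (hact A x (hact A c a)) (hact W' y (L (hact W (antipode H d) w))))"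
      using cd a by (intro lift_cong) (simp_all add: VV.A.hact_mult)
    \<comment> \<open>Quasi-commutativity of the target turns the left action into a right one,
      which commutes with \<open>L\<close>; quasi-commutativity of the source turns it back.\<close>
    also have "\<dots> = ract W' (L (hact W (antipode H d) w)) (hact A c a)"
      using quasi_commutative_W' cd a w Lc by (simp add: quasi_commutative_bimodule_def)
    also have "\<dots> = L (ract W (hact W (antipode H d) w) (hact A c a))"
      using cd a w by (simp add: WW.right_linear_mapsD(2)[OF L])
    also have "ract W (hact W (antipode H d) w) (hact A c a)
        = tsum W Ri (\<lambda>x y. lact W (hact A x (hact A c a)) (hact W y (hact W (antipode H d) w)))"
      using quasi_commutative_W cd a w by (simp add: quasi_commutative_bimodule_def)
    also have "\<dots> = tsum W Ri (\<lambda>x y. lact W (hact A (x \<otimes> c) a) (hact W (y \<otimes> antipode H d) w))"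
      using cd a w by (intro lift_cong) (simp_all add: VV.A.hact_mult WW.V.hact_mult)
    finally show "tsum W' Ri (\<lambda>x y. lact W' (hact A (x \<otimes> c) a) (hact W' y (L (hact W (antipode H d) w))))
        = L (tsum W Ri (\<lambda>x y. lact W (hact A (x \<otimes> c) a) (hact W (y \<otimes> antipode H d) w)))" .
  qed simp
  also have "\<dots> = L (tsum W Ri (\<lambda>c d. tsum W Ri (\<lambda>x y. lact W (hact A (x \<otimes> c) a) (hact W (y \<otimes> antipode H d) w))))"
    using a w by (intro HH.linear_tensor_lift[symmetric] WW.V_module M lin HH.lift_closed) simp_all
  also have "\<dots> = L (tsum W Ri (\<lambda>x y. tsum W Ri (\<lambda>c d. lact W (hact A (x \<otimes> c) a) (hact W (y \<otimes> antipode H d) w))))"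
    using a w by (intro arg_cong[where f = L] lift_swap WW.V_module) simp_all
  also have "\<dots> = L (lact W (hact A \<one> a) (hact W \<one> w))"
    using a w by (intro arg_cong[where f = L] lift_Ri_antipode[OF WW.V_module] all_rules) simp_all
  finally show ?thesis
    using a w by (simp add: VV.A.hact_one WW.V.hact_one)
qed

section \<open>The R-tensor product of two right linear maps\<close>

lemma tensor_R_bilinear:
  assumes P: "P \<in> linear_maps K V V'" and Q: "Q \<in> linear_maps K W W'"
  shows "(\<lambda>v w. tsum VW' Ri (\<lambda>x y. pure_tensor VW' (P (hact V x v)) (adj_act H W W' y Q w))) \<in> bilinear_maps K V W VW'"
  using linear_mapsD(1)[OF P] Q by (intro all_rules linear_maps_comp[OF P]) simp_all

text \<open>An element \<open>a\<close> on the left factor passes through \<open>P\<close> by right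
  linearity and crosses the tensor sign as a left action. The coproduct of the first leg of
  \<open>R\<inverse>\<close> has attached an R-matrix to it, just the one with which
  \<open>adj_quasi_commutative\<close> takes it inside \<open>Q\<close>.\<close>

lemma tensor_R_balanced:
  assumes P: "P \<in> right_linear_maps K A V V'" and Q: "Q \<in> right_linear_maps K A W W'"
  shows "balanced (carrier A) (ract V) (lact W) V W VW'
    (\<lambda>v w. tsum VW' Ri (\<lambda>x y. pure_tensor VW' (P (hact V x v)) (adj_act H W W' y Q w)))"
proof (rule T.VW.bilinear_balanced)
  note Pl = VV.right_linear_mapsD(1)[OF P] and Ql = WW.right_linear_mapsD(1)[OF Q]
  note Pc = linear_mapsD(1)[OF Pl]
  show "(\<lambda>v w. tsum VW' Ri (\<lambda>x y. pure_tensor VW' (P (hact V x v)) (adj_act H W W' y Q w))) \<in> bilinear_maps K V W VW'"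
    by (rule tensor_R_bilinear[OF Pl Ql])
  fix v a w assume v: "v \<in> carrier V" and a: "a \<in> carrier A" and w: "w \<in> carrier W"
  have "tsum VW' Ri (\<lambda>x y. pure_tensor VW' (P (hact V x (ract V v a))) (adj_act H W W' y Q w))
      = tsum VW' Ri (\<lambda>x y. tsum VW' (coprod H x) (\<lambda>p q. pure_tensor VW' (P (hact V p v)) (lact W' (hact A q a) (adj_act H W W' y Q w))))"
  proof (rule lift_cong)
    fix x y assume xy: "x \<in> carrier H" "y \<in> carrier H"
    have "pure_tensor VW' (P (hact V x (ract V v a))) (adj_act H W W' y Q w)
        = pure_tensor VW' (P (tsum V (coprod H x) (\<lambda>p q. ract V (hact V p v) (hact A q a)))) (adj_act H W W' y Q w)"
      using xy v a by (simp add: VV.V.hact_ract)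
    also have "\<dots> = tsum VW' (coprod H x) (\<lambda>p q. pure_tensor VW' (P (ract V (hact V p v) (hact A q a))) (adj_act H W W' y Q w))"
      using xy v a w Ql
      by (intro HH.linear_tensor_lift[where h = "\<lambda>z. pure_tensor VW' (P z) (adj_act H W W' y Q w)"] VV.V_module all_rules linear_maps_comp[OF Pl]) simp_all
    also have "\<dots> = tsum VW' (coprod H x) (\<lambda>p q. pure_tensor VW' (P (hact V p v)) (lact W' (hact A q a) (adj_act H W W' y Q w)))"
      using xy v a w Ql Pc by (intro lift_cong) (simp_all add: VV.right_linear_mapsD(2)[OF P] T'.VW.pure_tensor_balanced)
    finally show "pure_tensor VW' (P (hact V x (ract V v a))) (adj_act H W W' y Q w)
        = tsum VW' (coprod H x) (\<lambda>p q. pure_tensor VW' (P (hact V p v)) (lact W' (hact A q a) (adj_act H W W' y Q w)))" .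
  qed simp
  also have "\<dots> = tsum VW' Ri (\<lambda>x y. tsum VW' Ri (\<lambda>c d. pure_tensor VW' (P (hact V c v)) (lact W' (hact A x a) (adj_act H W W' (y \<otimes> d) Q w))))"
    using v a w Ql Pc by (intro lift_coprod_left_Ri T'.VW.T_module all_rules linear_maps_comp[OF Pl]) simp_all
  also have "\<dots> = tsum VW' Ri (\<lambda>c d. tsum VW' Ri (\<lambda>x y. pure_tensor VW' (P (hact V c v)) (lact W' (hact A x a) (adj_act H W W' (y \<otimes> d) Q w))))"
    using v a w Ql Pc by (intro lift_swap T'.VW.T_module) (simp_all add: T'.VW.pure_tensor_closed)
  also have "\<dots> = tsum VW' Ri (\<lambda>c d. pure_tensor VW' (P (hact V c v)) (adj_act H W W' d Q (lact W a w)))"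
  proof (rule lift_cong)
    fix c d assume cd: "c \<in> carrier H" "d \<in> carrier H"
    have "tsum VW' Ri (\<lambda>x y. pure_tensor VW' (P (hact V c v)) (lact W' (hact A x a) (adj_act H W W' (y \<otimes> d) Q w)))
        = tsum VW' Ri (\<lambda>x y. pure_tensor VW' (P (hact V c v)) (lact W' (hact A x a) (adj_act H W W' y (adj_act H W W' d Q) w)))"
      using cd w by (intro lift_cong) (simp_all add: WW.adj_mult[OF Ql])
    also have "\<dots> = pure_tensor VW' (P (hact V c v)) (tsum W' Ri (\<lambda>x y. lact W' (hact A x a) (adj_act H W W' y (adj_act H W W' d Q) w)))"
      using cd v a w Ql Pc
      by (intro HH.linear_tensor_lift[symmetric] WW.W_module all_rules) (simp_all add: WW.adj_linear)
    finally show "tsum VW' Ri (\<lambda>x y. pure_tensor VW' (P (hact V c v)) (lact W' (hact A x a) (adj_act H W W' (y \<otimes> d) Q w)))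
        = pure_tensor VW' (P (hact V c v)) (adj_act H W W' d Q (lact W a w))"
      using cd a w by (simp add: adj_quasi_commutative[OF WW.adj_right_linear[OF Q]])
  qed simp
  finally show "tsum VW' Ri (\<lambda>x y. pure_tensor VW' (P (hact V x (ract V v a))) (adj_act H W W' y Q w))
      = tsum VW' Ri (\<lambda>x y. pure_tensor VW' (P (hact V x v)) (adj_act H W W' y Q (lact W a w)))" .
qed

abbreviation tR where "tR \<equiv> tensor_R K H R A V V' W W'"

lemma tensor_R_eq:
  "tR P Q = tensor_lift VW' (\<lambda>v w. tsum VW' Ri (\<lambda>x y. pure_tensor VW' (P (hact V x v)) (adj_act H W W' y Q w)))"
  by (simp add: tensor_R_def Let_def)

lemma tensor_R_linear:
  assumes P: "P \<in> right_linear_maps K A V V'" and Q: "Q \<in> right_linear_maps K A W W'"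
  shows "tR P Q \<in> linear_maps K VW VW'"
  unfolding tensor_R_eq
  by (intro T.VW.tensor_lift_linear T'.VW.T_module tensor_R_balanced P Q tensor_R_bilinear
      VV.right_linear_mapsD(1)[OF P] WW.right_linear_mapsD(1)[OF Q])

lemma tensor_R_pure:
  assumes P: "P \<in> right_linear_maps K A V V'" and Q: "Q \<in> right_linear_maps K A W W'"
    and v: "v \<in> carrier V" and w: "w \<in> carrier W"
  shows "tR P Q (pure_tensor VW v w) = tsum VW' Ri (\<lambda>x y. pure_tensor VW' (P (hact V x v)) (adj_act H W W' y Q w))"
  unfolding tensor_R_eq
  by (intro T.VW.tensor_lift_pure T'.VW.T_abelian_group tensor_R_balanced P Q v w)

lemma tensor_R_adj_bilinear:
  assumes P: "P \<in> right_linear_maps K A V V'" and Q: "Q \<in> right_linear_maps K A W W'" and s: "s \<in> carrier VW"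
  shows "(\<lambda>a b. tR (adj_act H V V' a P) (adj_act H W W' b Q) s) \<in> bilinear_maps K H H VW'"
proof -
  note Pl = VV.right_linear_mapsD(1)[OF P] and Ql = WW.right_linear_mapsD(1)[OF Q]
  show ?thesis
    unfolding tensor_R_eq using s Pl Ql
    by (intro bilinear_mapsI T.VW.tensor_lift_linear_param T'.VW.T_module module_axioms all_rules WW.adj_linear_map)
      (simp_all add: WW.adj_linear VV.adj_linear)
qed

text \<open>The right side groups the two middle legs into one coproduct, past which an R-matrix can
  be commuted.\<close>

lemma coassoc4:
  assumes M: "module K M" and f: "f \<in> quadrilinear_maps K H M" and \<xi>: "\<xi> \<in> carrier H"
  shows "tsum M (coprod H \<xi>) (\<lambda>x y. tsum M (coprod H x) (\<lambda>a b. tsum M (coprod H y) (\<lambda>c d. f a b c d)))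
       = tsum M (coprod H \<xi>) (\<lambda>x y. tsum M (coprod H y) (\<lambda>p q. tsum M (coprod H p) (\<lambda>u u'. f x u u' q)))"
proof -
  note fr = linear_rules quadrilinear_apply[OF f] M module_axioms
  have "tsum M (coprod H \<xi>) (\<lambda>x y. tsum M (coprod H x) (\<lambda>a b. tsum M (coprod H y) (\<lambda>c d. f a b c d)))
      = tsum M (coprod H \<xi>) (\<lambda>x y. tsum M (coprod H y) (\<lambda>p q. tsum M (coprod H q) (\<lambda>c d. f x p c d)))"
    by (intro coassoc_lift[OF M _ \<xi>] fr) simp_all
  also have "\<dots> = tsum M (coprod H \<xi>) (\<lambda>x y. tsum M (coprod H y) (\<lambda>p q. tsum M (coprod H p) (\<lambda>u u'. f x u u' q)))"
    using \<xi> by (intro lift_cong coassoc_lift[OF M, symmetric] fr) simp_all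
  finally show ?thesis .
qed

text \<open>By uniqueness, the candidate only has to be tested on the action of a further coproduct
  leg. The leg acting on \<open>Q\<close> and the leg acting on \<open>v\<close> stand in the
  opposite order to the factors of the R-matrix; once they are commuted past it,
  \<open>adj_hact\<close> evaluates each tensor factor.\<close>

lemma adj_tensor_R:
  assumes P: "P \<in> right_linear_maps K A V V'" and Q: "Q \<in> right_linear_maps K A W W'"
    and \<xi>: "\<xi> \<in> carrier H" and s: "s \<in> carrier VW"
  shows "adj_act H VW VW' \<xi> (tR P Q) s = tsum VW' (coprod H \<xi>) (\<lambda>a b. tR (adj_act H V V' a P) (adj_act H W W' b Q) s)"
proof (rule VWd.adj_unique[OF tensor_R_linear[OF P Q] _ _ \<xi> s,
      where g = "\<lambda>\<xi> s. tsum VW' (coprod H \<xi>) (\<lambda>a b. tR (adj_act H V V' a P) (adj_act H W W' b Q) s)"])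
  note Pl = VV.right_linear_mapsD(1)[OF P] and Ql = WW.right_linear_mapsD(1)[OF Q]
  note Pc = linear_mapsD(1)[OF Pl] and M = T'.VW.T_module
  note adjR = VV.adj_right_linear[OF P] WW.adj_right_linear[OF Q]
  note lin = tensor_R_linear[OF adjR]
  show bil: "(\<lambda>\<xi> s. tsum VW' (coprod H \<xi>) (\<lambda>a b. tR (adj_act H V V' a P) (adj_act H W W' b Q) s)) \<in> bilinear_maps K H VW VW'"
    using lin
    by (intro bilinear_mapsI HH.lift_linear_arg[OF M] tensor_R_adj_bilinear P Q coprod_linear lift_linear_param M T.VW.T_module) auto
  fix \<xi> s assume \<xi>: "\<xi> \<in> carrier H" and s: "s \<in> carrier VW"
  show "tsum VW' (coprod H \<xi>) (\<lambda>x y. tsum VW' (coprod H x) (\<lambda>a b. tR (adj_act H V V' a P) (adj_act H W W' b Q) (hact VW y s)))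
      = hact VW' \<xi> (tR P Q s)"
  proof (rule T.VW_linear_eqI[OF _ _ s])
    show "(\<lambda>s. tsum VW' (coprod H \<xi>) (\<lambda>x y. tsum VW' (coprod H x) (\<lambda>a b. tR (adj_act H V V' a P) (adj_act H W W' b Q) (hact VW y s)))) \<in> linear_maps K VW VW'"
      using \<xi> T.hact_VW_linear
      by (intro lift_linear_param M T.VW.T_module linear_maps_comp[OF lin]) simp_all
    show "(\<lambda>s. hact VW' \<xi> (tR P Q s)) \<in> linear_maps K VW VW'"
      by (intro linear_maps_comp[OF T'.hact_VW_linear[OF \<xi>]] tensor_R_linear P Q)
    fix v w assume v: "v \<in> carrier V" and w: "w \<in> carrier W"
    note cl = HH.lift_closed M T'.VW.pure_tensor_closed
    let ?p = "pure_tensor VW'" and ?a = "adj_act H V V'" and ?b = "adj_act H W W'"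
    \<comment> \<open>The diagonal action produces the legs \<open>c\<close> and \<open>d\<close>;
      \<open>r\<close> multiplies the leg acting on \<open>v\<close> and \<open>r'\<close> the leg
      acting on \<open>Q\<close>.\<close>
    have "tsum VW' (coprod H \<xi>) (\<lambda>x y. tsum VW' (coprod H x) (\<lambda>a b. tR (?a a P) (?b b Q) (hact VW y (pure_tensor VW v w))))
        = tsum VW' (coprod H \<xi>) (\<lambda>x y. tsum VW' (coprod H x) (\<lambda>a b. tsum VW' (coprod H y) (\<lambda>c d.
            tsum VW' Ri (\<lambda>r r'. ?p (?a a P (hact V (r \<otimes> c) v)) (?b (r' \<otimes> b) Q (hact W d w))))))"
    proof (intro lift_cong coprod_closed \<xi>)
      fix x y a b assume xyab: "x \<in> carrier H" "y \<in> carrier H" "a \<in> carrier H" "b \<in> carrier H"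
      have "tR (?a a P) (?b b Q) (hact VW y (pure_tensor VW v w))
          = tsum VW' (coprod H y) (\<lambda>c d. tR (?a a P) (?b b Q) (pure_tensor VW (hact V c v) (hact W d w)))"
        unfolding T.hact_VW_pure[OF xyab(2) v w] using xyab v w
        by (intro HH.linear_tensor_lift M T.VW.T_module lin) (simp_all add: T.VW.pure_tensor_closed)
      also have "\<dots> = tsum VW' (coprod H y) (\<lambda>c d. tsum VW' Ri (\<lambda>r r'. ?p (?a a P (hact V (r \<otimes> c) v)) (?b (r' \<otimes> b) Q (hact W d w))))"
        using xyab v w
        by (intro lift_cong, simp, subst tensor_R_pure[OF adjR], simp_all)
          (intro lift_cong, simp_all add: VV.V.hact_mult WW.adj_mult[OF Ql])
      finally show "tR (?a a P) (?b b Q) (hact VW y (pure_tensor VW v w)) = tsum VW' (coprod H y) (\<lambda>c d.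
            tsum VW' Ri (\<lambda>r r'. ?p (?a a P (hact V (r \<otimes> c) v)) (?b (r' \<otimes> b) Q (hact W d w))))" .
    qed
    also have "\<dots> = tsum VW' (coprod H \<xi>) (\<lambda>x y. tsum VW' (coprod H y) (\<lambda>p q. tsum VW' (coprod H p) (\<lambda>u u'.
            tsum VW' Ri (\<lambda>r r'. ?p (?a x P (hact V (r \<otimes> u') v)) (?b (r' \<otimes> u) Q (hact W q w))))))"
      using v w Pl Ql
      by (intro coassoc4[OF M _ \<xi>, where f = "\<lambda>a b c d. tsum VW' Ri (\<lambda>r r'. ?p (?a a P (hact V (r \<otimes> c) v)) (?b (r' \<otimes> b) Q (hact W d w)))"] all_rules) simp_all
    \<comment> \<open>The legs of \<open>p\<close> occur flipped behind the inverse R-matrix; they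
      are moved in front of it and regain their order.\<close>
    also have "\<dots> = tsum VW' (coprod H \<xi>) (\<lambda>x y. tsum VW' (coprod H y) (\<lambda>p q. tsum VW' (coprod H p) (\<lambda>u u'.
            tsum VW' Ri (\<lambda>r r'. ?p (?a x P (hact V (u \<otimes> r) v)) (?b (u' \<otimes> r') Q (hact W q w))))))"
    proof -
      have key: "tsum VW' (coprod H p) (\<lambda>u u'. tsum VW' Ri (\<lambda>r r'. ?p (?a x P (hact V (r \<otimes> u') v)) (?b (r' \<otimes> u) Q (hact W q w))))
          = tsum VW' (coprod H p) (\<lambda>u u'. tsum VW' Ri (\<lambda>r r'. ?p (?a x P (hact V (u \<otimes> r) v)) (?b (u' \<otimes> r') Q (hact W q w))))"
        if H: "x \<in> carrier H" "p \<in> carrier H" "q \<in> carrier H" for x p q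
      proof -
        let ?f = "\<lambda>k l. ?p (?a x P (hact V k v)) (?b l Q (hact W q w))"
        have f: "?f \<in> bilinear_maps K H H VW'"
          using H v w Pl Ql by (intro all_rules) simp_all
        have "tsum VW' (coprod H p) (\<lambda>u u'. tsum VW' Ri (\<lambda>r r'. ?f (r \<otimes> u') (r' \<otimes> u)))
            = tsum VW' Ri (\<lambda>r r'. tsum VW' (coprod H p) (\<lambda>u u'. ?f (r \<otimes> u') (r' \<otimes> u)))"
          using H v w Pl Ql by (intro lift_swap cl) simp_all
        also have "\<dots> = tsum VW' (coprod H p) (\<lambda>u u'. tsum VW' Ri (\<lambda>r r'. ?f (u \<otimes> r) (u' \<otimes> r')))"
          by (rule lift_Ri_coprod[OF M f H(2)])
        finally show ?thesis .
      qed
      show ?thesis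
        using \<xi> by (intro lift_cong[OF coprod_closed] key) simp_all
    qed
    \<comment> \<open>Back in the symmetric grouping, each of the two inner coproducts belongs to a
      single tensor factor.\<close>
    also have "\<dots> = tsum VW' (coprod H \<xi>) (\<lambda>x y. tsum VW' (coprod H x) (\<lambda>a b. tsum VW' (coprod H y) (\<lambda>c d.
            tsum VW' Ri (\<lambda>r r'. ?p (?a a P (hact V (b \<otimes> r) v)) (?b (c \<otimes> r') Q (hact W d w))))))"
      using v w Pl Ql
      by (intro coassoc4[OF M _ \<xi>, symmetric, where f = "\<lambda>a b c d. tsum VW' Ri (\<lambda>r r'. ?p (?a a P (hact V (b \<otimes> r) v)) (?b (c \<otimes> r') Q (hact W d w)))"] all_rules) simp_all
    also have "\<dots> = tsum VW' (coprod H \<xi>) (\<lambda>x y. tsum VW' Ri (\<lambda>r r'. ?p (hact V' x (P (hact V r v))) (hact W' y (?b r' Q w))))"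
    proof (intro lift_cong coprod_closed \<xi>)
      fix x y assume xy: "x \<in> carrier H" "y \<in> carrier H"
      have "tsum VW' (coprod H x) (\<lambda>a b. tsum VW' (coprod H y) (\<lambda>c d.
            tsum VW' Ri (\<lambda>r r'. ?p (?a a P (hact V (b \<otimes> r) v)) (?b (c \<otimes> r') Q (hact W d w)))))
          = tsum VW' (coprod H x) (\<lambda>a b. tsum VW' Ri (\<lambda>r r'. tsum VW' (coprod H y) (\<lambda>c d.
            ?p (?a a P (hact V (b \<otimes> r) v)) (?b (c \<otimes> r') Q (hact W d w)))))"
        using xy v w Pl Ql by (intro lift_cong[OF coprod_closed] lift_swap cl) simp_all
      also have "\<dots> = tsum VW' Ri (\<lambda>r r'. tsum VW' (coprod H x) (\<lambda>a b. tsum VW' (coprod H y) (\<lambda>c d.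
            ?p (?a a P (hact V (b \<otimes> r) v)) (?b (c \<otimes> r') Q (hact W d w)))))"
        using xy v w Pl Ql by (intro lift_swap cl) simp_all
      also have "\<dots> = tsum VW' Ri (\<lambda>r r'. ?p (hact V' x (P (hact V r v))) (hact W' y (?b r' Q w)))"
      proof (rule lift_cong[OF Ri_closed])
        fix r r' assume r: "r \<in> carrier H" "r' \<in> carrier H"
        have "tsum VW' (coprod H x) (\<lambda>a b. tsum VW' (coprod H y) (\<lambda>c d.
            ?p (?a a P (hact V (b \<otimes> r) v)) (?b (c \<otimes> r') Q (hact W d w))))
          = tsum VW' (coprod H x) (\<lambda>a b. tsum VW' (coprod H y) (\<lambda>c d.
            ?p (?a a P (hact V b (hact V r v))) (?b c (?b r' Q) (hact W d w))))"
          using xy r v w by (intro lift_cong) (simp_all add: VV.V.hact_mult WW.adj_mult[OF Ql])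
        also have "\<dots> = tsum VW' (coprod H x) (\<lambda>a b. ?p (?a a P (hact V b (hact V r v))) (tsum W' (coprod H y) (\<lambda>c d. ?b c (?b r' Q) (hact W d w))))"
          using xy r v w Pl Ql
          by (intro lift_cong[OF coprod_closed] HH.linear_tensor_lift[symmetric] WW.W_module all_rules) (simp_all add: WW.adj_linear)
        also have "\<dots> = tsum VW' (coprod H x) (\<lambda>a b. ?p (?a a P (hact V b (hact V r v))) (hact W' y (?b r' Q w)))"
          using xy r w Ql by (simp add: WW.adj_hact WW.adj_linear)
        also have "\<dots> = ?p (tsum V' (coprod H x) (\<lambda>a b. ?a a P (hact V b (hact V r v)))) (hact W' y (?b r' Q w))"
          using xy r v w Pl Ql
          by (intro HH.linear_tensor_lift[symmetric, where h = "\<lambda>z. ?p z (hact W' y (?b r' Q w))"] VV.W_module all_rules) simp_all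
        also have "\<dots> = ?p (hact V' x (P (hact V r v))) (hact W' y (?b r' Q w))"
          using xy r v by (simp add: VV.adj_hact[OF Pl])
        finally show "tsum VW' (coprod H x) (\<lambda>a b. tsum VW' (coprod H y) (\<lambda>c d.
            ?p (?a a P (hact V (b \<otimes> r) v)) (?b (c \<otimes> r') Q (hact W d w))))
          = ?p (hact V' x (P (hact V r v))) (hact W' y (?b r' Q w))" .
      qed
      finally show "tsum VW' (coprod H x) (\<lambda>a b. tsum VW' (coprod H y) (\<lambda>c d.
            tsum VW' Ri (\<lambda>r r'. ?p (?a a P (hact V (b \<otimes> r) v)) (?b (c \<otimes> r') Q (hact W d w)))))
          = tsum VW' Ri (\<lambda>r r'. ?p (hact V' x (P (hact V r v))) (hact W' y (?b r' Q w)))" .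
    qed
    also have "\<dots> = tsum VW' Ri (\<lambda>r r'. tsum VW' (coprod H \<xi>) (\<lambda>x y. ?p (hact V' x (P (hact V r v))) (hact W' y (?b r' Q w))))"
      using \<xi> v w Pc Ql by (intro lift_swap cl) simp_all
    also have "\<dots> = tsum VW' Ri (\<lambda>r r'. hact VW' \<xi> (?p (P (hact V r v)) (?b r' Q w)))"
      using \<xi> v w Pc Ql by (intro lift_cong T'.hact_VW_pure[symmetric]) simp_all
    also have "\<dots> = hact VW' \<xi> (tsum VW' Ri (\<lambda>r r'. ?p (P (hact V r v)) (?b r' Q w)))"
      using \<xi> v w Pc Ql by (intro HH.linear_tensor_lift[symmetric] M T'.hact_VW_linear) (simp_all add: T'.VW.pure_tensor_closed)
    also have "\<dots> = hact VW' \<xi> (tR P Q (pure_tensor VW v w))"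
      by (simp add: tensor_R_pure[OF P Q v w])
    finally show "tsum VW' (coprod H \<xi>) (\<lambda>x y. tsum VW' (coprod H x) (\<lambda>a b. tR (?a a P) (?b b Q) (hact VW y (pure_tensor VW v w))))
        = hact VW' \<xi> (tR P Q (pure_tensor VW v w))" .
  qed
qed

end

section \<open>The isomorphism from the deformed to the undeformed tensor product\<close>

lemma star_bimod_simps:
  "carrier (star_bimod K F H A V) = carrier V" "ring.add (star_bimod K F H A V) = ring.add V"
  "\<zero>\<^bsub>star_bimod K F H A V\<^esub> = \<zero>\<^bsub>V\<^esub>" "hact (star_bimod K F H A V) = hact V"
  "lact (star_bimod K F H A V) a v
    = tensor_lift V (\<lambda>x y. lact V (hact A x a) (hact V y v)) (inv\<^bsub>tensor2 K H\<^esub> F)"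
  "ract (star_bimod K F H A V) v a
    = tensor_lift V (\<lambda>x y. ract V (hact V x v) (hact A y a)) (inv\<^bsub>tensor2 K H\<^esub> F)"
  by (simp_all add: star_bimod_def)

lemma tensor_lift_star_bimod: "tensor_lift (star_bimod K F H A V) = tensor_lift V"
  by (rule tensor_lift_codomain) (simp_all add: star_bimod_simps)

lemma pure_tensor_star_bimod: "pure_tensor (star_bimod K F H A V) = pure_tensor V"
  by (rule pure_tensor_codomain) (simp add: star_bimod_simps)

text \<open>The deformation changes the actions of \<open>A\<close> only, and the adjoint action
  does not involve them.\<close>

lemma adj_act_star_bimod:
  "adj_act H' (star_bimod K F H A V) (star_bimod K F H A W) = adj_act H' V W"
  by (simp add: fun_eq_iff adj_act_def tensor_lift_star_bimod star_bimod_simps)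

locale twisted_bimodule_pair = twisted_hopf_algebra K H R F + hmodule_bimodule_pair K H A V W
  for K and H :: "('k, 'h, 'm) hopf_scheme" (structure) and R F :: "('h, 'h) tensor"
    and A :: "('k, 'h, 'a, 'n) hmod_scheme"
    and V :: "('k, 'h, 'a, 'v, 'p) hbimod_scheme" and W :: "('k, 'h, 'a, 'w, 'q) hbimod_scheme"
begin

abbreviation As where "As \<equiv> star_algebra K F H A"
abbreviation Vs where "Vs \<equiv> star_bimod K F H A V"
abbreviation Ws where "Ws \<equiv> star_bimod K F H A W"
abbreviation VWs where "VWs \<equiv> tensor_bimod HF As Vs Ws"

text \<open>The underlying modules \<open>V\<close> and \<open>W\<close> can be taken as factors,
  because the deformation enters through the balancing relations alone. The same formal sums
  represent tensors before and after it.\<close>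

sublocale VWs: tensor_product "carrier A" "ract Vs" "lact Ws" V W VWs
proof unfold_locales
  show "ract Vs v a \<in> carrier V" if "v \<in> carrier V" "a \<in> carrier A" for v a
    unfolding star_bimod_simps using that by (intro HH.lift_closed V_module) simp_all
  show "lact Ws a w \<in> carrier W" if "w \<in> carrier W" "a \<in> carrier A" for w a
    unfolding star_bimod_simps using that by (intro HH.lift_closed W_module) simp_all
  have "tensor_group (carrier As) (ract Vs) (lact Ws) Vs Ws = tensor_group (carrier A) (ract Vs) (lact Ws) V W"
    by (simp add: tensor_group_def tensor_quotient_def tensor_relations_def star_algebra_def
        star_bimod_simps(1-4) Let_def)
  then show "carrier VWs = carrier (tensor_group (carrier A) (ract Vs) (lact Ws) V W)"
    "ring.add VWs = ring.add (tensor_group (carrier A) (ract Vs) (lact Ws) V W)"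
    "\<zero>\<^bsub>VWs\<^esub> = \<zero>\<^bsub>tensor_group (carrier A) (ract Vs) (lact Ws) V W\<^esub>"
    by (simp_all add: tensor_bimod_simps)
qed

abbreviation \<phi> where "\<phi> \<equiv> twist_iso K F H A V W"

lemma twist_iso_eq:
  "\<phi> = tensor_lift VW (\<lambda>v w. tsum VW Fi (\<lambda>x y. pure_tensor VW (hact V x v) (hact W y w)))"
  by (simp add: twist_iso_def Let_def tensor_lift_star_bimod pure_tensor_star_bimod)

text \<open>Brings the action on a deformed product into the form
  \<open>\<Delta> F\<inverse>\<close>, one side of the cocycle condition as it is needed for
  balancedness of the isomorphism.\<close>

lemma hact_ract_star:
  assumes \<xi>: "\<xi> \<in> carrier H" and v: "v \<in> carrier V" and a: "a \<in> carrier A"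
  shows "hact V \<xi> (ract Vs v a)
    = tsum V (coprod H \<xi>) (\<lambda>p q. tsum V Fi (\<lambda>c d. ract V (hact V (p \<otimes> c) v) (hact A (q \<otimes> d) a)))"
proof -
  have "hact V \<xi> (ract Vs v a) = tsum V Fi (\<lambda>c d. hact V \<xi> (ract V (hact V c v) (hact A d a)))"
    unfolding star_bimod_simps using assms by (intro HH.linear_tensor_lift V_module V.hact_linear) simp_all
  also have "\<dots> = tsum V Fi (\<lambda>c d. tsum V (coprod H \<xi>) (\<lambda>p q. ract V (hact V (p \<otimes> c) v) (hact A (q \<otimes> d) a)))"
    using assms by (intro lift_cong) (simp_all add: V.hact_ract V.hact_mult A.hact_mult cong: lift_cong)
  also have "\<dots> = tsum V (coprod H \<xi>) (\<lambda>p q. tsum V Fi (\<lambda>c d. ract V (hact V (p \<otimes> c) v) (hact A (q \<otimes> d) a)))"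
    using assms by (intro lift_swap V_module) simp_all
  finally show ?thesis .
qed

lemma hact_lact_star:
  assumes \<xi>: "\<xi> \<in> carrier H" and w: "w \<in> carrier W" and a: "a \<in> carrier A"
  shows "hact W \<xi> (lact Ws a w)
    = tsum W (coprod H \<xi>) (\<lambda>p q. tsum W Fi (\<lambda>c d. lact W (hact A (p \<otimes> c) a) (hact W (q \<otimes> d) w)))"
proof -
  have "hact W \<xi> (lact Ws a w) = tsum W Fi (\<lambda>c d. hact W \<xi> (lact W (hact A c a) (hact W d w)))"
    unfolding star_bimod_simps using assms by (intro HH.linear_tensor_lift W_module W.hact_linear) simp_all
  also have "\<dots> = tsum W Fi (\<lambda>c d. tsum W (coprod H \<xi>) (\<lambda>p q. lact W (hact A (p \<otimes> c) a) (hact W (q \<otimes> d) w)))"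
    using assms by (intro lift_cong) (simp_all add: W.hact_lact W.hact_mult A.hact_mult cong: lift_cong)
  also have "\<dots> = tsum W (coprod H \<xi>) (\<lambda>p q. tsum W Fi (\<lambda>c d. lact W (hact A (p \<otimes> c) a) (hact W (q \<otimes> d) w)))"
    using assms by (intro lift_swap W_module) simp_all
  finally show ?thesis .
qed

text \<open>Placing the deformed action of \<open>a\<close> on \<open>v\<close> or on
  \<open>w\<close> produces the two sides of the inverted cocycle condition, with legs acting on
  \<open>v\<close>, \<open>a\<close> and \<open>w\<close>. Balancedness over \<open>A\<close> moves
  the middle leg across the tensor sign.\<close>

lemma twist_iso_balanced:
  "balanced (carrier A) (ract Vs) (lact Ws) V W VW
    (\<lambda>v w. tsum VW Fi (\<lambda>x y. pure_tensor VW (hact V x v) (hact W y w)))"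
proof -
  let ?f = "\<lambda>v w. tsum VW Fi (\<lambda>x y. pure_tensor VW (hact V x v) (hact W y w))"
  have bil: "?f \<in> bilinear_maps K V W VW"
    by (intro VW_rules bimodule_rules) simp_all
  have "?f (ract Vs v a) w = ?f v (lact Ws a w)"
    if v: "v \<in> carrier V" and a: "a \<in> carrier A" and w: "w \<in> carrier W" for v a w
  proof -
    have "?f (ract Vs v a) w = tsum VW Fi (\<lambda>x y. tsum VW (coprod H x) (\<lambda>p q. tsum VW Fi (\<lambda>c d.
        pure_tensor VW (ract V (hact V (p \<otimes> c) v) (hact A (q \<otimes> d) a)) (hact W y w))))"
    proof (rule lift_cong[OF Fi_closed])
      fix x y assume xy: "x \<in> carrier H" "y \<in> carrier H"
      let ?h = "\<lambda>z. pure_tensor VW z (hact W y w)"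
      have h: "?h \<in> linear_maps K V VW"
        using xy w by (intro VW_rules linear_maps_id) simp_all
      have "?h (hact V x (ract Vs v a)) = tsum VW (coprod H x) (\<lambda>p q. ?h (tsum V Fi (\<lambda>c d. ract V (hact V (p \<otimes> c) v) (hact A (q \<otimes> d) a))))"
        unfolding hact_ract_star[OF xy(1) v a] using xy v a
        by (intro HH.linear_tensor_lift[where h = ?h] V_module VW.T_module h HH.lift_closed) simp_all
      also have "\<dots> = tsum VW (coprod H x) (\<lambda>p q. tsum VW Fi (\<lambda>c d. ?h (ract V (hact V (p \<otimes> c) v) (hact A (q \<otimes> d) a))))"
        using xy v a by (intro lift_cong HH.linear_tensor_lift[where h = ?h] V_module VW.T_module h) simp_all
      finally show "?h (hact V x (ract Vs v a)) = tsum VW (coprod H x) (\<lambda>p q. tsum VW Fi (\<lambda>c d.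
          ?h (ract V (hact V (p \<otimes> c) v) (hact A (q \<otimes> d) a))))" .
    qed
    also have "\<dots> = tsum VW Fi (\<lambda>x y. tsum VW (coprod H y) (\<lambda>p q. tsum VW Fi (\<lambda>c d.
        pure_tensor VW (ract V (hact V x v) (hact A (p \<otimes> c) a)) (hact W (q \<otimes> d) w))))"
      using v a w
      by (intro lift_cocycle[where f = "\<lambda>k l m. pure_tensor VW (ract V (hact V k v) (hact A l a)) (hact W m w)"] VW_rules bimodule_rules) simp_all
    also have "\<dots> = ?f v (lact Ws a w)"
    proof (rule lift_cong[OF Fi_closed])
      fix x y assume xy: "x \<in> carrier H" "y \<in> carrier H"
      let ?h = "\<lambda>z. pure_tensor VW (hact V x v) z"
      have h: "?h \<in> linear_maps K W VW"
        using xy v by (intro VW_rules linear_maps_id) simp_all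
      have "tsum VW (coprod H y) (\<lambda>p q. tsum VW Fi (\<lambda>c d.
          pure_tensor VW (ract V (hact V x v) (hact A (p \<otimes> c) a)) (hact W (q \<otimes> d) w)))
        = tsum VW (coprod H y) (\<lambda>p q. tsum VW Fi (\<lambda>c d. ?h (lact W (hact A (p \<otimes> c) a) (hact W (q \<otimes> d) w))))"
        using xy v a w by (intro lift_cong) (simp_all add: VW.pure_tensor_balanced)
      also have "\<dots> = tsum VW (coprod H y) (\<lambda>p q. ?h (tsum W Fi (\<lambda>c d. lact W (hact A (p \<otimes> c) a) (hact W (q \<otimes> d) w))))"
        using xy a w by (intro lift_cong HH.linear_tensor_lift[where h = ?h, symmetric] W_module VW.T_module h) simp_all
      also have "\<dots> = ?h (hact W y (lact Ws a w))"
        unfolding hact_lact_star[OF xy(2) w a] using xy a w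
        by (intro HH.linear_tensor_lift[where h = ?h, symmetric] W_module VW.T_module h HH.lift_closed) simp_all
      finally show "tsum VW (coprod H y) (\<lambda>p q. tsum VW Fi (\<lambda>c d.
          pure_tensor VW (ract V (hact V x v) (hact A (p \<otimes> c) a)) (hact W (q \<otimes> d) w)))
        = ?h (hact W y (lact Ws a w))" .
    qed
    finally show ?thesis .
  qed
  then show ?thesis
    using bil by (auto simp: balanced_def bilinear_maps_def linear_maps_additive)
qed

lemma twist_iso_additive: "\<phi> \<in> additive_maps VWs VW"
  unfolding twist_iso_eq by (intro VWs.tensor_lift_additive VW.T_abelian_group twist_iso_balanced)

lemma twist_iso_pure:
  "\<lbrakk>v \<in> carrier V; w \<in> carrier W\<rbrakk>
    \<Longrightarrow> \<phi> (pure_tensor VWs v w) = tsum VW Fi (\<lambda>x y. pure_tensor VW (hact V x v) (hact W y w))"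
  unfolding twist_iso_eq by (intro VWs.tensor_lift_pure VW.T_abelian_group twist_iso_balanced)

end

section \<open>The tensor product of deformed maps\<close>

context quasi_commutative_setting
begin

sublocale S: twisted_bimodule_pair K H R F A V W
  by unfold_locales

sublocale S': twisted_bimodule_pair K H R F A V' W'
  by unfold_locales

lemma tensor_R_star_eq:
  "tensor_R K HF RF S.As S.Vs S'.Vs S.Ws S'.Ws P Q
    = tensor_lift S'.VWs (\<lambda>v w. tsum S'.VWs RFi (\<lambda>x y.
        pure_tensor S'.VWs (P (hact V x v)) (adj_act HF W W' y Q w)))"
  by (simp add: tensor_R_def Let_def tensor2_HF star_bimod_simps(4) adj_act_star_bimod)

text \<open>The generator case of the theorem. Both sides are brought to sums of one quadrilinear
  map, to which \<open>tsum_cocycle4_R\<close> applies.\<close>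

lemma tensor_R_deform_pure:
  assumes P: "P \<in> right_linear_maps K A V V'" and Q: "Q \<in> right_linear_maps K A W W'"
    and v: "v \<in> carrier V" and w: "w \<in> carrier W"
  shows "S'.\<phi> (tsum S'.VWs RFi (\<lambda>x y. pure_tensor S'.VWs (VVd.D P (hact V x v)) (adj_act HF W W' y (WWd.D Q) w)))
    = VWd.D (\<lambda>s. tsum VW' Fi (\<lambda>x y. tR (adj_act H V V' x P) (adj_act H W W' y Q) s))
        (tsum VW Fi (\<lambda>c d. pure_tensor VW (hact V c v) (hact W d w)))"
proof -
  note Pl = VV.right_linear_mapsD(1)[OF P] and Ql = WW.right_linear_mapsD(1)[OF Q]
  note M = T'.VW.T_module
  note adjR = VV.adj_right_linear[OF P] WW.adj_right_linear[OF Q]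
  note cl = HH.lift_closed M T'.VW.pure_tensor_closed
  let ?p = "pure_tensor VW'" and ?a = "adj_act H V V'" and ?b = "adj_act H W W'"
  \<comment> \<open>The arguments stand in the order \<open>P\<close>, \<open>v\<close>,
    \<open>Q\<close>, \<open>w\<close>, so the R-matrices sit on the two inner ones.\<close>
  let ?\<Phi> = "\<lambda>k l m n. ?p (?a k P (hact V l v)) (?b m Q (hact W n w))"
  let ?B = "\<lambda>s. tsum VW' Fi (\<lambda>x y. tR (?a x P) (?b y Q) s)"
  let ?z = "tsum VW Fi (\<lambda>c d. pure_tensor VW (hact V c v) (hact W d w))"
  have \<Phi>: "?\<Phi> \<in> quadrilinear_maps K H VW'"
    using v w Pl Ql by (intro all_rules) simp_all
  have "S'.\<phi> (tsum S'.VWs RFi (\<lambda>x y. pure_tensor S'.VWs (VVd.D P (hact V x v)) (adj_act HF W W' y (WWd.D Q) w)))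
      = tsum VW' RFi (\<lambda>x y. S'.\<phi> (pure_tensor S'.VWs (VVd.D P (hact V x v)) (WWd.D (?b y Q) w)))"
    using v w Pl Ql
    by (subst HH.additive_map_tensor_lift[OF S'.VWs.T_abelian_group T'.VW.T_abelian_group S'.twist_iso_additive RFi_closed])
      (auto intro!: S'.VWs.pure_tensor_closed lift_cong simp: WWd.adj_HF_deform WW.adj_linear)
  also have "\<dots> = tsum VW' RFi (\<lambda>x y. tsum VW' Fi (\<lambda>b b'. ?p (hact V' b (VVd.D P (hact V x v))) (hact W' b' (WWd.D (?b y Q) w))))"
    using v w Pl Ql by (intro lift_cong S'.twist_iso_pure) (simp_all add: WW.adj_linear)
  also have "\<dots> = tsum VW' RFi (\<lambda>x y. tsum VW' Fi (\<lambda>b b'. tsum VW' (coprod H b) (\<lambda>p q. tsum VW' Fi (\<lambda>c d.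
      tsum VW' (coprod H b') (\<lambda>p' q'. tsum VW' Fi (\<lambda>c' d'. ?\<Phi> (p \<otimes> c) (q \<otimes> d \<otimes> x) (p' \<otimes> c' \<otimes> y) (q' \<otimes> d')))))))"
  proof -
    \<comment> \<open>\<open>hact_deform\<close> is used for each tensor factor in turn while the
      other one is held fixed.\<close>
    have key: "?p (hact V' b (VVd.D P (hact V x v))) (hact W' b' (WWd.D (?b y Q) w))
        = tsum VW' (coprod H b) (\<lambda>p q. tsum VW' Fi (\<lambda>c d.
      tsum VW' (coprod H b') (\<lambda>p' q'. tsum VW' Fi (\<lambda>c' d'. ?\<Phi> (p \<otimes> c) (q \<otimes> d \<otimes> x) (p' \<otimes> c' \<otimes> y) (q' \<otimes> d')))))"
      if H: "x \<in> carrier H" "y \<in> carrier H" "b \<in> carrier H" "b' \<in> carrier H" for x y b b'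
    proof -
      let ?w = "hact W' b' (WWd.D (?b y Q) w)"
      let ?l = "\<lambda>z. ?p z ?w"
      have w': "?w \<in> carrier W'"
        using H w Ql by (simp add: WW.adj_linear)
      have l: "?l \<in> linear_maps K V' VW'"
        using w' by (intro all_rules)
      have "?l (hact V' b (VVd.D P (hact V x v)))
          = tsum VW' (coprod H b) (\<lambda>p q. ?l (tsum V' Fi (\<lambda>c d. ?a (p \<otimes> c) P (hact V (q \<otimes> d) (hact V x v)))))"
        unfolding VVd.hact_deform[OF Pl H(3) VV.V.hact_closed[OF H(1) v]] using H v Pl
        by (intro HH.linear_tensor_lift[where h = ?l] VV.W_module M l HH.lift_closed) simp_all
      also have "\<dots> = tsum VW' (coprod H b) (\<lambda>p q. tsum VW' Fi (\<lambda>c d. ?l (?a (p \<otimes> c) P (hact V (q \<otimes> d) (hact V x v)))))"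
        using H v Pl by (intro lift_cong[OF coprod_closed] HH.linear_tensor_lift[where h = ?l] VV.W_module M l) simp_all
      also have "\<dots> = tsum VW' (coprod H b) (\<lambda>p q. tsum VW' Fi (\<lambda>c d.
          tsum VW' (coprod H b') (\<lambda>p' q'. tsum VW' Fi (\<lambda>c' d'. ?\<Phi> (p \<otimes> c) (q \<otimes> d \<otimes> x) (p' \<otimes> c' \<otimes> y) (q' \<otimes> d')))))"
      proof (intro lift_cong coprod_closed Fi_closed H)
        fix p q c d assume pqcd: "p \<in> carrier H" "q \<in> carrier H" "c \<in> carrier H" "d \<in> carrier H"
        let ?u = "?a (p \<otimes> c) P (hact V (q \<otimes> d \<otimes> x) v)"
        let ?r = "\<lambda>z. ?p ?u z"
        have u: "?u \<in> carrier V'"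
          using H pqcd v Pl by simp
        have r: "?r \<in> linear_maps K W' VW'"
          using u by (intro all_rules)
        have "?l (?a (p \<otimes> c) P (hact V (q \<otimes> d) (hact V x v))) = ?r ?w"
          using H pqcd v by (simp add: VV.V.hact_mult)
        also have "\<dots> = tsum VW' (coprod H b') (\<lambda>p' q'. ?r (tsum W' Fi (\<lambda>c' d'. ?b (p' \<otimes> c') (?b y Q) (hact W (q' \<otimes> d') w))))"
          unfolding WWd.hact_deform[OF WW.adj_linear[OF Ql H(2)] H(4) w] using H w Ql
          by (intro HH.linear_tensor_lift[where h = ?r] WW.W_module M r HH.lift_closed) (simp_all add: WW.adj_linear)
        also have "\<dots> = tsum VW' (coprod H b') (\<lambda>p' q'. tsum VW' Fi (\<lambda>c' d'. ?r (?b (p' \<otimes> c') (?b y Q) (hact W (q' \<otimes> d') w))))"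
          using H w Ql
          by (intro lift_cong[OF coprod_closed] HH.linear_tensor_lift[where h = ?r] WW.W_module M r) (simp_all add: WW.adj_linear)
        also have "\<dots> = tsum VW' (coprod H b') (\<lambda>p' q'. tsum VW' Fi (\<lambda>c' d'. ?\<Phi> (p \<otimes> c) (q \<otimes> d \<otimes> x) (p' \<otimes> c' \<otimes> y) (q' \<otimes> d')))"
          using H w by (intro lift_cong) (simp_all add: WW.adj_mult[OF Ql])
        finally show "?l (?a (p \<otimes> c) P (hact V (q \<otimes> d) (hact V x v)))
          = tsum VW' (coprod H b') (\<lambda>p' q'. tsum VW' Fi (\<lambda>c' d'. ?\<Phi> (p \<otimes> c) (q \<otimes> d \<otimes> x) (p' \<otimes> c' \<otimes> y) (q' \<otimes> d')))" .
      qed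
      finally show ?thesis .
    qed
    show ?thesis
      by (intro lift_cong[OF RFi_closed] lift_cong[OF Fi_closed] key)
  qed
  \<comment> \<open>From here the sum over the twisted R-matrix is moved inwards past one sum at a
    time, until it sits directly on the inner legs.\<close>
  also have "\<dots> = tsum VW' Fi (\<lambda>b b'. tsum VW' RFi (\<lambda>x y. tsum VW' (coprod H b) (\<lambda>p q. tsum VW' Fi (\<lambda>c d.
      tsum VW' (coprod H b') (\<lambda>p' q'. tsum VW' Fi (\<lambda>c' d'. ?\<Phi> (p \<otimes> c) (q \<otimes> d \<otimes> x) (p' \<otimes> c' \<otimes> y) (q' \<otimes> d')))))))"
    using v w Pl Ql by (intro lift_swap cl) simp_all
  also have "\<dots> = tsum VW' Fi (\<lambda>b b'. tsum VW' (coprod H b) (\<lambda>p q. tsum VW' RFi (\<lambda>x y. tsum VW' Fi (\<lambda>c d.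
      tsum VW' (coprod H b') (\<lambda>p' q'. tsum VW' Fi (\<lambda>c' d'. ?\<Phi> (p \<otimes> c) (q \<otimes> d \<otimes> x) (p' \<otimes> c' \<otimes> y) (q' \<otimes> d')))))))"
    using v w Pl Ql by (intro lift_cong[OF Fi_closed] lift_swap cl) simp_all
  also have "\<dots> = tsum VW' Fi (\<lambda>b b'. tsum VW' (coprod H b) (\<lambda>p q. tsum VW' Fi (\<lambda>c d. tsum VW' RFi (\<lambda>x y.
      tsum VW' (coprod H b') (\<lambda>p' q'. tsum VW' Fi (\<lambda>c' d'. ?\<Phi> (p \<otimes> c) (q \<otimes> d \<otimes> x) (p' \<otimes> c' \<otimes> y) (q' \<otimes> d')))))))"
    using v w Pl Ql by (intro lift_cong[OF Fi_closed] lift_cong[OF coprod_closed] lift_swap cl) simp_all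
  also have "\<dots> = tsum VW' Fi (\<lambda>b b'. tsum VW' (coprod H b) (\<lambda>p q. tsum VW' Fi (\<lambda>c d.
      tsum VW' (coprod H b') (\<lambda>p' q'. tsum VW' RFi (\<lambda>x y. tsum VW' Fi (\<lambda>c' d'. ?\<Phi> (p \<otimes> c) (q \<otimes> d \<otimes> x) (p' \<otimes> c' \<otimes> y) (q' \<otimes> d')))))))"
    using v w Pl Ql by (intro lift_cong[OF Fi_closed] lift_cong[OF coprod_closed] lift_swap cl) simp_all
  also have "\<dots> = tsum VW' Fi (\<lambda>b b'. tsum VW' (coprod H b) (\<lambda>p q. tsum VW' Fi (\<lambda>c d.
      tsum VW' (coprod H b') (\<lambda>p' q'. tsum VW' Fi (\<lambda>c' d'. tsum VW' RFi (\<lambda>x y. ?\<Phi> (p \<otimes> c) (q \<otimes> d \<otimes> x) (p' \<otimes> c' \<otimes> y) (q' \<otimes> d')))))))"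
    using v w Pl Ql by (intro lift_cong[OF Fi_closed] lift_cong[OF coprod_closed] lift_swap cl) simp_all
  also have "\<dots> = tsum VW' Fi (\<lambda>b b'. tsum VW' (coprod H b) (\<lambda>p q. tsum VW' Fi (\<lambda>c d.
      tsum VW' (coprod H b') (\<lambda>p' q'. tsum VW' Fi (\<lambda>c' d'. tsum VW' Ri (\<lambda>r r'. ?\<Phi> (p \<otimes> c) (r \<otimes> (p' \<otimes> c')) (r' \<otimes> (q \<otimes> d)) (q' \<otimes> d')))))))"
    by (rule tsum_cocycle4_R[OF M \<Phi>])
  \<comment> \<open>The other side is expanded until it matches: \<open>b\<close> acts on the
    R-tensor product through \<open>adj_tensor_R\<close>, and \<open>b'\<close> acts diagonally on
    the image of \<open>v\<close> and \<open>w\<close> under the isomorphism.\<close>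
  also have "\<dots> = tsum VW' Fi (\<lambda>b b'. adj_act H VW VW' b ?B (hact VW b' ?z))"
  proof (rule lift_cong[OF Fi_closed])
    fix b b' assume b: "b \<in> carrier H" "b' \<in> carrier H"
    let ?q = "\<lambda>p' q' c' d'. pure_tensor VW (hact V (p' \<otimes> c') v) (hact W (q' \<otimes> d') w)"
    have z: "hact VW b' ?z = tsum VW (coprod H b') (\<lambda>p' q'. tsum VW Fi (\<lambda>c' d'. ?q p' q' c' d'))"
    proof -
      have "hact VW b' ?z = tsum VW Fi (\<lambda>c' d'. hact VW b' (pure_tensor VW (hact V c' v) (hact W d' w)))"
        using b v w by (intro HH.linear_tensor_lift T.VW.T_module T.hact_VW_linear) (simp_all add: T.VW.pure_tensor_closed)
      also have "\<dots> = tsum VW Fi (\<lambda>c' d'. tsum VW (coprod H b') (\<lambda>p' q'. ?q p' q' c' d'))"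
        using b v w by (intro lift_cong[OF Fi_closed]) (simp add: T.hact_VW_pure VV.V.hact_mult WW.V.hact_mult cong: lift_cong)
      also have "\<dots> = tsum VW (coprod H b') (\<lambda>p' q'. tsum VW Fi (\<lambda>c' d'. ?q p' q' c' d'))"
        using b v w by (intro lift_swap T.VW.T_module) (simp_all add: T.VW.pure_tensor_closed)
      finally show ?thesis .
    qed
    have zc: "hact VW b' ?z \<in> carrier VW"
      using b v w by (intro linear_mapsD(1)[OF T.hact_VW_linear] HH.lift_closed T.VW.T_module) (simp_all add: T.VW.pure_tensor_closed)
    have "adj_act H VW VW' b ?B (hact VW b' ?z)
        = tsum VW' Fi (\<lambda>c d. adj_act H VW VW' b (tR (?a c P) (?b d Q)) (hact VW b' ?z))"
      using b zc by (intro VWd.adj_tsum linear_mapsD(1)[OF tensor_R_linear[OF adjR]]) simp_all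
    also have "\<dots> = tsum VW' Fi (\<lambda>c d. tsum VW' (coprod H b) (\<lambda>p q. tR (?a p (?a c P)) (?b q (?b d Q)) (hact VW b' ?z)))"
      using b zc by (intro lift_cong[OF Fi_closed] adj_tensor_R adjR) simp_all
    also have "\<dots> = tsum VW' (coprod H b) (\<lambda>p q. tsum VW' Fi (\<lambda>c d. tR (?a p (?a c P)) (?b q (?b d Q)) (hact VW b' ?z)))"
      using b zc
      by (intro lift_swap M linear_mapsD(1)[OF tensor_R_linear] VV.adj_right_linear[OF VV.adj_right_linear[OF P]]
          WW.adj_right_linear[OF WW.adj_right_linear[OF Q]]) simp_all
    also have "\<dots> = tsum VW' (coprod H b) (\<lambda>p q. tsum VW' Fi (\<lambda>c d. tsum VW' (coprod H b') (\<lambda>p' q'. tsum VW' Fi (\<lambda>c' d'.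
        tsum VW' Ri (\<lambda>r r'. ?\<Phi> (p \<otimes> c) (r \<otimes> (p' \<otimes> c')) (r' \<otimes> (q \<otimes> d)) (q' \<otimes> d'))))))"
    proof (intro lift_cong coprod_closed Fi_closed b)
      fix p q c d assume pqcd: "p \<in> carrier H" "q \<in> carrier H" "c \<in> carrier H" "d \<in> carrier H"
      let ?t = "tR (?a p (?a c P)) (?b q (?b d Q))"
      have PR: "?a p (?a c P) \<in> right_linear_maps K A V V'" "?b q (?b d Q) \<in> right_linear_maps K A W W'"
        using pqcd by (intro VV.adj_right_linear WW.adj_right_linear P Q; simp)+
      note t = tensor_R_linear[OF PR]
      have "?t (hact VW b' ?z) = tsum VW' (coprod H b') (\<lambda>p' q'. ?t (tsum VW Fi (\<lambda>c' d'. ?q p' q' c' d')))"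
        unfolding z using b v w
        by (intro HH.linear_tensor_lift[OF T.VW.T_module M t] HH.lift_closed T.VW.T_module) (simp_all add: T.VW.pure_tensor_closed)
      also have "\<dots> = tsum VW' (coprod H b') (\<lambda>p' q'. tsum VW' Fi (\<lambda>c' d'. ?t (?q p' q' c' d')))"
        using b v w
        by (intro lift_cong[OF coprod_closed] HH.linear_tensor_lift[OF T.VW.T_module M t]) (simp_all add: T.VW.pure_tensor_closed)
      also have "\<dots> = tsum VW' (coprod H b') (\<lambda>p' q'. tsum VW' Fi (\<lambda>c' d'.
          tsum VW' Ri (\<lambda>r r'. ?\<Phi> (p \<otimes> c) (r \<otimes> (p' \<otimes> c')) (r' \<otimes> (q \<otimes> d)) (q' \<otimes> d'))))"
      proof (intro lift_cong[OF coprod_closed] lift_cong[OF Fi_closed] b)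
        fix p' q' c' d' assume H: "p' \<in> carrier H" "q' \<in> carrier H" "c' \<in> carrier H" "d' \<in> carrier H"
        have "?t (?q p' q' c' d') = tsum VW' Ri (\<lambda>r r'. ?p (?a p (?a c P) (hact V r (hact V (p' \<otimes> c') v)))
            (?b r' (?b q (?b d Q)) (hact W (q' \<otimes> d') w)))"
          using H v w by (intro tensor_R_pure[OF PR]) simp_all
        also have "\<dots> = tsum VW' Ri (\<lambda>r r'. ?\<Phi> (p \<otimes> c) (r \<otimes> (p' \<otimes> c')) (r' \<otimes> (q \<otimes> d)) (q' \<otimes> d'))"
        proof (rule lift_cong[OF Ri_closed])
          fix r r' assume r: "r \<in> carrier H" "r' \<in> carrier H"
          \<comment> \<open>The two inner adjoint actions are merged under the outer one, which
            calls for \<open>adj_cong\<close>.\<close>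
          have "?b r' (?b q (?b d Q)) (hact W (q' \<otimes> d') w) = ?b r' (?b (q \<otimes> d) Q) (hact W (q' \<otimes> d') w)"
            using r H pqcd w by (intro WW.adj_cong) (simp_all add: WW.adj_mult[OF Ql])
          then show "?p (?a p (?a c P) (hact V r (hact V (p' \<otimes> c') v))) (?b r' (?b q (?b d Q)) (hact W (q' \<otimes> d') w))
              = ?\<Phi> (p \<otimes> c) (r \<otimes> (p' \<otimes> c')) (r' \<otimes> (q \<otimes> d)) (q' \<otimes> d')"
            using r H pqcd v w by (simp add: VV.adj_mult[OF Pl] WW.adj_mult[OF Ql] VV.V.hact_mult)
        qed
        finally show "?t (?q p' q' c' d') = tsum VW' Ri (\<lambda>r r'. ?\<Phi> (p \<otimes> c) (r \<otimes> (p' \<otimes> c')) (r' \<otimes> (q \<otimes> d)) (q' \<otimes> d'))" .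
      qed
      finally show "?t (hact VW b' ?z) = tsum VW' (coprod H b') (\<lambda>p' q'. tsum VW' Fi (\<lambda>c' d'.
          tsum VW' Ri (\<lambda>r r'. ?\<Phi> (p \<otimes> c) (r \<otimes> (p' \<otimes> c')) (r' \<otimes> (q \<otimes> d)) (q' \<otimes> d'))))" .
    qed
    finally show "tsum VW' (coprod H b) (\<lambda>p q. tsum VW' Fi (\<lambda>c d. tsum VW' (coprod H b') (\<lambda>p' q'. tsum VW' Fi (\<lambda>c' d'.
        tsum VW' Ri (\<lambda>r r'. ?\<Phi> (p \<otimes> c) (r \<otimes> (p' \<otimes> c')) (r' \<otimes> (q \<otimes> d)) (q' \<otimes> d'))))))
      = adj_act H VW VW' b ?B (hact VW b' ?z)" by simp
  qed
  also have "\<dots> = VWd.D ?B ?z"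
    by (simp add: deform_def)
  finally show ?thesis .
qed

text \<open>The additive maps on both sides move inside their lifts, which are then evaluated on one
  and the same representative of \<open>t\<close>. It remains to compare the integrands, and that is
  \<open>tensor_R_deform_pure\<close>.\<close>

lemma tensor_R_deform:
  assumes P: "P \<in> right_linear_maps K A V V'" and Q: "Q \<in> right_linear_maps K A W W'"
    and t: "t \<in> carrier S.VWs"
  shows "S'.\<phi> (tensor_R K HF RF S.As S.Vs S'.Vs S.Ws S'.Ws (VVd.D P) (WWd.D Q) t)
    = VWd.D (\<lambda>s. tsum VW' Fi (\<lambda>x y. tR (adj_act H V V' x P) (adj_act H W W' y Q) s)) (S.\<phi> t)"
proof -
  note Pl = VV.right_linear_mapsD(1)[OF P] and Ql = WW.right_linear_mapsD(1)[OF Q]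
  let ?B = "\<lambda>s. tsum VW' Fi (\<lambda>x y. tR (adj_act H V V' x P) (adj_act H W W' y Q) s)"
  let ?f = "\<lambda>v w. tsum S'.VWs RFi (\<lambda>x y. pure_tensor S'.VWs (VVd.D P (hact V x v)) (adj_act HF W W' y (WWd.D Q) w))"
  let ?g = "\<lambda>v w. tsum VW Fi (\<lambda>c d. pure_tensor VW (hact V c v) (hact W d w))"
  have f: "?f v w \<in> carrier S'.VWs" if "v \<in> carrier V" "w \<in> carrier W" for v w
    using that Pl Ql
    by (intro HH.tensor_lift_closed S'.VWs.T_abelian_group S'.VWs.pure_tensor_closed)
      (simp_all add: WWd.adj_HF_deform WW.adj_linear)
  have g: "?g v w \<in> carrier VW" if "v \<in> carrier V" "w \<in> carrier W" for v w
    using that by (intro HH.lift_closed T.VW.T_module) (simp_all add: T.VW.pure_tensor_closed)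
  have B: "?B \<in> linear_maps K VW VW'"
    by (intro lift_linear_param T'.VW.T_module T.VW.T_module tensor_R_linear VV.adj_right_linear
        WW.adj_right_linear P Q Fi_closed)
  have "S'.\<phi> (tensor_R K HF RF S.As S.Vs S'.Vs S.Ws S'.Ws (VVd.D P) (WWd.D Q) t) = tensor_lift VW' (\<lambda>v w. S'.\<phi> (?f v w)) t"
    unfolding tensor_R_star_eq
    by (rule S.VWs.additive_map_tensor_lift[OF S'.VWs.T_abelian_group T'.VW.T_abelian_group S'.twist_iso_additive t f])
  also have "\<dots> = tensor_lift VW' (\<lambda>v w. VWd.D ?B (?g v w)) t"
    by (rule S.VWs.tensor_lift_cong[OF t tensor_R_deform_pure[OF P Q]])
  also have "\<dots> = VWd.D ?B (S.\<phi> t)"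
    unfolding S.twist_iso_eq
    by (rule S.VWs.additive_map_tensor_lift[OF T.VW.T_abelian_group T'.VW.T_abelian_group
          linear_maps_additive[OF VWd.deform_linear[OF B]] t g, symmetric])
  finally show ?thesis .
qed

end

theorem theorem3p5:
  fixes K :: "'k ring" and H :: "('k, 'h) hopf" and R F :: "('h, 'h) tensor"
    and A :: "('k, 'h, 'a) hmod"
    and V :: "('k, 'h, 'a, 'v) hbimod" and V' :: "('k, 'h, 'a, 'v1) hbimod"
    and W :: "('k, 'h, 'a, 'w) hbimod" and W' :: "('k, 'h, 'a, 'w1) hbimod"
  assumes "quasitriangular_hopf_algebra K H R"
    and "is_twist K H F"
    and "hmodule_algebra K H A" and "quasi_commutative_algebra K H R A"
    and "hmodule_bimodule K H A V" and "quasi_commutative_bimodule K H R A V"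
    and "hmodule_bimodule K H A V'" and "quasi_commutative_bimodule K H R A V'"
    and "hmodule_bimodule K H A W" and "quasi_commutative_bimodule K H R A W"
    and "hmodule_bimodule K H A W'" and "quasi_commutative_bimodule K H R A W'"
    and "P \<in> right_linear_maps K A V V'" and "Q \<in> right_linear_maps K A W W'"
  defines "HF \<equiv> twist_hopf K F H" and "RF \<equiv> twist_R K F H R"
    and "As \<equiv> star_algebra K F H A"
    and "Vs \<equiv> star_bimod K F H A V" and "Vs' \<equiv> star_bimod K F H A V'"
    and "Ws \<equiv> star_bimod K F H A W" and "Ws' \<equiv> star_bimod K F H A W'"
    and "VW \<equiv> tensor_bimod H A V W" and "VW' \<equiv> tensor_bimod H A V' W'"
  shows "\<forall>t \<in> carrier (tensor_bimod HF As Vs Ws).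
    (twist_iso K F H A V' W' \<circ>
      tensor_R K HF RF As Vs Vs' Ws Ws' (deform K F H V V' P) (deform K F H W W' Q)) t =
    (deform K F H VW VW'
      (\<lambda>s. tensor_lift VW'
        (\<lambda>x y. tensor_R K H R A V V' W W' (adj_act H V V' x P) (adj_act H W W' y Q) s)
        (inv\<^bsub>tensor2 K H\<^esub> F)) \<circ>
      twist_iso K F H A V W) t"
proof -
  have "hopf_algebra K H"
    using assms(1) by (simp add: quasitriangular_hopf_algebra_def)
  then interpret quasi_commutative_setting K H R F A V V' W W'
    using assms(1-12)
    by (intro quasi_commutative_setting.intro twisted_hopf_algebra.intro hmodule_bimodule_pair.intro
        twisted_hopf_algebra_axioms.intro quasi_commutative_setting_axioms.intro)
  show ?thesis
    unfolding HF_def RF_def As_def Vs_def Vs'_def Ws_def Ws'_def VW_def VW'_def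
    using tensor_R_deform[OF assms(13,14)] by simp
qed

end
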